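(* Let $1<p\le q<\infty$ and let $t<s<t+d$ be real numbers. Let $v,w$ be weights on $\mathbb R^d$ with $(v,w)\in A_{p,q}^{s-t}$ and $v^{-p'/p},w\in A_\infty$, and set $\tau=\max\{-d,-t\}$. Then there is a constant $C>0$, depending on $v,w,p,q,d,s,t$ but not on $f$, such that for every $f\in D^{>\tau}\mathcal S(\mathbb R^d)$ there exists a polynomial $P$ of degree at most $\lfloor s-t\rfloor$ with $$\|D^tf-P\|_{L^q(w)}\le C\,\|D^sf\|_{L^p(v)}.$$
   Context: A weight is a locally integrable function $w$ on $\mathbb R^d$ with $0<w(x)<\infty$ for a.e. $x$, and $\|f\|_{L^p(w)}^p=\int_{\mathbb R^d}|f|^pw\,dx$. $p'$ is the conjugate exponent of $p$. Cubes $Q$ have sides parallel to the axes. For $1<p<\infty$, $w\in A_p$ iff $\sup_Q\big(\frac1{|Q|}\int_Qw^{-p'/p}\big)^{p-1}\frac1{|Q|}\int_Qw<\infty$; $A_\infty=\bigcup_{1<p<\infty}A_p$. For $1<p,q<\infty$, $\alpha\in\mathbb R$, a pair of weights $(v,w)$ is in $A_{p,q}^\alpha$ iff $\sup_Q|Q|^{\frac\alpha d-1}\big(\int_Qv^{-p'/p}\big)^{1/p'}\big(\int_Qw\big)^{1/q}<\infty$. Fourier transform: $\hat g(\xi)=\int e^{-2\pi ix\cdot\xi}g(x)\,dx$. For $g\in\mathcal S(\mathbb R^d)$ and $\operatorname{Re}(z)>-d$, $D^zg(x)=\int e^{2\pi ix\cdot\xi}|\xi|^z\hat g(\xi)\,d\xi$.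 For $a\ge -d$, $D^{>a}\mathcal S(\mathbb R^d)=\{f\in L^\infty: f=D^bg\text{ for some }g\in\mathcal S(\mathbb R^d)\text{ and real }b>a\}$. For $f=D^bg$ with $b>-d$ and $b+\sigma>-d$, one sets $D^\sigma f(x)=\int e^{2\pi ix\cdot\xi}|\xi|^{\sigma}|\xi|^{b}\hat g(\xi)\,d\xi$. *)

theory Defs
  imports "HOL-Analysis.Analysis"
begin

definition conj_exp :: "real \<Rightarrow> real" where
  "conj_exp p = p / (p - 1)"

text \<open>Powers of \<open>[0,\<infinity>]\<close>-valued quantities; only used with exponent \<open>a > 0\<close>,
  where \<open>\<infinity>\<close> to the power \<open>a\<close> is \<open>\<infinity>\<close>.\<close>

definition ennreal_powr :: "ennreal \<Rightarrow> real \<Rightarrow> ennreal" where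
  "ennreal_powr x a = (if x = \<infinity> then \<infinity> else ennreal (enn2real x powr a))"


section \<open>Weights\<close>

text \<open>The condition \<open>0 < w(x) < \<infinity>\<close> a.e. is rendered by a real-valued function that is
  positive a.e.; its values on a null set are irrelevant everywhere below.\<close>

definition weight :: "(real^'n \<Rightarrow> real) \<Rightarrow> bool" where
  "weight w \<longleftrightarrow> (\<forall>K. compact K \<longrightarrow> set_integrable lebesgue K w) \<and> (AE x in lebesgue. 0 < w x)"

definition cubes :: "(real^'n) set set" where
  "cubes = {cbox a (a + vec l) | a l. 0 < l}"

definition A_p :: "real \<Rightarrow> (real^'n \<Rightarrow> real) set" where
  "A_p p = {w. weight w \<and>
     (SUP Q\<in>cubes.
        ennreal_powr ((\<integral>\<^sup>+x\<in>Q. ennreal (w x powr (- conj_exp p / p)) \<partial>lebesgue) / emeasure lebesgue Q) (p - 1)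
        * ((\<integral>\<^sup>+x\<in>Q. ennreal (w x) \<partial>lebesgue) / emeasure lebesgue Q)) < \<infinity>}"

definition A_infty :: "(real^'n \<Rightarrow> real) set" where
  "A_infty = (\<Union>p\<in>{1<..}. A_p p)"

definition A_pq :: "real \<Rightarrow> real \<Rightarrow> real \<Rightarrow> ((real^'n \<Rightarrow> real) \<times> (real^'n \<Rightarrow> real)) set" where
  "A_pq \<alpha> p q = {(v, w). weight v \<and> weight w \<and>
     (SUP Q\<in>cubes.
        ennreal (measure lebesgue Q powr (\<alpha> / real CARD('n) - 1))
        * ennreal_powr (\<integral>\<^sup>+x\<in>Q. ennreal (v x powr (- conj_exp p / p)) \<partial>lebesgue) (1 / conj_exp p)
        * ennreal_powr (\<integral>\<^sup>+x\<in>Q. ennreal (w x) \<partial>lebesgue) (1 / q)) < \<infinity>}"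

text \<open>The weighted norm takes values in \<open>[0,\<infinity>]\<close>; it is \<open>\<infinity>\<close> for functions outside the space.\<close>

definition Lp_norm :: "real \<Rightarrow> (real^'n \<Rightarrow> real) \<Rightarrow> (real^'n \<Rightarrow> complex) \<Rightarrow> ennreal" where
  "Lp_norm p w f = ennreal_powr (\<integral>\<^sup>+x. ennreal (norm (f x) powr p * w x) \<partial>lebesgue) (1 / p)"


section \<open>Polynomials and Schwartz functions\<close>

definition monomial :: "('n \<Rightarrow> nat) \<Rightarrow> real^'n \<Rightarrow> real" where
  "monomial \<alpha> x = (\<Prod>i\<in>UNIV. (x $ i) ^ \<alpha> i)"

definition polynomial_of_degree_le :: "nat \<Rightarrow> (real^'n \<Rightarrow> complex) \<Rightarrow> bool" where
  "polynomial_of_degree_le m P \<longleftrightarrow>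
     (\<exists>c :: ('n \<Rightarrow> nat) \<Rightarrow> complex.
        \<forall>x. P x = (\<Sum>\<alpha> | (\<Sum>i\<in>UNIV. \<alpha> i) \<le> m. c \<alpha> * of_real (monomial \<alpha> x)))"

definition partial_deriv :: "'n \<Rightarrow> (real^'n \<Rightarrow> complex) \<Rightarrow> real^'n \<Rightarrow> complex" where
  "partial_deriv i g x = vector_derivative (\<lambda>h. g (x + h *\<^sub>R axis i 1)) (at 0)"

primrec iter_partial_deriv :: "'n list \<Rightarrow> (real^'n \<Rightarrow> complex) \<Rightarrow> real^'n \<Rightarrow> complex" where
  "iter_partial_deriv [] g = g"
| "iter_partial_deriv (i # js) g = partial_deriv i (iter_partial_deriv js g)"

text \<open>All iterated partial derivatives being (Frechet) differentiable everywhere means that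
  \<open>g\<close> is infinitely differentiable. A list \<open>js\<close> of coordinates stands for the derivative of
  multi-index \<open>count_list js\<close>.\<close>

definition schwartz :: "(real^'n \<Rightarrow> complex) set" where
  "schwartz = {g.
     (\<forall>js x. iter_partial_deriv js g differentiable (at x)) \<and>
     (\<forall>js \<alpha>. bounded (range (\<lambda>x. of_real (monomial \<alpha> x) * iter_partial_deriv js g x)))}"


section \<open>Fractional derivatives\<close>

definition fourier :: "(real^'n \<Rightarrow> complex) \<Rightarrow> real^'n \<Rightarrow> complex" where
  "fourier g \<xi> = (LINT x|lebesgue. exp (- 2 * of_real pi * \<i> * of_real (x \<bullet> \<xi>)) * g x)"

text \<open>Real orders \<open>b > -d\<close> suffice here. The value of \<open>0 powr b\<close> only affects the
  integrand at the origin.\<close>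

definition frac_deriv_schwartz :: "real \<Rightarrow> (real^'n \<Rightarrow> complex) \<Rightarrow> real^'n \<Rightarrow> complex" where
  "frac_deriv_schwartz b g x =
     (LINT \<xi>|lebesgue. exp (2 * of_real pi * \<i> * of_real (x \<bullet> \<xi>)) * of_real (norm \<xi> powr b) * fourier g \<xi>)"

definition L_infty :: "(real^'n \<Rightarrow> complex) set" where
  "L_infty = {f. f \<in> borel_measurable lebesgue \<and> (\<exists>M. AE x in lebesgue. norm (f x) \<le> M)}"

text \<open>Equality of elements of \<open>L_infty\<close> is equality a.e.\<close>

definition D_gt_schwartz :: "real \<Rightarrow> (real^'n \<Rightarrow> complex) set" where
  "D_gt_schwartz a = {f \<in> L_infty. \<exists>g\<in>schwartz. \<exists>b>a. AE x in lebesgue. f x = frac_deriv_schwartz b g x}"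

text \<open>The function \<open>D\<^sup>\<sigma> f\<close> for \<open>f = D\<^sup>b g\<close>. It does not depend on the choice
  of \<open>(b, g)\<close>: since \<open>b > -d\<close>, the function \<open>|\<xi>|\<^sup>b\<close> times the Fourier transform of \<open>g\<close> is integrable,
  hence determined a.e. by its inverse Fourier transform \<open>f\<close>.\<close>

definition frac_deriv :: "real \<Rightarrow> (real^'n \<Rightarrow> complex) \<Rightarrow> real^'n \<Rightarrow> complex" where
  "frac_deriv \<sigma> f = (THE h. \<exists>g\<in>schwartz. \<exists>b. b > - real CARD('n) \<and> b + \<sigma> > - real CARD('n) \<and>
     (AE x in lebesgue. f x = frac_deriv_schwartz b g x) \<and>
     h = (\<lambda>x. LINT \<xi>|lebesgue. exp (2 * of_real pi * \<i> * of_real (x \<bullet> \<xi>)) *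
            of_real (norm \<xi> powr \<sigma>) * of_real (norm \<xi> powr b) * fourier g \<xi>))"

end

theory Submission
  imports Defs "HOL-Probability.Characteristic_Functions"
begin

text \<open>
  Write \<open>f = D\<^sup>b g\<close>, \<open>h = D\<^sup>s f\<close> and \<open>\<alpha> = s - t\<close>. Since \<open>b + t > 0\<close>, both \<open>D\<^sup>s f\<close> and \<open>D\<^sup>t f\<close> are inverse
  Fourier transforms of integrable functions, and \<open>D\<^sup>t f\<close> is obtained from \<open>h\<close> by dividing the
  symbol by \<open>|\<xi>|\<^sup>\<alpha>\<close>. Writing \<open>|\<xi>|\<close> to the power \<open>- \<alpha>\<close> as a superposition of Gaussians gives the pointwise
  bound of \<open>|D\<^sup>t f|\<close> by a multiple of the Riesz potential of order \<open>\<alpha>\<close> of \<open>|h|\<close>, so that \<open>P = 0\<close> works.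

  The two-weight bound for the Riesz potential follows by sparse domination. The kernel is dominated
  by sums over finitely many translated dyadic grids; in each grid, cubes are sorted by the
  dyadic size of the average of \<open>|h|\<close> and only those are kept that are not contained in a larger cube of
  at least the same size class. The kept family is sparse for Lebesgue measure, hence by \<open>A\<^sub>\<infinity>\<close> also for
  \<open>w\<close> and for \<open>v\<close> to the power \<open>- p'/p\<close>. Duality, the \<open>A\<^sub>p\<^sub>,\<^sub>q\<close> condition, Hoelder's inequality with \<open>p \<le> q\<close> and the
  Carleson embedding theorem for both measures conclude.
\<close>

section \<open>Carleson embedding and sparse selection for finite laminar families\<close>

text \<open>The weighted estimates are made for finite families of cubes, with constants independent
  of the family. Finiteness closes the duality argument: the integral X of the q-th power of the
  dyadic operator against w satisfies X \<le> Y * J^(1/p) * X^(1/q'), and X^(1/q') can be cancelled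
  only because X is finite. Monotone convergence then removes the truncation. Cubes inside a kept
  cube R are harmless because the factor 2^(-\<alpha> k) at level k makes their contributions sum
  geometrically to that of R. \<open>A_infty\<close> enters through one consequence only: a subset
  of at least half the Lebesgue measure of a cube carries a fixed proportion of its weight. The
  weight v acts through \<sigma> = v^(-p'/p): the norm of h / \<sigma> in L^p(\<sigma>) is that of h
  in L^p(v). On the Fourier side, f may come from several pairs (b, g), and the symbol |\<xi>|^b may
  blow up at the origin. That f nevertheless determines D^s f is shown by testing against Gaussians
  that concentrate at points other than the origin.\<close>

definition laminar :: "'a set set \<Rightarrow> bool" where
  "laminar F \<longleftrightarrow> (\<forall>A\<in>F. \<forall>B\<in>F. A \<subseteq> B \<or> B \<subseteq> A \<or> A \<inter> B = {})"

lemma laminarD: "laminar F \<Longrightarrow> A \<in> F \<Longrightarrow> B \<in> F \<Longrightarrow> A \<subseteq> B \<or> B \<subseteq> A \<or> A \<inter> B = {}"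
  unfolding laminar_def by blast

lemma laminar_subset: "laminar F \<Longrightarrow> G \<subseteq> F \<Longrightarrow> laminar G"
  unfolding laminar_def by blast

text \<open>The inclusion-maximal members serve: by finiteness every member lies in one of them, and
  two distinct ones cannot be nested, so laminarity makes them disjoint.\<close>

lemma laminar_maximal_disjoint:
  assumes "finite F" "laminar F"
  obtains H where "H \<subseteq> F" "disjoint H" "\<Union>H = \<Union>F"
proof
  let ?H = "{A\<in>F. \<forall>B\<in>F. A \<subseteq> B \<longrightarrow> A = B}"
  show "?H \<subseteq> F" by blast
  show "disjoint ?H"
  proof (rule disjointI)
    fix A B assume "A \<in> ?H" "B \<in> ?H" "A \<noteq> B"
    then show "A \<inter> B = {}" using laminarD[OF assms(2), of A B] by auto
  qed
  show "\<Union>?H = \<Union>F"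
  proof
    show "\<Union>F \<subseteq> \<Union>?H"
    proof
      fix x assume "x \<in> \<Union>F"
      then obtain A where A: "A \<in> F" "x \<in> A" by blast
      obtain B where B: "B \<in> F" "A \<subseteq> B" "\<forall>C\<in>F. B \<subseteq> C \<longrightarrow> C = B"
        using finite_has_maximal2[OF assms(1) A(1)] by metis
      then have "B \<in> ?H" by auto
      then show "x \<in> \<Union>?H" using A B by blast
    qed
  qed blast
qed

lemma sum_indicator_disjoint:
  assumes "finite H" "disjoint H"
  shows "(\<Sum>Q\<in>H. indicator Q x :: ennreal) \<le> 1"
  using assms
proof (induction H rule: finite_induct)
  case (insert A H)
  have dis: "A \<inter> B = {}" if "B \<in> H" for B
    using insert.prems insert.hyps that unfolding disjoint_def by (metis insertCI)
  show ?case
  proof (cases "x \<in> A")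
    case True
    then have "indicator B x = (0::ennreal)" if "B \<in> H" for B
      using dis[OF that] by (auto simp: indicator_def)
    then have "(\<Sum>B\<in>H. indicator B x :: ennreal) = 0" by simp
    then show ?thesis using insert.hyps True by simp
  next
    case False
    have "disjoint H" using insert.prems unfolding disjoint_def by blast
    then show ?thesis using insert False by simp
  qed
qed simp

text \<open>On a maximal member the values of \<phi> below t/2 account for at most half of the mass
  t * |Q|, and that half cancels because Q has finite measure. Keeping only the values above t/2 on
  the right is what later allows interpolation between weak and strong bounds.\<close>

lemma maximal_weak_type:
  fixes \<phi> :: "'a \<Rightarrow> real"
  assumes F: "finite F" "laminar F" "F \<subseteq> sets M" "\<And>Q. Q \<in> F \<Longrightarrow> emeasure M Q < \<infinity>"
    and [measurable]: "\<phi> \<in> borel_measurable M" and "0 < t"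
    and av: "\<And>Q. Q \<in> F \<Longrightarrow> ennreal t * emeasure M Q \<le> (\<integral>\<^sup>+x\<in>Q. ennreal (\<phi> x) \<partial>M)"
  shows "ennreal (t / 2) * emeasure M (\<Union>F) \<le> (\<integral>\<^sup>+x. ennreal (\<phi> x) * indicator {x. t / 2 < \<phi> x} x \<partial>M)"
proof -
  obtain H where H: "H \<subseteq> F" "disjoint H" "\<Union>H = \<Union>F"
    using laminar_maximal_disjoint[OF F(1,2)] by blast
  have finH: "finite H" using H(1) F(1) finite_subset by blast
  let ?g = "\<lambda>x. ennreal (\<phi> x) * indicator {x. t / 2 < \<phi> x} x"
  have [measurable]: "Q \<in> sets M" if "Q \<in> H" for Q using that H F by blast
  have each: "ennreal (t / 2) * emeasure M Q \<le> (\<integral>\<^sup>+x\<in>Q. ?g x \<partial>M)" if "Q \<in> H" for Q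
  proof -
    have [measurable]: "Q \<in> sets M" using that by simp
    have Qf: "emeasure M Q \<noteq> \<infinity>" using F(4) H(1) that by (metis less_irrefl subsetD)
    have "(\<integral>\<^sup>+x\<in>Q. ennreal (\<phi> x) \<partial>M) \<le> (\<integral>\<^sup>+x. ?g x * indicator Q x + ennreal (t/2) * indicator Q x \<partial>M)"
      by (intro nn_integral_mono) (auto simp: indicator_def ennreal_leI)
    also have "\<dots> = (\<integral>\<^sup>+x\<in>Q. ?g x \<partial>M) + ennreal (t/2) * emeasure M Q"
      by (subst nn_integral_add) (auto simp: nn_integral_cmult_indicator)
    finally have "ennreal t * emeasure M Q \<le> (\<integral>\<^sup>+x\<in>Q. ?g x \<partial>M) + ennreal (t/2) * emeasure M Q"
      using av[of Q] that H(1) by (meson order_trans subsetD)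
    moreover have "ennreal t * emeasure M Q = ennreal (t/2) * emeasure M Q + ennreal (t/2) * emeasure M Q"
      using \<open>0 < t\<close> by (simp flip: distrib_right ennreal_plus)
    moreover have "ennreal (t/2) * emeasure M Q \<noteq> \<infinity>" using Qf by (simp add: ennreal_mult_eq_top_iff)
    ultimately show ?thesis
      by (simp add: ennreal_add_left_cancel_le add.commute)
  qed
  have "emeasure M (\<Union>H) \<le> (\<Sum>Q\<in>H. emeasure M Q)"
    using emeasure_subadditive_finite[OF finH, of "\<lambda>x. x" M] by (simp add: subset_eq)
  then have "ennreal (t / 2) * emeasure M (\<Union>F) \<le> ennreal (t/2) * (\<Sum>Q\<in>H. emeasure M Q)"
    unfolding H(3)[symmetric] by (rule mult_left_mono) simp
  also have "\<dots> \<le> (\<Sum>Q\<in>H. (\<integral>\<^sup>+x\<in>Q. ?g x \<partial>M))"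
    unfolding sum_distrib_left by (intro sum_mono each)
  also have "\<dots> = (\<integral>\<^sup>+x. (\<Sum>Q\<in>H. ?g x * indicator Q x) \<partial>M)"
    by (rule nn_integral_sum[symmetric]) measurable
  also have "\<dots> \<le> (\<integral>\<^sup>+x. ?g x \<partial>M)"
  proof (intro nn_integral_mono)
    fix x
    have "(\<Sum>Q\<in>H. indicator Q x :: ennreal) \<le> 1"
      using sum_indicator_disjoint[OF finH H(2)] .
    then have "?g x * (\<Sum>Q\<in>H. indicator Q x) \<le> ?g x * 1" by (intro mult_left_mono) auto
    then show "(\<Sum>Q\<in>H. ?g x * indicator Q x) \<le> ?g x" by (simp add: sum_distrib_left)
  qed
  finally show ?thesis .
qed

section \<open>The Carleson embedding theorem\<close>

lemma nn_integral_powr_below: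
  assumes "-1 < a" "0 \<le> c"
  shows "(\<integral>\<^sup>+t. ennreal (t powr a) * indicator {0<..<c} t \<partial>lborel) = ennreal (c powr (a + 1) / (a + 1))"
proof -
  have "((\<lambda>x. x powr a) has_integral c powr (a + 1) / (a + 1)) {0..c}"
    using has_integral_powr_from_0[OF assms] .
  then have "(\<integral>\<^sup>+x. ennreal (x powr a) * indicator {0..c} x \<partial>lborel) = ennreal (c powr (a+1)/(a+1))"
    by (intro nn_integral_has_integral_lebesgue') auto
  moreover have "(\<integral>\<^sup>+x. ennreal (x powr a) * indicator {0..c} x \<partial>lborel)
      = (\<integral>\<^sup>+t. ennreal (t powr a) * indicator {0<..<c} t \<partial>lborel)"
    using AE_lborel_singleton[of 0] AE_lborel_singleton[of c]
    by (intro nn_integral_cong_AE) (auto simp: indicator_def)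
  ultimately show ?thesis by simp
qed

text \<open>Layer cake over heights t: the members with a Q > t have total measure at most c times
  that of their sets E Q, hence at most 2 * c times that of their union, to which
  \<open>maximal_weak_type\<close> applies. After exchanging the integrals, t^(p-2) is integrated
  over (0, 2 * \<phi> x), which converges because p > 1. In the constant, 4 is 2 for the overlap
  times 2 from the height t/2.\<close>

lemma carleson_embedding:
  fixes \<phi> :: "'a \<Rightarrow> real" and a :: "'a set \<Rightarrow> real"
  assumes "sigma_finite_measure M"
    and F: "finite F" "laminar F" "F \<subseteq> sets M" "\<And>Q. Q \<in> F \<Longrightarrow> emeasure M Q < \<infinity>"
    and [measurable]: "\<phi> \<in> borel_measurable M" and "1 < p" "0 \<le> c"
    and a: "\<And>Q. Q \<in> F \<Longrightarrow> 0 \<le> a Q"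
    and av: "\<And>Q. Q \<in> F \<Longrightarrow> ennreal (a Q) * emeasure M Q \<le> (\<integral>\<^sup>+x\<in>Q. ennreal (\<phi> x) \<partial>M)"
    and E: "\<And>Q. Q \<in> F \<Longrightarrow> E Q \<in> sets M" "\<And>Q. Q \<in> F \<Longrightarrow> E Q \<subseteq> Q"
      "\<And>Q. Q \<in> F \<Longrightarrow> emeasure M Q \<le> ennreal c * emeasure M (E Q)"
    and overlap: "\<And>x. card {Q\<in>F. x \<in> E Q} \<le> 2"
  shows "(\<Sum>Q\<in>F. ennreal (a Q powr p) * emeasure M Q)
    \<le> ennreal (4 * c * p * 2 powr (p - 1) / (p - 1)) * (\<integral>\<^sup>+x. ennreal (\<phi> x powr p) \<partial>M)"
proof -
  interpret sigma_finite_measure M by fact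
  interpret P: pair_sigma_finite M lborel
    by (rule pair_sigma_finite.intro) (auto intro: sigma_finite_lborel assms(1))
  define W where "W t = (\<integral>\<^sup>+x. ennreal (\<phi> x) * indicator {x. t / 2 < \<phi> x} x \<partial>M)" for t
  \<comment> \<open>\<open>m t\<close> is the total measure, with multiplicity, of the members of
    height above t; the sum to be bounded is its integral against p * t^(p-1).\<close>
  define m where "m t = (\<Sum>Q\<in>F. indicator {t. t < a Q} t * emeasure M Q)" for t :: real
  have m_le: "m t \<le> ennreal (4 * c / t) * W t" if "0 < t" for t
  proof -
    let ?G = "{Q\<in>F. t < a Q}"
    have G: "finite ?G" "?G \<subseteq> F" using F(1) by auto
    have "m t = (\<Sum>Q\<in>?G. emeasure M Q)"
      unfolding m_def by (rule sum.mono_neutral_cong_right) (use F(1) in \<open>auto simp: indicator_def\<close>)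
    also have "\<dots> \<le> (\<Sum>Q\<in>?G. ennreal c * emeasure M (E Q))"
      by (intro sum_mono E(3)) auto
    also have "\<dots> = ennreal c * (\<Sum>Q\<in>?G. emeasure M (E Q))"
      by (simp add: sum_distrib_left)
    also have "(\<Sum>Q\<in>?G. emeasure M (E Q)) = (\<Sum>Q\<in>?G. (\<integral>\<^sup>+x. indicator (E Q) x \<partial>M))"
      by (intro sum.cong refl nn_integral_indicator[symmetric]) (use E(1) in auto)
    also have "\<dots> = (\<integral>\<^sup>+x. (\<Sum>Q\<in>?G. indicator (E Q) x) \<partial>M)"
      by (rule nn_integral_sum[symmetric]) (use E(1) in auto)
    also have "\<dots> \<le> (\<integral>\<^sup>+x. 2 * indicator (\<Union>?G) x \<partial>M)"
    proof (intro nn_integral_mono)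
      fix x
      have eq: "(\<Sum>Q\<in>?G. indicator (E Q) x :: ennreal) = (\<Sum>Q\<in>{Q\<in>?G. x \<in> E Q}. 1)"
        by (rule sum.mono_neutral_cong_right) (use F(1) in \<open>auto simp: indicator_def\<close>)
      show "(\<Sum>Q\<in>?G. indicator (E Q) x) \<le> (2 * indicator (\<Union>?G) x :: ennreal)"
      proof (cases "x \<in> \<Union>?G")
        case True
        have "card {Q\<in>?G. x \<in> E Q} \<le> card {Q\<in>F. x \<in> E Q}"
          by (rule card_mono) (use F(1) in auto)
        then have "card {Q\<in>?G. x \<in> E Q} \<le> 2" using overlap[of x] by linarith
        then have "of_nat (card {Q\<in>?G. x \<in> E Q}) \<le> (of_nat 2 :: ennreal)"
          by (rule of_nat_mono)
        then show ?thesis unfolding eq using True by simp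
      next
        case False
        then have "{Q\<in>?G. x \<in> E Q} = {}" using E(2) by blast
        then have "card {Q\<in>?G. x \<in> E Q} = 0" by (metis card.empty)
        then show ?thesis unfolding eq by (simp del: Collect_conj_eq)
      qed
    qed
    also have "\<dots> = 2 * emeasure M (\<Union>?G)"
      by (rule nn_integral_cmult_indicator) (use F(3) G in blast)
    also have "\<dots> \<le> 2 * (ennreal (2 / t) * W t)"
    proof -
      have "ennreal (t / 2) * emeasure M (\<Union>?G) \<le> W t"
        unfolding W_def
      proof (rule maximal_weak_type)
        show "laminar ?G" using laminar_subset F(2) G by blast
        fix Q assume "Q \<in> ?G"
        then show "ennreal t * emeasure M Q \<le> (\<integral>\<^sup>+x\<in>Q. ennreal (\<phi> x) \<partial>M)"
          using that by (intro order_trans[OF mult_right_mono av]) (auto intro: ennreal_leI)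
      qed (use F G that in auto)
      then have "ennreal (2 / t) * (ennreal (t / 2) * emeasure M (\<Union>?G)) \<le> ennreal (2 / t) * W t"
        by (rule mult_left_mono) simp
      then show ?thesis
        using that by (intro mult_left_mono) (auto simp: mult.assoc[symmetric] simp flip: ennreal_mult)
    qed
    finally have "m t \<le> ennreal c * (2 * (ennreal (2 / t) * W t))"
      by (simp add: mult_left_mono)
    also have "\<dots> = (ennreal c * ennreal 2 * ennreal (2 / t)) * W t" by (simp add: mult.assoc)
    also have "ennreal c * ennreal 2 * ennreal (2 / t) = ennreal (4 * c / t)"
      using that \<open>0 \<le> c\<close> by (subst ennreal_mult[symmetric], simp, simp)+ simp
    finally show ?thesis .
  qed
  have pw: "ennreal (a Q powr p) = (\<integral>\<^sup>+t. ennreal (p * t powr (p - 1)) * indicator {0<..<a Q} t \<partial>lborel)"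
    if "Q \<in> F" for Q
  proof -
    have "(\<integral>\<^sup>+t. ennreal (p * t powr (p - 1)) * indicator {0<..<a Q} t \<partial>lborel)
      = (\<integral>\<^sup>+t. ennreal p * (ennreal (t powr (p - 1)) * indicator {0<..<a Q} t) \<partial>lborel)"
      using \<open>1 < p\<close> by (simp add: ennreal_mult mult.assoc)
    also have "\<dots> = ennreal p * ennreal (a Q powr p / p)"
      using nn_integral_powr_below[of "p - 1" "a Q"] a[OF that] \<open>1 < p\<close>
      by (subst nn_integral_cmult) auto
    also have "\<dots> = ennreal (a Q powr p)" using \<open>1 < p\<close> by (simp flip: ennreal_mult)
    finally show ?thesis by simp
  qed
  have "(\<Sum>Q\<in>F. ennreal (a Q powr p) * emeasure M Q)
      = (\<Sum>Q\<in>F. \<integral>\<^sup>+t. ennreal (p * t powr (p - 1)) * indicator {0<..<a Q} t * emeasure M Q \<partial>lborel)"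
    by (intro sum.cong refl) (simp add: pw nn_integral_multc)
  also have "\<dots> = (\<integral>\<^sup>+t. (\<Sum>Q\<in>F. ennreal (p * t powr (p - 1)) * indicator {0<..<a Q} t * emeasure M Q) \<partial>lborel)"
    by (rule nn_integral_sum[symmetric]) measurable
  also have "\<dots> = (\<integral>\<^sup>+t. ennreal (p * t powr (p - 1)) * indicator {0<..} t * m t \<partial>lborel)"
    unfolding m_def sum_distrib_left
    by (intro nn_integral_cong sum.cong refl) (auto simp: indicator_def)
  also have "\<dots> \<le> (\<integral>\<^sup>+t. ennreal (4 * c * p * t powr (p - 2)) * indicator {0<..} t * W t \<partial>lborel)"
  proof (intro nn_integral_mono)
    fix t :: real
    show "ennreal (p * t powr (p - 1)) * indicator {0<..} t * m t
      \<le> ennreal (4 * c * p * t powr (p - 2)) * indicator {0<..} t * W t"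
    proof (cases "0 < t")
      case True
      have "ennreal (p * t powr (p - 1)) * m t \<le> ennreal (p * t powr (p - 1)) * (ennreal (4 * c / t) * W t)"
        by (intro mult_left_mono m_le True) simp
      also have "\<dots> = ennreal (p * t powr (p - 1) * (4 * c / t)) * W t"
        using True \<open>0 \<le> c\<close> \<open>1 < p\<close> by (subst ennreal_mult) (auto simp: mult.assoc)
      also have "p * t powr (p - 1) * (4 * c / t) = 4 * c * p * t powr (p - 2)"
        using True powr_diff[of t "p - 1" 1] by (simp add: field_simps)
      finally show ?thesis using True by simp
    qed simp
  qed
  also have "\<dots> = (\<integral>\<^sup>+t. (\<integral>\<^sup>+x. ennreal (4 * c * p * t powr (p - 2)) * indicator {0<..} t
      * (ennreal (\<phi> x) * indicator {x. t / 2 < \<phi> x} x) \<partial>M) \<partial>lborel)"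
    unfolding W_def by (intro nn_integral_cong nn_integral_cmult[symmetric]) measurable
  also have "\<dots> = (\<integral>\<^sup>+x. (\<integral>\<^sup>+t. ennreal (4 * c * p * t powr (p - 2)) * indicator {0<..} t
      * (ennreal (\<phi> x) * indicator {x. t / 2 < \<phi> x} x) \<partial>lborel) \<partial>M)"
    by (rule P.Fubini') measurable
  \<comment> \<open>For fixed x only t < 2 * \<phi> x contributes, which leaves an integral of a
    power. Points with \<phi> x \<le> 0 contribute nothing, hence \<open>max 0\<close>.\<close>
  also have "\<dots> = (\<integral>\<^sup>+x. ennreal (4 * c * p * 2 powr (p - 1) / (p - 1)) * ennreal (max 0 (\<phi> x) powr p) \<partial>M)"
  proof (intro nn_integral_cong)
    fix x
    let ?K = "ennreal (4 * c * p)"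
    show "(\<integral>\<^sup>+t. ennreal (4 * c * p * t powr (p - 2)) * indicator {0<..} t
      * (ennreal (\<phi> x) * indicator {x. t / 2 < \<phi> x} x) \<partial>lborel)
      = ennreal (4 * c * p * 2 powr (p - 1) / (p - 1)) * ennreal (max 0 (\<phi> x) powr p)"
    proof (cases "0 < \<phi> x")
      case True
      have "(\<integral>\<^sup>+t. ennreal (4 * c * p * t powr (p - 2)) * indicator {0<..} t
        * (ennreal (\<phi> x) * indicator {x. t / 2 < \<phi> x} x) \<partial>lborel)
        = (\<integral>\<^sup>+t. (?K * ennreal (\<phi> x)) * (ennreal (t powr (p - 2)) * indicator {0<..<2 * \<phi> x} t) \<partial>lborel)"
        using \<open>1 < p\<close> \<open>0 \<le> c\<close>
        by (intro nn_integral_cong) (auto simp: indicator_def ennreal_mult mult_ac)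
      also have "\<dots> = (?K * ennreal (\<phi> x)) * ennreal ((2 * \<phi> x) powr (p - 1) / (p - 1))"
        using nn_integral_powr_below[of "p - 2" "2 * \<phi> x"] True \<open>1 < p\<close>
        by (subst nn_integral_cmult) auto
      also have "\<dots> = ennreal (4 * c * p * 2 powr (p - 1) / (p - 1) * (\<phi> x powr p))"
      proof -
        have "\<phi> x powr p = \<phi> x * \<phi> x powr (p - 1)"
          using True powr_add[of "\<phi> x" 1 "p - 1"] by simp
        then show ?thesis using True \<open>1 < p\<close> \<open>0 \<le> c\<close>
          by (simp add: powr_mult ennreal_mult[symmetric] mult_ac)
      qed
      also have "\<dots> = ennreal (4 * c * p * 2 powr (p - 1) / (p - 1)) * ennreal (max 0 (\<phi> x) powr p)"
        using True \<open>1 < p\<close> \<open>0 \<le> c\<close> by (subst ennreal_mult) auto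
      finally show ?thesis .
    next
      case False
      then have "ennreal (\<phi> x) = 0" "max 0 (\<phi> x) = 0" by (auto simp: ennreal_neg)
      then show ?thesis by simp
    qed
  qed
  also have "\<dots> \<le> (\<integral>\<^sup>+x. ennreal (4 * c * p * 2 powr (p - 1) / (p - 1)) * ennreal (\<phi> x powr p) \<partial>M)"
    by (intro nn_integral_mono mult_left_mono ennreal_leI) (auto simp: max_def)
  also have "\<dots> = ennreal (4 * c * p * 2 powr (p - 1) / (p - 1)) * (\<integral>\<^sup>+x. ennreal (\<phi> x powr p) \<partial>M)"
    by (rule nn_integral_cmult) measurable
  finally show ?thesis .
qed

section \<open>Selection of a sparse subfamily\<close>

lemma floor_log2_bounds:
  assumes "0 < (x::real)"
  shows "2 powr \<lfloor>log 2 x\<rfloor> \<le> x" "x < 2 powr (\<lfloor>log 2 x\<rfloor> + 1)"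
proof -
  have "2 powr \<lfloor>log 2 x\<rfloor> \<le> 2 powr (log 2 x)" by (intro powr_mono) auto
  then show "2 powr \<lfloor>log 2 x\<rfloor> \<le> x" using assms by simp
  have "2 powr (log 2 x) < 2 powr (\<lfloor>log 2 x\<rfloor> + 1)" by (intro powr_less_mono) linarith+
  then show "x < 2 powr (\<lfloor>log 2 x\<rfloor> + 1)" using assms by simp
qed

text \<open>Trades all averages over F, at the price of a factor 2, for averages over a subfamily
  whose members have large parts E R of bounded overlap. This is the geometric input of
  \<open>carleson_embedding\<close>. Averages must be positive because the size classes are floors
  of logarithms.\<close>

lemma sparse_selection:
  fixes f :: "'a \<Rightarrow> ennreal" and a :: "'a set \<Rightarrow> real"
  assumes F: "finite F" "laminar F" "F \<subseteq> sets M" "\<And>Q. Q \<in> F \<Longrightarrow> emeasure M Q < \<infinity>"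
    and f: "f \<in> borel_measurable M" and a: "\<And>Q. Q \<in> F \<Longrightarrow> 0 < a Q"
    and av: "\<And>Q. Q \<in> F \<Longrightarrow> (\<integral>\<^sup>+x\<in>Q. f x \<partial>M) = ennreal (a Q) * emeasure M Q"
  obtains S E where "S \<subseteq> F" "\<And>Q. Q \<in> F \<Longrightarrow> \<exists>R\<in>S. Q \<subseteq> R \<and> a Q \<le> 2 * a R"
    "\<And>R. R \<in> S \<Longrightarrow> E R \<in> sets M" "\<And>R. R \<in> S \<Longrightarrow> E R \<subseteq> R"
    "\<And>R. R \<in> S \<Longrightarrow> emeasure M R \<le> 2 * emeasure M (E R)"
    "\<And>x. card {R\<in>S. x \<in> E R} \<le> 2"
proof
  define l where "l Q = \<lfloor>log 2 (a Q)\<rfloor>" for Q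
  \<comment> \<open>\<open>l\<close> increases strictly along chains of \<open>S\<close>, so two steps down the averages have more than
    doubled; this gives both the size of \<open>E R\<close> and the overlap at most two.\<close>
  define S where "S = {R\<in>F. \<forall>Q\<in>F. R \<subset> Q \<longrightarrow> l Q < l R}"
  define U where "U R = {Q\<in>S. Q \<subset> R \<and> l R + 2 \<le> l Q}" for R
  define E where "E R = R - \<Union>(U R)" for R
  show SF: "S \<subseteq> F" unfolding S_def by blast
  then have finS: "finite S" using F(1) finite_subset by blast
  have US: "U R \<subseteq> S" "finite (U R)" for R using finS unfolding U_def by auto
  show "\<exists>R\<in>S. Q \<subseteq> R \<and> a Q \<le> 2 * a R" if "Q \<in> F" for Q
  proof -
    \<comment> \<open>R is taken maximal above Q among the sets of class at least that of Q. A
      strictly larger set then has a smaller class than R, so R is kept; the factor 2 is the width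
      of one class.\<close>
    let ?H = "{R\<in>F. l Q \<le> l R}"
    have "finite ?H" "Q \<in> ?H" using F(1) that by auto
    then obtain R where R: "R \<in> ?H" "Q \<subseteq> R" "\<forall>C\<in>?H. R \<subseteq> C \<longrightarrow> R = C"
      by (rule finite_has_maximal2[THEN bexE]) auto
    have "l C < l R" if "C \<in> F" "R \<subset> C" for C
    proof (rule ccontr)
      assume "\<not> l C < l R"
      then have "C \<in> ?H" using R(1) that by auto
      then have "R = C" using R(3) that(2) by (metis psubset_imp_subset)
      then show False using that(2) by simp
    qed
    then have "R \<in> S" using R(1) unfolding S_def by blast
    moreover have "a Q \<le> 2 * a R"
    proof -
      have "a Q < 2 powr (l Q + 1)" using floor_log2_bounds(2)[OF a[OF that]] unfolding l_def .
      also have "\<dots> \<le> 2 powr (l R + 1)" using R(1) by (intro powr_mono) auto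
      also have "\<dots> = 2 * 2 powr (l R)" by (simp add: powr_add)
      also have "\<dots> \<le> 2 * a R" using floor_log2_bounds(1)[OF a, of R] R(1) unfolding l_def by simp
      finally show ?thesis by simp
    qed
    ultimately show ?thesis using R(2) by blast
  qed
  show E1: "E R \<in> sets M" if "R \<in> S" for R
    unfolding E_def using that SF F(3) US[of R] by (intro sets.Diff sets.finite_Union) auto
  show "E R \<subseteq> R" if "R \<in> S" for R unfolding E_def by blast
  show "emeasure M R \<le> 2 * emeasure M (E R)" if "R \<in> S" for R
  proof -
    \<comment> \<open>The removed part is a union of disjoint sets with averages at least 2^(l R +
      2). Their mass belongs to the mass of R, which is at most 2^(l R + 1) times the measure of R,
      so at most half of R is removed.\<close>
    obtain H where H: "H \<subseteq> U R" "disjoint H" "\<Union>H = \<Union>(U R)"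
      using laminar_maximal_disjoint[of "U R"] laminar_subset[OF F(2), of "U R"] US SF by blast
    have finH: "finite H" using H(1) US finite_subset by blast
    have HF: "H \<subseteq> F" using H(1) US SF by blast
    have Hsets: "Q \<in> sets M" if "Q \<in> H" for Q using that HF F(3) by blast
    have RF: "R \<in> F" using that SF by blast
    let ?u = "emeasure M (\<Union>H)"
    have "ennreal (2 powr (l R + 2)) * ?u \<le> ennreal (2 powr (l R + 2)) * (\<Sum>Q\<in>H. emeasure M Q)"
      using emeasure_subadditive_finite[OF finH, of "\<lambda>x. x" M] Hsets
      by (intro mult_left_mono) (simp_all add: subset_eq)
    also have "\<dots> = (\<Sum>Q\<in>H. ennreal (2 powr (l R + 2)) * emeasure M Q)"
      by (rule sum_distrib_left)
    also have "\<dots> \<le> (\<Sum>Q\<in>H. \<integral>\<^sup>+x\<in>Q. f x \<partial>M)"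
    proof (intro sum_mono)
      fix Q assume Q: "Q \<in> H"
      then have "Q \<in> F" "l R + 2 \<le> l Q" using HF H(1) unfolding U_def by auto
      then have "2 powr (l R + 2) \<le> 2 powr (l Q)" by (intro powr_mono) auto
      also have "\<dots> \<le> a Q" using floor_log2_bounds(1)[OF a[OF \<open>Q \<in> F\<close>]] unfolding l_def .
      finally show "ennreal (2 powr (l R + 2)) * emeasure M Q \<le> (\<integral>\<^sup>+x\<in>Q. f x \<partial>M)"
        unfolding av[OF \<open>Q \<in> F\<close>] by (intro mult_right_mono ennreal_leI) auto
    qed
    also have "\<dots> = (\<integral>\<^sup>+x. (\<Sum>Q\<in>H. f x * indicator Q x) \<partial>M)"
      by (rule nn_integral_sum[symmetric]) (use f Hsets in auto)
    also have "\<dots> \<le> (\<integral>\<^sup>+x\<in>R. f x \<partial>M)"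
    proof (intro nn_integral_mono)
      fix x
      show "(\<Sum>Q\<in>H. f x * indicator Q x) \<le> f x * indicator R x"
      proof (cases "x \<in> R")
        case True
        have "f x * (\<Sum>Q\<in>H. indicator Q x) \<le> f x * 1"
          by (intro mult_left_mono sum_indicator_disjoint[OF finH H(2)]) auto
        then show ?thesis using True by (simp add: sum_distrib_left)
      next
        case False
        then have "x \<notin> Q" if "Q \<in> H" for Q using that H(1) unfolding U_def by blast
        then show ?thesis by simp
      qed
    qed
    also have "\<dots> = ennreal (a R) * emeasure M R" using av[OF RF] .
    also have "\<dots> \<le> ennreal (2 powr (l R + 1)) * emeasure M R"
      using floor_log2_bounds(2)[OF a[OF RF]] unfolding l_def
      by (intro mult_right_mono ennreal_leI) auto
    finally have le: "ennreal (2 powr (l R + 2)) * ?u \<le> ennreal (2 powr (l R + 1)) * emeasure M R" .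
    have "ennreal (2 powr (l R + 2)) = ennreal (2 powr (l R + 1)) * 2"
    proof -
      have "2 powr (l R + 2) = 2 powr (l R + 1) * (2::real)" by (simp add: powr_add)
      then show ?thesis by (simp add: ennreal_mult)
    qed
    with le have le2: "ennreal (2 powr (l R + 1)) * (2 * ?u) \<le> ennreal (2 powr (l R + 1)) * emeasure M R"
      by (simp only: mult.assoc)
    have cancel: "ennreal (2 powr - (l R + 1)) * (ennreal (2 powr (l R + 1)) * x) = x" for x
      by (simp only: mult.assoc[symmetric] ennreal_mult[symmetric] powr_add[symmetric] powr_ge_zero) simp
    have u: "2 * ?u \<le> emeasure M R"
      using mult_left_mono[OF le2, of "ennreal (2 powr - (l R + 1))"] unfolding cancel by simp
    have Rfin: "emeasure M R < \<infinity>" using F(4)[OF RF] .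
    have "?u \<le> emeasure M R" 
      by (rule emeasure_mono) (use H(1) RF F(3) in \<open>auto simp: U_def\<close>)
    then have ufin: "?u < \<infinity>" using Rfin by (rule le_less_trans)
    have "emeasure M R \<le> emeasure M (E R) + ?u"
    proof -
      have Hm: "\<Union>H \<in> sets M" using sets.finite_Union[OF finH] Hsets by blast
      have "R \<subseteq> E R \<union> \<Union>H" unfolding E_def H(3) by blast
      then have "emeasure M R \<le> emeasure M (E R \<union> \<Union>H)"
        using E1[OF that] Hm by (intro emeasure_mono) auto
      also have "\<dots> \<le> emeasure M (E R) + ?u"
        using E1[OF that] Hm by (rule emeasure_subadditive)
      finally show ?thesis .
    qed
    then have "2 * emeasure M R \<le> 2 * emeasure M (E R) + 2 * ?u"
      by (metis distrib_left mult_left_mono zero_le)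
    also have "\<dots> \<le> 2 * emeasure M (E R) + emeasure M R" using u by (intro add_left_mono)
    finally have "emeasure M R + emeasure M R \<le> emeasure M R + 2 * emeasure M (E R)"
      by (simp add: mult_2 add.commute)
    then show ?thesis using Rfin by (auto simp: ennreal_add_left_cancel_le)
  qed
  show "card {R\<in>S. x \<in> E R} \<le> 2" for x
  proof (rule ccontr)
    assume "\<not> card {R\<in>S. x \<in> E R} \<le> 2"
    then have "3 \<le> card {R\<in>S. x \<in> E R}" by simp
    \<comment> \<open>Three kept sets through one point form a chain. Classes strictly increase
      inwards, so the innermost set is at least two classes above the outermost one and is removed
      from its part E, although the point lies in both.\<close>
    then obtain T where T: "T \<subseteq> {R\<in>S. x \<in> E R}" "card T = 3"
      by (meson obtain_subset_with_card_n)
    have Tx: "R \<in> S" "x \<in> E R" "x \<in> R" if "R \<in> T" for R using that T(1) by (auto simp: E_def)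
    have nest: "A \<subset> B \<or> B \<subset> A" if "A \<in> T" "B \<in> T" "A \<noteq> B" for A B
      using laminarD[OF F(2), of A B] Tx[OF that(1)] Tx[OF that(2)] SF that(3) by blast
    have lev: "l B < l A" if "A \<in> T" "B \<in> T" "A \<subset> B" for A B
      using Tx[OF that(1)] Tx[OF that(2)] that(3) SF unfolding S_def by blast
    have no: False if "A \<in> T" "B \<in> T" "C \<in> T" "A \<subset> B" "B \<subset> C" for A B C
    proof -
      have "l C + 2 \<le> l A" "A \<subset> C" using lev[of A B] lev[of B C] that by auto
      then have "A \<in> U C" unfolding U_def using Tx[OF that(1)] by blast
      then show False using Tx(2)[OF that(3)] Tx(3)[OF that(1)] unfolding E_def by blast
    qed
    obtain A B C where ABC: "T = {A,B,C}" "A \<noteq> B" "B \<noteq> C" "A \<noteq> C"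
      using T(2) by (metis card_3_iff)
    then have mem: "A \<in> T" "B \<in> T" "C \<in> T" by auto
    show False
      using nest[OF mem(1,2) ABC(2)] nest[OF mem(2,3) ABC(3)] nest[OF mem(1,3) ABC(4)]
      by (elim disjE) (use no mem in \<open>metis psubset_trans less_irrefl\<close>)+
  qed
qed

section \<open>Hoelder inequalities and sums over levels\<close>

text \<open>The inclusion of l^1 in l^r. The Hoelder estimate below uses it with r = p'/q', which is
  at least 1 precisely because p \<le> q.\<close>

lemma sum_powr_le_powr_sum:
  fixes b :: "'a \<Rightarrow> real"
  assumes "finite S" "\<And>R. R \<in> S \<Longrightarrow> 0 \<le> b R" "1 \<le> r"
  shows "(\<Sum>R\<in>S. b R powr r) \<le> (\<Sum>R\<in>S. b R) powr r"
proof -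
  let ?B = "\<Sum>R\<in>S. b R"
  have B: "0 \<le> ?B" using assms(2) by (rule sum_nonneg)
  have split: "x powr r = x * x powr (r - 1)" if "0 \<le> x" for x :: real
    using that powr_add[of x 1 "r - 1"] by (cases "x = 0") auto
  have "(\<Sum>R\<in>S. b R powr r) \<le> (\<Sum>R\<in>S. b R * ?B powr (r - 1))"
  proof (intro sum_mono)
    fix R assume R: "R \<in> S"
    have "b R \<le> ?B" using member_le_sum[OF R, of b] assms by auto
    then have "b R powr (r - 1) \<le> ?B powr (r - 1)"
      using assms(2)[OF R] assms(3) by (intro powr_mono2) auto
    then show "b R powr r \<le> b R * ?B powr (r - 1)"
      unfolding split[OF assms(2)[OF R]] using assms(2)[OF R] by (rule mult_left_mono)
  qed
  also have "\<dots> = ?B powr r" by (simp add: split[OF B] sum_distrib_right)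
  finally show ?thesis .
qed

text \<open>The scaling is chosen so that the bracket adds up to 1/p + 1/q = 1 once A and B are the
  sums or integrals of a^p and b^q.\<close>

lemma Youngs_inequality_scaled:
  fixes p q :: real
  assumes "1 < p" "1 < q" "1 / p + 1 / q = 1" "0 \<le> a" "0 \<le> b" "0 < A" "0 < B"
  shows "a * b \<le> A powr (1/p) * B powr (1/q) * (a powr p / (p * A) + b powr q / (q * B))"
proof -
  have "(a / A powr (1/p)) * (b / B powr (1/q))
      \<le> (a / A powr (1/p)) powr p / p + (b / B powr (1/q)) powr q / q"
    using assms by (intro Youngs_inequality) auto
  also have "\<dots> = a powr p / (p * A) + b powr q / (q * B)"
    using assms by (simp add: powr_divide powr_powr mult.commute)
  finally have le: "(a / A powr (1/p)) * (b / B powr (1/q)) \<le> a powr p / (p * A) + b powr q / (q * B)" .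
  have "a * b = A powr (1/p) * B powr (1/q) * ((a / A powr (1/p)) * (b / B powr (1/q)))"
    using assms by simp
  also have "\<dots> \<le> A powr (1/p) * B powr (1/q) * (a powr p / (p * A) + b powr q / (q * B))"
    by (intro mult_left_mono le) auto
  finally show ?thesis .
qed

lemma Holder_sum:
  fixes a b :: "'a \<Rightarrow> real"
  assumes "1 < p" "1 < q" "1 / p + 1 / q = 1" "finite S"
    and a: "\<And>R. R \<in> S \<Longrightarrow> 0 \<le> a R" and b: "\<And>R. R \<in> S \<Longrightarrow> 0 \<le> b R"
  shows "(\<Sum>R\<in>S. a R * b R) \<le> (\<Sum>R\<in>S. a R powr p) powr (1/p) * (\<Sum>R\<in>S. b R powr q) powr (1/q)"
proof -
  let ?A = "\<Sum>R\<in>S. a R powr p" and ?B = "\<Sum>R\<in>S. b R powr q"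
  have nn: "0 \<le> ?A" "0 \<le> ?B" by (auto intro: sum_nonneg)
  show ?thesis
  proof (cases "?A = 0 \<or> ?B = 0")
    case True
    then have "\<forall>R\<in>S. a R * b R = 0"
      using \<open>finite S\<close> by (auto simp: sum_nonneg_eq_0_iff)
    then have "(\<Sum>R\<in>S. a R * b R) = 0" by (intro sum.neutral)
    then show ?thesis by simp
  next
    case False
    then have pos: "0 < ?A" "0 < ?B" using nn by auto
    have "(\<Sum>R\<in>S. a R * b R) \<le> (\<Sum>R\<in>S. ?A powr (1/p) * ?B powr (1/q)
        * (a R powr p / (p * ?A) + b R powr q / (q * ?B)))"
      using assms pos by (intro sum_mono Youngs_inequality_scaled) auto
    also have "\<dots> = ?A powr (1/p) * ?B powr (1/q) * (?A / (p * ?A) + ?B / (q * ?B))"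
      by (simp add: sum_distrib_left[symmetric] sum.distrib sum_divide_distrib[symmetric])
    also have "?A / (p * ?A) + ?B / (q * ?B) = 1" using assms pos by simp
    finally show ?thesis by simp
  qed
qed

text \<open>Stated with positive upper bounds A and B instead of the two integrals, so that a
  vanishing integral needs no separate treatment and a bound can be made as small as desired;
  \<open>A_infty_half\<close> exploits this.\<close>

lemma Holder_nn_integral:
  fixes a b :: "'a \<Rightarrow> real"
  assumes "1 < p" "1 < q" "1 / p + 1 / q = 1"
    and [measurable]: "a \<in> borel_measurable M" "b \<in> borel_measurable M"
    and "\<And>x. 0 \<le> a x" "\<And>x. 0 \<le> b x" "0 < A" "0 < B"
    and A: "(\<integral>\<^sup>+x. ennreal (a x powr p) \<partial>M) \<le> ennreal A"
    and B: "(\<integral>\<^sup>+x. ennreal (b x powr q) \<partial>M) \<le> ennreal B"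
  shows "(\<integral>\<^sup>+x. ennreal (a x * b x) \<partial>M) \<le> ennreal (A powr (1/p) * B powr (1/q))"
proof -
  let ?K = "A powr (1/p) * B powr (1/q)"
  have "(\<integral>\<^sup>+x. ennreal (a x * b x) \<partial>M)
      \<le> (\<integral>\<^sup>+x. ennreal (?K / (p * A)) * ennreal (a x powr p) + ennreal (?K / (q * B)) * ennreal (b x powr q) \<partial>M)"
  proof (intro nn_integral_mono)
    fix x
    have "a x * b x \<le> ?K * (a x powr p / (p * A) + b x powr q / (q * B))"
      using assms by (intro Youngs_inequality_scaled) auto
    also have "\<dots> = ?K / (p * A) * a x powr p + ?K / (q * B) * b x powr q"
      by (simp add: algebra_simps)
    finally show "ennreal (a x * b x)
      \<le> ennreal (?K / (p * A)) * ennreal (a x powr p) + ennreal (?K / (q * B)) * ennreal (b x powr q)"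
      using assms by (simp add: ennreal_leI flip: ennreal_mult ennreal_plus)
  qed
  also have "\<dots> = ennreal (?K / (p * A)) * (\<integral>\<^sup>+x. ennreal (a x powr p) \<partial>M)
      + ennreal (?K / (q * B)) * (\<integral>\<^sup>+x. ennreal (b x powr q) \<partial>M)"
    by (simp add: nn_integral_add nn_integral_cmult)
  also have "\<dots> \<le> ennreal (?K / (p * A)) * ennreal A + ennreal (?K / (q * B)) * ennreal B"
    by (intro add_mono mult_left_mono A B) auto
  also have "\<dots> = ennreal (?K / (p * A) * A + ?K / (q * B) * B)"
    using assms by (simp flip: ennreal_mult ennreal_plus)
  also have "?K / (p * A) * A + ?K / (q * B) * B = ?K * (1/p + 1/q)"
    using assms(8,9) by (simp add: field_simps)
  finally show ?thesis using assms(3) by simp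
qed

lemma powr_root_mult:
  fixes x y p :: real
  assumes "0 < x" "0 \<le> y" "0 < p"
  shows "(x powr (1 / p) * y) powr p = x * y powr p"
  using assms by (simp only: powr_mult powr_powr powr_ge_zero) simp

text \<open>Splitting s = s^(1/p) * s^(1/p') and n = n^(1/q') * n^(1/q) isolates the quantity
  bounded by K and leaves a product to which Hoelder with exponents p and p' applies. In the second
  factor p' is then lowered to q' by \<open>sum_powr_le_powr_sum\<close>.\<close>

lemma Holder_two_weight_sum:
  fixes s n k F G :: "'a \<Rightarrow> real"
  assumes "1 < p" "p \<le> q" "finite S" "0 \<le> K"
    and pos: "\<And>R. R \<in> S \<Longrightarrow> 0 < s R" "\<And>R. R \<in> S \<Longrightarrow> 0 < n R"
    and nn: "\<And>R. R \<in> S \<Longrightarrow> 0 \<le> F R" "\<And>R. R \<in> S \<Longrightarrow> 0 \<le> G R"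
    and K: "\<And>R. R \<in> S \<Longrightarrow> k R * s R powr (1 / conj_exp p) * n R powr (1 / q) \<le> K"
    and A: "(\<Sum>R\<in>S. s R * (F R / s R) powr p) \<le> A"
    and B: "(\<Sum>R\<in>S. n R * (G R / n R) powr conj_exp q) \<le> B"
  shows "(\<Sum>R\<in>S. k R * F R * G R) \<le> K * A powr (1 / p) * B powr (1 / conj_exp q)"
proof -
  define p' q' where "p' = conj_exp p" and "q' = conj_exp q"
  have p': "1 < p'" "1 / p + 1 / p' = 1" and q': "1 < q'" "1 / q + 1 / q' = 1"
    using assms(1,2) unfolding p'_def q'_def conj_exp_def by (auto simp: field_simps)
  have "1 / q \<le> 1 / p" using assms(1,2) by (simp add: frac_le)
  then have "1 / p' \<le> 1 / q'" using p' q' by linarith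
  then have r: "1 \<le> p' / q'" using p' q' by (simp add: field_simps)
  let ?a = "\<lambda>R. s R powr (1/p) * (F R / s R)" and ?b = "\<lambda>R. n R powr (1/q') * (G R / n R)"
  let ?c = "\<lambda>R. n R * (G R / n R) powr q'"
  have "(\<Sum>R\<in>S. k R * F R * G R) \<le> (\<Sum>R\<in>S. K * (?a R * ?b R))"
  proof (intro sum_mono)
    fix R assume R: "R \<in> S"
    have s: "s R powr (1/p) * s R powr (1/p') = s R"
      using pos(1)[OF R] p'(2) by (simp flip: powr_add)
    have n: "n R powr (1/q') * n R powr (1/q) = n R"
      using pos(2)[OF R] q'(2) by (simp add: add.commute flip: powr_add)
    have "k R * F R * G R = (k R * s R powr (1/p') * n R powr (1/q)) * (?a R * ?b R)"
    proof -
      have "(k R * s R powr (1/p') * n R powr (1/q)) * (?a R * ?b R)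
        = k R * F R * G R * ((s R powr (1/p) * s R powr (1/p')) / s R) * ((n R powr (1/q') * n R powr (1/q)) / n R)"
        by simp
      also have "\<dots> = k R * F R * G R" unfolding s n using pos[OF R] by simp
      finally show ?thesis by simp
    qed
    also have "\<dots> \<le> K * (?a R * ?b R)"
      using K[OF R] nn[OF R] pos[OF R] unfolding p'_def by (intro mult_right_mono) auto
    finally show "k R * F R * G R \<le> K * (?a R * ?b R)" .
  qed
  also have "\<dots> = K * (\<Sum>R\<in>S. ?a R * ?b R)" by (simp add: sum_distrib_left)
  also have "(\<Sum>R\<in>S. ?a R * ?b R) \<le> (\<Sum>R\<in>S. ?a R powr p) powr (1/p) * (\<Sum>R\<in>S. ?b R powr p') powr (1/p')"
    using assms(1,3) p' nn pos by (intro Holder_sum) (auto simp: less_imp_le)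
  also have "(\<Sum>R\<in>S. ?a R powr p) = (\<Sum>R\<in>S. s R * (F R / s R) powr p)"
    using assms(1) pos nn by (intro sum.cong refl powr_root_mult) (auto simp: less_imp_le)
  also have "(\<Sum>R\<in>S. ?b R powr p') = (\<Sum>R\<in>S. ?c R powr (p' / q'))"
  proof (intro sum.cong refl)
    fix R assume R: "R \<in> S"
    have "?b R powr p' = (?b R powr q') powr (p' / q')" using q' by (simp add: powr_powr)
    also have "?b R powr q' = ?c R" using q' pos(2)[OF R] nn(2)[OF R] by (intro powr_root_mult) auto
    finally show "?b R powr p' = ?c R powr (p' / q')" .
  qed
  finally have 1: "(\<Sum>R\<in>S. k R * F R * G R) \<le> K * ((\<Sum>R\<in>S. s R * (F R / s R) powr p) powr (1/p)
      * (\<Sum>R\<in>S. ?c R powr (p' / q')) powr (1/p'))"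
    using assms(4) by (simp add: mult_left_mono)
  have c: "0 \<le> ?c R" if "R \<in> S" for R using pos(2)[OF that] by (intro mult_nonneg_nonneg) auto
  have "(\<Sum>R\<in>S. ?c R powr (p' / q')) powr (1/p') \<le> ((\<Sum>R\<in>S. ?c R) powr (p' / q')) powr (1/p')"
    using p' r c by (intro powr_mono2 sum_powr_le_powr_sum assms(3) sum_nonneg) auto
  also have "\<dots> = (\<Sum>R\<in>S. ?c R) powr (1/q')" using p' by (simp add: powr_powr)
  also have "\<dots> \<le> B powr (1/q')"
    using q' B c by (intro powr_mono2 sum_nonneg) (auto simp: q'_def)
  finally have 2: "(\<Sum>R\<in>S. ?c R powr (p' / q')) powr (1/p') \<le> B powr (1/q')" .
  have 3: "(\<Sum>R\<in>S. s R * (F R / s R) powr p) powr (1/p) \<le> A powr (1/p)"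
    using assms(1) A pos by (intro powr_mono2 sum_nonneg mult_nonneg_nonneg) (auto simp: less_imp_le)
  have "K * ((\<Sum>R\<in>S. s R * (F R / s R) powr p) powr (1/p) * (\<Sum>R\<in>S. ?c R powr (p' / q')) powr (1/p'))
      \<le> K * (A powr (1/p) * B powr (1/q'))"
    using assms(4) 2 3 by (intro mult_left_mono mult_mono) auto
  then show ?thesis using 1 unfolding q'_def by (simp add: mult.assoc)
qed

section \<open>Geometric sums over levels\<close>

lemma sum_powr_levels_le:
  fixes J :: "int set" and L :: int and \<alpha> :: real
  assumes "finite J" "\<And>j. j \<in> J \<Longrightarrow> L \<le> j" "0 < \<alpha>"
  shows "(\<Sum>j\<in>J. 2 powr (- \<alpha> * j)) \<le> 2 powr (- \<alpha> * L) / (1 - 2 powr - \<alpha>)"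
proof -
  let ?z = "2 powr - \<alpha> :: real"
  have "?z < 2 powr 0" using assms(3) by (intro powr_less_mono) auto
  then have z: "0 < ?z" "?z < 1" by auto
  have inj: "inj_on (\<lambda>j. nat (j - L)) J"
    using assms(2) by (intro inj_onI) (metis diff_add_cancel diff_ge_0_iff_ge int_nat_eq)
  have "(\<Sum>j\<in>J. 2 powr (- \<alpha> * j)) = (\<Sum>j\<in>J. 2 powr (- \<alpha> * L) * ?z ^ nat (j - L))"
  proof (intro sum.cong refl)
    fix j assume "j \<in> J"
    then have j: "real_of_int j = L + real (nat (j - L))" using assms(2)[of j] by simp
    have "?z ^ nat (j - L) = 2 powr (- \<alpha> * real (nat (j - L)))"
      by (simp add: powr_realpow[symmetric] powr_powr)
    then show "2 powr (- \<alpha> * j) = 2 powr (- \<alpha> * L) * ?z ^ nat (j - L)"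
      by (subst j) (simp add: powr_add[symmetric] algebra_simps)
  qed
  also have "\<dots> = 2 powr (- \<alpha> * L) * (\<Sum>m\<in>(\<lambda>j. nat (j - L)) ` J. ?z ^ m)"
    by (simp add: sum_distrib_left sum.reindex[OF inj])
  also have "\<dots> \<le> 2 powr (- \<alpha> * L) * (1 / (1 - ?z))"
  proof (intro mult_left_mono)
    have "(\<Sum>m\<in>(\<lambda>j. nat (j - L)) ` J. ?z ^ m) \<le> (\<Sum>m. ?z ^ m)"
      using z assms(1) by (intro sum_le_suminf) (auto simp: summable_geometric_iff)
    then show "(\<Sum>m\<in>(\<lambda>j. nat (j - L)) ` J. ?z ^ m) \<le> 1 / (1 - ?z)"
      using z by (simp add: suminf_geometric)
  qed simp
  finally show ?thesis by simp
qed

text \<open>Sets of one level are disjoint subsets of R, so each level contributes at most the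
  measure of R, and the weights 2^(-\<alpha> j) with j \<ge> L sum to a geometric series.\<close>

lemma sum_levels_le:
  fixes lev :: "'a set \<Rightarrow> int" and L :: int and \<alpha> :: real
  assumes F: "finite F" "F \<subseteq> sets N" "\<And>Q. Q \<in> F \<Longrightarrow> Q \<subseteq> R" "R \<in> sets N"
    and dis: "\<And>Q Q'. Q \<in> F \<Longrightarrow> Q' \<in> F \<Longrightarrow> lev Q = lev Q' \<Longrightarrow> Q \<noteq> Q' \<Longrightarrow> Q \<inter> Q' = {}"
    and lev: "\<And>Q. Q \<in> F \<Longrightarrow> L \<le> lev Q" and "0 < \<alpha>"
  shows "(\<Sum>Q\<in>F. ennreal (2 powr (- \<alpha> * lev Q)) * emeasure N Q)
    \<le> ennreal (2 powr (- \<alpha> * L) / (1 - 2 powr - \<alpha>)) * emeasure N R"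
proof -
  have layer: "(\<Sum>Q\<in>{Q\<in>F. lev Q = j}. emeasure N Q) \<le> emeasure N R" for j
  proof -
    let ?H = "{Q\<in>F. lev Q = j}"
    have H: "finite ?H" using F(1) by simp
    have "(\<Sum>Q\<in>?H. emeasure N Q) = (\<Sum>Q\<in>?H. \<integral>\<^sup>+x. indicator Q x \<partial>N)"
      using F(2) by (intro sum.cong refl nn_integral_indicator[symmetric]) auto
    also have "\<dots> = (\<integral>\<^sup>+x. (\<Sum>Q\<in>?H. indicator Q x) \<partial>N)"
      by (rule nn_integral_sum[symmetric]) (use F(2) in auto)
    also have "\<dots> \<le> (\<integral>\<^sup>+x. indicator R x \<partial>N)"
    proof (intro nn_integral_mono)
      fix x
      have "disjoint ?H" by (rule disjointI) (use dis in auto)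
      then have "(\<Sum>Q\<in>?H. indicator Q x :: ennreal) \<le> 1" by (rule sum_indicator_disjoint[OF H])
      moreover have "(\<Sum>Q\<in>?H. indicator Q x :: ennreal) = 0" if "x \<notin> R"
        using that F(3) by (intro sum.neutral) (auto simp: indicator_def)
      ultimately show "(\<Sum>Q\<in>?H. indicator Q x :: ennreal) \<le> indicator R x"
        by (cases "x \<in> R") auto
    qed
    also have "\<dots> = emeasure N R" using F(4) by simp
    finally show ?thesis .
  qed
  have "(\<Sum>Q\<in>F. ennreal (2 powr (- \<alpha> * lev Q)) * emeasure N Q)
      = (\<Sum>j\<in>lev ` F. \<Sum>Q\<in>{Q\<in>F. lev Q = j}. ennreal (2 powr (- \<alpha> * lev Q)) * emeasure N Q)"
    by (rule sum.image_gen[OF F(1)])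
  also have "\<dots> = (\<Sum>j\<in>lev ` F. ennreal (2 powr (- \<alpha> * j)) * (\<Sum>Q\<in>{Q\<in>F. lev Q = j}. emeasure N Q))"
    by (intro sum.cong refl) (simp add: sum_distrib_left)
  also have "\<dots> \<le> (\<Sum>j\<in>lev ` F. ennreal (2 powr (- \<alpha> * j)) * emeasure N R)"
    by (intro sum_mono mult_left_mono layer) simp
  also have "\<dots> = ennreal (\<Sum>j\<in>lev ` F. 2 powr (- \<alpha> * j)) * emeasure N R"
    by (simp add: sum_distrib_right[symmetric])
  also have "\<dots> \<le> ennreal (2 powr (- \<alpha> * L) / (1 - 2 powr - \<alpha>)) * emeasure N R"
    using F(1) lev \<open>0 < \<alpha>\<close> by (intro mult_right_mono ennreal_leI sum_powr_levels_le) auto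
  finally show ?thesis .
qed

section \<open>The dyadic fractional integral\<close>

text \<open>The factor of \<open>carleson_embedding\<close>, named because it occurs with the two
  exponents p and \<open>conj_exp q\<close>.\<close>

definition carleson_const :: "real \<Rightarrow> real \<Rightarrow> real" where
  "carleson_const c p = 4 * c * p * 2 powr (p - 1) / (p - 1)"

text \<open>Its factors are the 2 lost in passing to the sparse family, the geometric series over
  levels, the two-weight bound K and the two Carleson constants. The power q arises because the
  argument bounds the q-th root of the integral.\<close>

definition dyadic_const :: "real \<Rightarrow> real \<Rightarrow> real \<Rightarrow> real \<Rightarrow> real \<Rightarrow> real" where
  "dyadic_const \<alpha> p q K c = (2 / (1 - 2 powr - \<alpha>) * K * carleson_const c p powr (1 / p)
     * carleson_const c (conj_exp q) powr (1 / conj_exp q)) powr q"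

lemma carleson_const_nonneg: "0 \<le> c \<Longrightarrow> 1 < p \<Longrightarrow> 0 \<le> carleson_const c p"
  unfolding carleson_const_def by simp

lemma ennreal_sum_mult_le_iff:
  fixes a b :: "'a \<Rightarrow> real"
  assumes "\<And>i. i \<in> S \<Longrightarrow> 0 \<le> a i" "\<And>i. i \<in> S \<Longrightarrow> 0 \<le> b i" "0 \<le> B"
  shows "(\<Sum>i\<in>S. ennreal (a i) * ennreal (b i)) \<le> ennreal B \<longleftrightarrow> (\<Sum>i\<in>S. a i * b i) \<le> B"
proof -
  have "(\<Sum>i\<in>S. ennreal (a i) * ennreal (b i)) = ennreal (\<Sum>i\<in>S. a i * b i)"
    using assms by (subst sum_ennreal[symmetric]) (auto intro!: sum.cong simp: ennreal_mult)
  then show ?thesis using assms(3) by simp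
qed

text \<open>Duality with an explicit extremal function: the integral X of \<open>T x powr q\<close>
  is the pairing of T with g, the (q-1)-st power of T. After sparse selection, Carleson embedding
  bounds the averages of f / \<sigma> through J and those of g through X itself, and X is then
  absorbed. The functions m, n, s and I record the finite measures and integrals as real
  numbers.\<close>

lemma dyadic_fractional_integral_bound:
  fixes w \<sigma> f :: "'a \<Rightarrow> real" and lev :: "'a set \<Rightarrow> int" and m n s I :: "'a set \<Rightarrow> real" and \<alpha> :: real
  assumes sf: "sigma_finite_measure M"
    and meas[measurable]: "w \<in> borel_measurable M" "\<sigma> \<in> borel_measurable M" "f \<in> borel_measurable M"
    and \<sigma>: "AE x in M. 0 < \<sigma> x" and f: "\<And>x. 0 \<le> f x"
    and F: "finite F" "laminar F" "F \<subseteq> sets M"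
    and dis: "\<And>Q Q'. Q \<in> F \<Longrightarrow> Q' \<in> F \<Longrightarrow> lev Q = lev Q' \<Longrightarrow> Q \<noteq> Q' \<Longrightarrow> Q \<inter> Q' = {}"
    and lev: "\<And>Q R. Q \<in> F \<Longrightarrow> R \<in> F \<Longrightarrow> Q \<subseteq> R \<Longrightarrow> lev R \<le> lev Q"
    and m: "\<And>Q. Q \<in> F \<Longrightarrow> 0 < m Q" "\<And>Q. Q \<in> F \<Longrightarrow> emeasure M Q = ennreal (m Q)"
    and n: "\<And>Q. Q \<in> F \<Longrightarrow> 0 < n Q" "\<And>Q. Q \<in> F \<Longrightarrow> emeasure (density M (\<lambda>x. ennreal (w x))) Q = ennreal (n Q)"
    and s: "\<And>Q. Q \<in> F \<Longrightarrow> 0 < s Q" "\<And>Q. Q \<in> F \<Longrightarrow> emeasure (density M (\<lambda>x. ennreal (\<sigma> x))) Q = ennreal (s Q)"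
    and I: "\<And>Q. Q \<in> F \<Longrightarrow> 0 \<le> I Q" "\<And>Q. Q \<in> F \<Longrightarrow> (\<integral>\<^sup>+x\<in>Q. ennreal (f x) \<partial>M) = ennreal (I Q)"
    and pq: "1 < p" "p \<le> q" and "0 < \<alpha>" "0 \<le> K" "0 \<le> c"
    and K: "\<And>Q. Q \<in> F \<Longrightarrow> 2 powr (- \<alpha> * lev Q) / m Q * s Q powr (1 / conj_exp p) * n Q powr (1 / q) \<le> K"
    and half_w: "\<And>Q E. Q \<in> F \<Longrightarrow> E \<in> sets M \<Longrightarrow> E \<subseteq> Q \<Longrightarrow> emeasure M Q \<le> 2 * emeasure M E \<Longrightarrow>
      emeasure (density M (\<lambda>x. ennreal (w x))) Q \<le> ennreal c * emeasure (density M (\<lambda>x. ennreal (w x))) E"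
    and half_\<sigma>: "\<And>Q E. Q \<in> F \<Longrightarrow> E \<in> sets M \<Longrightarrow> E \<subseteq> Q \<Longrightarrow> emeasure M Q \<le> 2 * emeasure M E \<Longrightarrow>
      emeasure (density M (\<lambda>x. ennreal (\<sigma> x))) Q \<le> ennreal c * emeasure (density M (\<lambda>x. ennreal (\<sigma> x))) E"
    and J: "0 \<le> J" "(\<integral>\<^sup>+x. ennreal ((f x / \<sigma> x) powr p) \<partial>density M (\<lambda>x. ennreal (\<sigma> x))) \<le> ennreal J"
  shows "(\<integral>\<^sup>+x. ennreal ((\<Sum>Q\<in>F. 2 powr (- \<alpha> * lev Q) / m Q * I Q * indicator Q x) powr q)
      \<partial>density M (\<lambda>x. ennreal (w x))) \<le> ennreal (dyadic_const \<alpha> p q K c * J powr (q / p))"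
proof -
  interpret M: sigma_finite_measure M by fact
  define N where "N = density M (\<lambda>x. ennreal (w x))"
  define D where "D = density M (\<lambda>x. ennreal (\<sigma> x))"
  have sets_ND[measurable_cong, simp]: "sets N = sets M" "sets D = sets M" by (auto simp: N_def D_def)
  have sfN: "sigma_finite_measure N" "sigma_finite_measure D"
    unfolding N_def D_def using M.sigma_finite_iff_density_finite by auto
  have Fs[measurable]: "Q \<in> sets M" if "Q \<in> F" for Q using F(3) that by blast
  define q' where "q' = conj_exp q"
  have q': "1 < q'" "1 / q + 1 / q' = 1" "(q - 1) * q' = q"
    using pq unfolding q'_def conj_exp_def by (auto simp: field_simps)
  define k where "k Q = 2 powr (- \<alpha> * lev Q)" for Q
  define a where "a Q = I Q / m Q" for Q
  define T where "T x = (\<Sum>Q\<in>F. k Q / m Q * I Q * indicator Q x)" for x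
  define g where "g x = T x powr (q - 1)" for x \<comment> \<open>the extremal function for duality\<close>
  have k: "0 < k Q" for Q by (simp add: k_def)
  have a_nn: "0 \<le> a Q" if "Q \<in> F" for Q using I(1) m(1) that by (simp add: a_def less_imp_le)
  have ka: "0 \<le> k Q / m Q * I Q" if "Q \<in> F" for Q
    using I(1)[OF that] m(1)[OF that] k[of Q] by simp
  have [measurable]: "T \<in> borel_measurable M"
    unfolding T_def by measurable
  then have [measurable]: "T \<in> borel_measurable N"
    by (simp add: N_def)
  have [measurable]: "g \<in> borel_measurable M" "g \<in> borel_measurable N" unfolding g_def by measurable
  have T_nn: "0 \<le> T x" for x unfolding T_def using ka by (intro sum_nonneg mult_nonneg_nonneg[OF ka]) auto
  define B where "B = (\<Sum>Q\<in>F. k Q / m Q * I Q)"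
  have T_le: "T x \<le> B" for x
    unfolding T_def B_def using ka by (intro sum_mono) (auto simp: indicator_def)
  have g_nn: "0 \<le> g x" for x by (simp add: g_def)
  have g_le: "g x \<le> B powr (q - 1)" for x
    unfolding g_def using pq T_nn T_le by (intro powr_mono2) auto
  \<comment> \<open>T is a finite sum and hence bounded, so g is bounded and its integral over each
    cube is finite.\<close>
  define G where "G Q = enn2real (\<integral>\<^sup>+x\<in>Q. ennreal (g x) \<partial>N)" for Q
  have G_nn: "0 \<le> G Q" for Q by (simp add: G_def)
  have G: "(\<integral>\<^sup>+x\<in>Q. ennreal (g x) \<partial>N) = ennreal (G Q)" if "Q \<in> F" for Q
  proof -
    have "(\<integral>\<^sup>+x\<in>Q. ennreal (g x) \<partial>N) \<le> (\<integral>\<^sup>+x. ennreal (B powr (q - 1)) * indicator Q x \<partial>N)"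
      by (intro nn_integral_mono mult_right_mono ennreal_leI g_le) auto
    also have "\<dots> = ennreal (B powr (q - 1)) * ennreal (n Q)"
      using that n(2)[OF that] by (subst nn_integral_cmult_indicator) (auto simp: N_def)
    also have "\<dots> < \<infinity>" by (simp add: ennreal_mult_less_top)
    finally show ?thesis unfolding G_def by simp
  qed
  define X where "X = (\<Sum>Q\<in>F. k Q * a Q * G Q)"
  have X_nn: "0 \<le> X" unfolding X_def using a_nn k G_nn by (intro sum_nonneg) (auto simp: less_imp_le)
  have X: "(\<integral>\<^sup>+x. ennreal (T x powr q) \<partial>N) = ennreal X"
  proof -
    have "(\<integral>\<^sup>+x. ennreal (T x powr q) \<partial>N)
      = (\<integral>\<^sup>+x. (\<Sum>Q\<in>F. ennreal (k Q / m Q * I Q) * (ennreal (g x) * indicator Q x)) \<partial>N)"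
    proof (intro nn_integral_cong)
      fix x
      have "T x powr q = T x * g x"
        unfolding g_def using T_nn[of x] powr_add[of "T x" 1 "q - 1"] by (cases "T x = 0") auto
      also have "\<dots> = (\<Sum>Q\<in>F. (k Q / m Q * I Q) * (g x * indicator Q x))"
        unfolding T_def sum_distrib_right by (intro sum.cong) auto
      finally have "ennreal (T x powr q) = ennreal (\<Sum>Q\<in>F. (k Q / m Q * I Q) * (g x * indicator Q x))"
        by (rule arg_cong)
      also have "\<dots> = (\<Sum>Q\<in>F. ennreal ((k Q / m Q * I Q) * (g x * indicator Q x)))"
        using g_nn by (intro sum_ennreal[symmetric] mult_nonneg_nonneg[OF ka]) auto
      also have "\<dots> = (\<Sum>Q\<in>F. ennreal (k Q / m Q * I Q) * (ennreal (g x) * indicator Q x))"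
        by (intro sum.cong refl) (simp only: ennreal_mult'[OF ka] ennreal_mult'[OF g_nn] ennreal_indicator)
      finally show "ennreal (T x powr q)
          = (\<Sum>Q\<in>F. ennreal (k Q / m Q * I Q) * (ennreal (g x) * indicator Q x))" .
    qed
    also have "\<dots> = (\<Sum>Q\<in>F. \<integral>\<^sup>+x. ennreal (k Q / m Q * I Q) * (ennreal (g x) * indicator Q x) \<partial>N)"
      by (intro nn_integral_sum) auto
    also have "\<dots> = (\<Sum>Q\<in>F. ennreal (k Q / m Q * I Q) * ennreal (G Q))"
      by (intro sum.cong refl) (simp add: nn_integral_cmult G)
    also have "\<dots> = (\<Sum>Q\<in>F. ennreal (k Q * a Q * G Q))"
      using ka G_nn by (intro sum.cong refl) (simp add: a_def ennreal_mult'[symmetric])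
    also have "\<dots> = ennreal X"
      unfolding X_def using a_nn k G_nn by (intro sum_ennreal) (auto simp: less_imp_le)
    finally show ?thesis .
  qed
  \<comment> \<open>Cubes of zero average contribute nothing to X and have no size class.\<close>
  define F0 where "F0 = {Q\<in>F. 0 < a Q}"
  have F0: "finite F0" "F0 \<subseteq> F" "laminar F0" using F laminar_subset[of F F0] by (auto simp: F0_def)
  obtain S E where SF0: "S \<subseteq> F0" and SR: "\<And>Q. Q \<in> F0 \<Longrightarrow> \<exists>R\<in>S. Q \<subseteq> R \<and> a Q \<le> 2 * a R"
    and E: "\<And>R. R \<in> S \<Longrightarrow> E R \<in> sets M" "\<And>R. R \<in> S \<Longrightarrow> E R \<subseteq> R"
      "\<And>R. R \<in> S \<Longrightarrow> emeasure M R \<le> 2 * emeasure M (E R)"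
    and overlap: "\<And>x. card {R\<in>S. x \<in> E R} \<le> 2"
  proof (rule sparse_selection[of F0 M "\<lambda>x. ennreal (f x)" a])
    fix Q assume Q: "Q \<in> F0"
    then have QF: "Q \<in> F" using F0 by blast
    show "emeasure M Q < \<infinity>" using m(2)[OF QF] by simp
    show "0 < a Q" using Q by (simp add: F0_def)
    show "(\<integral>\<^sup>+x\<in>Q. ennreal (f x) \<partial>M) = ennreal (a Q) * emeasure M Q"
      using I(2)[OF QF] m[OF QF] a_nn[OF QF] by (simp add: a_def flip: ennreal_mult)
  qed (use F0 F(3) in auto)
  have SF: "S \<subseteq> F" "finite S" "laminar S"
    using SF0 F0 finite_subset laminar_subset by blast+
  have SFD: "R \<in> F" if "R \<in> S" for R using that SF by blast
  let ?C0 = "2 / (1 - 2 powr - \<alpha>)"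
  have C0: "0 < 1 - 2 powr - \<alpha>" using \<open>0 < \<alpha>\<close> powr_less_mono[of "- \<alpha>" 0 2] by simp
  have geo: "(\<Sum>Q\<in>{Q\<in>F0. Q \<subseteq> R}. k Q * G Q) \<le> k R / (1 - 2 powr - \<alpha>) * G R" if "R \<in> S" for R
  proof -
    \<comment> \<open>With g absorbed into the measure, G Q is the measure of Q, and the geometric
      summation over levels applies.\<close>
    define N' where "N' = density N (\<lambda>x. ennreal (g x))"
    have sN': "sets N' = sets M" by (simp add: N'_def)
    have N'Q: "emeasure N' Q = ennreal (G Q)" if "Q \<in> F" for Q
      unfolding N'_def using that by (subst emeasure_density) (auto simp: G)
    have "(\<Sum>Q\<in>{Q\<in>F0. Q \<subseteq> R}. ennreal (2 powr (- \<alpha> * lev Q)) * emeasure N' Q)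
      \<le> ennreal (2 powr (- \<alpha> * lev R) / (1 - 2 powr - \<alpha>)) * emeasure N' R"
    proof (rule sum_levels_le)
      show "{Q\<in>F0. Q \<subseteq> R} \<subseteq> sets N'" using F0 Fs by (auto simp: sN')
      show "R \<in> sets N'" using SFD[OF that] Fs by (simp add: sN')
      show "Q \<inter> Q' = {}" if "Q \<in> {Q\<in>F0. Q \<subseteq> R}" "Q' \<in> {Q\<in>F0. Q \<subseteq> R}" "lev Q = lev Q'" "Q \<noteq> Q'" for Q Q'
        using dis that F0 by blast
      show "lev R \<le> lev Q" if "Q \<in> {Q\<in>F0. Q \<subseteq> R}" for Q
        using lev SFD[OF \<open>R \<in> S\<close>] that F0 by blast
    qed (use F0 \<open>0 < \<alpha>\<close> in auto)
    also have "(\<Sum>Q\<in>{Q\<in>F0. Q \<subseteq> R}. ennreal (2 powr (- \<alpha> * lev Q)) * emeasure N' Q)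
      = (\<Sum>Q\<in>{Q\<in>F0. Q \<subseteq> R}. ennreal (k Q) * ennreal (G Q))"
      using F0 N'Q by (intro sum.cong) (auto simp: k_def)
    also have "ennreal (2 powr (- \<alpha> * lev R) / (1 - 2 powr - \<alpha>)) * emeasure N' R
      = ennreal (k R / (1 - 2 powr - \<alpha>) * G R)"
      using C0 G_nn k[of R] by (subst ennreal_mult) (auto simp: N'Q[OF SFD[OF that]] k_def)
    finally show ?thesis
      using C0 G_nn k by (subst (asm) ennreal_sum_mult_le_iff) (auto simp: less_imp_le)
  qed
  have sparse: "X \<le> ?C0 * (\<Sum>R\<in>S. k R / m R * I R * G R)"
  proof -
    have "X = (\<Sum>Q\<in>F0. k Q * a Q * G Q)"
      unfolding X_def F0_def using F(1) a_nn by (intro sum.mono_neutral_right) force+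
    \<comment> \<open>Q is charged to every kept R that contains it instead of one chosen R. All
      terms are nonnegative, so this only enlarges the sum, and the two sums can then be
      exchanged.\<close>
    also have "\<dots> \<le> (\<Sum>Q\<in>F0. \<Sum>R\<in>S. if Q \<subseteq> R then 2 * a R * (k Q * G Q) else 0)"
    proof (intro sum_mono)
      fix Q assume Q: "Q \<in> F0"
      then obtain R where R: "R \<in> S" "Q \<subseteq> R" "a Q \<le> 2 * a R" using SR by blast
      have "k Q * a Q * G Q = a Q * (k Q * G Q)" by simp
      also have "\<dots> \<le> 2 * a R * (k Q * G Q)"
        using R(3) k[of Q] G_nn[of Q] by (intro mult_right_mono) auto
      also have "\<dots> = (if Q \<subseteq> R then 2 * a R * (k Q * G Q) else 0)" using R by simp
      also have "\<dots> \<le> (\<Sum>R\<in>S. if Q \<subseteq> R then 2 * a R * (k Q * G Q) else 0)"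
        using SF(2) R(1) a_nn SFD k[of Q] G_nn[of Q] by (intro member_le_sum) auto
      finally show "k Q * a Q * G Q \<le> \<dots>" .
    qed
    also have "\<dots> = (\<Sum>R\<in>S. \<Sum>Q\<in>F0. if Q \<subseteq> R then 2 * a R * (k Q * G Q) else 0)"
      by (rule sum.swap)
    also have "\<dots> = (\<Sum>R\<in>S. 2 * a R * (\<Sum>Q\<in>{Q\<in>F0. Q \<subseteq> R}. k Q * G Q))"
      using F0(1) by (intro sum.cong refl) (simp add: sum_distrib_left sum.inter_filter if_distrib cong: if_cong)
    also have "\<dots> \<le> (\<Sum>R\<in>S. 2 * a R * (k R / (1 - 2 powr - \<alpha>) * G R))"
      using a_nn SFD by (intro sum_mono mult_left_mono geo) auto
    also have "\<dots> = ?C0 * (\<Sum>R\<in>S. k R / m R * I R * G R)"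
      unfolding sum_distrib_left a_def by (intro sum.cong refl) (simp add: field_simps)
    finally show ?thesis .
  qed
  have D_bound: "(\<Sum>R\<in>S. s R * (I R / s R) powr p) \<le> carleson_const c p * J"
  proof -
    \<comment> \<open>Carleson embedding for f / \<sigma> in the measure \<sigma> dx, where the
      average over R is I R / s R.\<close>
    have "(\<Sum>R\<in>S. ennreal ((I R / s R) powr p) * emeasure D R)
      \<le> ennreal (4 * c * p * 2 powr (p - 1) / (p - 1)) * (\<integral>\<^sup>+x. ennreal ((f x / \<sigma> x) powr p) \<partial>D)"
    proof (rule carleson_embedding[where E = E])
      fix Q assume Q: "Q \<in> S"
      then have QF: "Q \<in> F" by (rule SFD)
      show "emeasure D Q < \<infinity>" using s(2)[OF QF] by (simp add: D_def)
      show "0 \<le> I Q / s Q" using I(1)[OF QF] s(1)[OF QF] by simp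
      have "(\<integral>\<^sup>+x\<in>Q. ennreal (f x / \<sigma> x) \<partial>D) = (\<integral>\<^sup>+x. ennreal (\<sigma> x) * (ennreal (f x / \<sigma> x) * indicator Q x) \<partial>M)"
        unfolding D_def using QF by (subst nn_integral_density) auto
      also have "\<dots> = (\<integral>\<^sup>+x\<in>Q. ennreal (f x) \<partial>M)"
      proof (rule nn_integral_cong_AE, use \<sigma> in eventually_elim)
        case (elim x)
        then have "ennreal (\<sigma> x) * ennreal (f x / \<sigma> x) = ennreal (f x)"
          using f by (simp flip: ennreal_mult')
        then show ?case by (simp add: mult.assoc[symmetric])
      qed
      also have "\<dots> = ennreal (I Q / s Q) * emeasure D Q"
        using I[OF QF] s[OF QF] by (simp add: D_def flip: ennreal_mult)
      finally show "ennreal (I Q / s Q) * emeasure D Q \<le> (\<integral>\<^sup>+x\<in>Q. ennreal (f x / \<sigma> x) \<partial>D)" by simp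
      show "emeasure D Q \<le> ennreal c * emeasure D (E Q)"
        unfolding D_def using QF E Q by (intro half_\<sigma>) auto
    qed (use SF sfN F(3) E overlap \<open>0 \<le> c\<close> pq in \<open>auto simp: D_def\<close>)
    also have "\<dots> \<le> ennreal (carleson_const c p) * ennreal J"
      unfolding carleson_const_def D_def by (intro mult_left_mono J) simp
    also have "\<dots> = ennreal (carleson_const c p * J)"
      using J(1) carleson_const_nonneg[OF \<open>0 \<le> c\<close> pq(1)] by (simp add: ennreal_mult)
    also have "(\<Sum>R\<in>S. ennreal ((I R / s R) powr p) * emeasure D R)
      = (\<Sum>R\<in>S. ennreal (s R) * ennreal ((I R / s R) powr p))"
      by (intro sum.cong refl) (simp add: D_def s(2)[OF SFD] mult.commute)
    finally show ?thesis
      using carleson_const_nonneg[OF \<open>0 \<le> c\<close> pq(1)] J(1) s(1)[OF SFD]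
      by (subst (asm) ennreal_sum_mult_le_iff) (auto simp: less_imp_le)
  qed
  have N_bound: "(\<Sum>R\<in>S. n R * (G R / n R) powr q') \<le> carleson_const c q' * X"
  proof -
    \<comment> \<open>Carleson embedding for g in the measure w dx. As (q - 1) * q' = q, the
      integral on the right is X again.\<close>
    have "(\<Sum>R\<in>S. ennreal ((G R / n R) powr q') * emeasure N R)
      \<le> ennreal (4 * c * q' * 2 powr (q' - 1) / (q' - 1)) * (\<integral>\<^sup>+x. ennreal (g x powr q') \<partial>N)"
    proof (rule carleson_embedding[where E = E])
      fix Q assume Q: "Q \<in> S"
      then have QF: "Q \<in> F" by (rule SFD)
      show "emeasure N Q < \<infinity>" using n(2)[OF QF] by (simp add: N_def)
      show "0 \<le> G Q / n Q" using G_nn n(1)[OF QF] by simp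
      show "ennreal (G Q / n Q) * emeasure N Q \<le> (\<integral>\<^sup>+x\<in>Q. ennreal (g x) \<partial>N)"
        unfolding G[OF QF] using n[OF QF] G_nn[of Q] by (simp add: N_def flip: ennreal_mult)
      show "emeasure N Q \<le> ennreal c * emeasure N (E Q)"
        unfolding N_def using QF E Q by (intro half_w) auto
    qed (use SF sfN F(3) E overlap \<open>0 \<le> c\<close> q' in \<open>auto simp: N_def\<close>)
    also have "(\<integral>\<^sup>+x. ennreal (g x powr q') \<partial>N) = ennreal X"
      unfolding X[symmetric] by (simp add: g_def powr_powr q'(3))
    also have "ennreal (4 * c * q' * 2 powr (q' - 1) / (q' - 1)) * ennreal X = ennreal (carleson_const c q' * X)"
      using X_nn carleson_const_nonneg[OF \<open>0 \<le> c\<close> q'(1)] by (simp add: ennreal_mult carleson_const_def[symmetric])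
    also have "(\<Sum>R\<in>S. ennreal ((G R / n R) powr q') * emeasure N R)
      = (\<Sum>R\<in>S. ennreal (n R) * ennreal ((G R / n R) powr q'))"
      by (intro sum.cong refl) (simp add: N_def n(2)[OF SFD] mult.commute)
    finally show ?thesis
      using carleson_const_nonneg[OF \<open>0 \<le> c\<close> q'(1)] X_nn n(1)[OF SFD]
      by (subst (asm) ennreal_sum_mult_le_iff) (auto simp: less_imp_le)
  qed
  have "(\<Sum>R\<in>S. k R / m R * I R * G R)
    \<le> K * (carleson_const c p * J) powr (1/p) * (carleson_const c q' * X) powr (1/q')"
    unfolding q'_def
  proof (rule Holder_two_weight_sum[where s = s and n = n])
    show "(\<Sum>R\<in>S. n R * (G R / n R) powr conj_exp q) \<le> carleson_const c (conj_exp q) * X"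
      using N_bound unfolding q'_def .
  qed (use pq SF \<open>0 \<le> K\<close> s(1) n(1) I(1) G_nn SFD K D_bound in \<open>auto simp: k_def\<close>)
  then have "?C0 * (\<Sum>R\<in>S. k R / m R * I R * G R)
    \<le> ?C0 * (K * (carleson_const c p * J) powr (1/p) * (carleson_const c q' * X) powr (1/q'))"
    using C0 by (intro mult_left_mono) auto
  with sparse have X_le: "X \<le> ?C0 * (K * (carleson_const c p * J) powr (1/p) * (carleson_const c q' * X) powr (1/q'))"
    by linarith
  define Y where "Y = ?C0 * K * carleson_const c p powr (1/p) * carleson_const c q' powr (1/q')"
  have cc: "0 \<le> carleson_const c p" "0 \<le> carleson_const c q'"
    using carleson_const_nonneg \<open>0 \<le> c\<close> pq q' by auto
  have Y_nn: "0 \<le> Y" unfolding Y_def using C0 \<open>0 \<le> K\<close> by (intro mult_nonneg_nonneg) auto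
  have "X \<le> Y powr q * J powr (q / p)"
  \<comment> \<open>X is a real number, so for X > 0 the factor X^(1/q') cancels and X^(1/q) \<le> Y
    * J^(1/p) remains.\<close>
  proof (cases "X = 0")
    case False
    then have Xp: "0 < X" using X_nn by simp
    have "X \<le> Y * J powr (1/p) * X powr (1/q')"
      using X_le cc J(1) X_nn by (simp add: powr_mult Y_def mult_ac)
    moreover have "X = X powr (1/q) * X powr (1/q')"
      using Xp q'(2) by (simp flip: powr_add)
    ultimately have "X powr (1/q) * X powr (1/q') \<le> Y * J powr (1/p) * X powr (1/q')" by simp
    then have "X powr (1/q) \<le> Y * J powr (1/p)" using Xp by simp
    then have "(X powr (1/q)) powr q \<le> (Y * J powr (1/p)) powr q"
      using pq by (intro powr_mono2) auto
    then show ?thesis using Xp pq Y_nn by (simp add: powr_powr powr_mult)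
  qed (use Y_nn in simp)
  also have "Y powr q = dyadic_const \<alpha> p q K c"
    unfolding Y_def dyadic_const_def q'_def by simp
  finally have "X \<le> dyadic_const \<alpha> p q K c * J powr (q / p)" .
  then have "(\<integral>\<^sup>+x. ennreal (T x powr q) \<partial>N) \<le> ennreal (dyadic_const \<alpha> p q K c * J powr (q / p))"
    unfolding X by (rule ennreal_leI)
  then show ?thesis unfolding T_def N_def k_def .
qed

section \<open>Muckenhoupt weights\<close>

text \<open>Integrability on compact sets gives measurability of the cut-off functions; w is their
  limit along growing balls.\<close>

lemma weight_measurable:
  fixes w :: "real^'n \<Rightarrow> real"
  assumes "weight w"
  shows "w \<in> borel_measurable lebesgue"
proof (rule borel_measurable_LIMSEQ_real)
  let ?B = "\<lambda>k::nat. cball (0::real^'n) (real k)"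
  show "(\<lambda>x. indicator (?B k) x *\<^sub>R w x) \<in> borel_measurable lebesgue" for k
    using assms unfolding weight_def set_integrable_def
    by (intro borel_measurable_integrable) auto
  fix x :: "real^'n"
  obtain k0 :: nat where k0: "norm x \<le> real k0" using real_arch_simple by blast
  have "\<forall>\<^sub>F k in sequentially. indicator (?B k) x *\<^sub>R w x = w x"
    using eventually_ge_at_top[of k0] by eventually_elim (use k0 in \<open>auto simp: indicator_def\<close>)
  then show "(\<lambda>k. indicator (?B k) x *\<^sub>R w x) \<longlonglongrightarrow> w x"
    by (rule tendsto_eventually)
qed

lemma weight_nn_integral_finite:
  fixes w :: "real^'n \<Rightarrow> real"
  assumes "weight w" "compact K"
  shows "(\<integral>\<^sup>+x\<in>K. ennreal (w x) \<partial>lebesgue) < \<infinity>"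
proof -
  have "(\<integral>\<^sup>+x. ennreal (norm (indicator K x *\<^sub>R w x)) \<partial>lebesgue) < \<infinity>"
    using assms unfolding weight_def set_integrable_def integrable_iff_bounded by blast
  moreover have "(\<integral>\<^sup>+x\<in>K. ennreal (w x) \<partial>lebesgue) \<le> (\<integral>\<^sup>+x. ennreal (norm (indicator K x *\<^sub>R w x)) \<partial>lebesgue)"
    by (intro nn_integral_mono) (auto simp: indicator_def ennreal_leI)
  ultimately show ?thesis by (rule le_less_trans[rotated])
qed

lemma weight_nn_integral_pos:
  fixes w :: "real^'n \<Rightarrow> real"
  assumes "weight w" and A: "A \<in> sets lebesgue" "0 < emeasure lebesgue A"
  shows "0 < (\<integral>\<^sup>+x\<in>A. ennreal (w x) \<partial>lebesgue)"
proof (rule ccontr)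
  assume "\<not> ?thesis"
  then have "(\<integral>\<^sup>+x\<in>A. ennreal (w x) \<partial>lebesgue) = 0" by simp
  moreover have "(\<lambda>x. ennreal (w x) * indicator A x) \<in> borel_measurable lebesgue"
    using weight_measurable[OF assms(1)] A(1) by measurable
  ultimately have "AE x in lebesgue. ennreal (w x) * indicator A x = 0"
    by (simp add: nn_integral_0_iff_AE)
  moreover have "AE x in lebesgue. 0 < w x" using assms(1) by (simp add: weight_def)
  ultimately have "AE x in lebesgue. x \<notin> A"
    by eventually_elim (auto simp: indicator_def split: if_splits)
  then have "emeasure lebesgue A = 0" using A(1) by (simp add: AE_iff_null_sets[symmetric] null_setsD1)
  then show False using A(2) by simp
qed

lemma conj_exp_facts:
  assumes "1 < p"
  shows "1 < conj_exp p" "1 / p + 1 / conj_exp p = 1" "conj_exp p / p = 1 / (p - 1)"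
    "1 / conj_exp p = (p - 1) / p"
  using assms unfolding conj_exp_def by (auto simp: field_simps)

lemma cubes_compact: "Q \<in> cubes \<Longrightarrow> compact Q"
  unfolding cubes_def by auto

lemma emeasure_cube:
  fixes a :: "real^'n"
  assumes "0 < l"
  shows "emeasure lebesgue (cbox a (a + vec l)) = ennreal (l ^ CARD('n))"
    "emeasure lebesgue (box a (a + vec l)) = ennreal (l ^ CARD('n))"
proof -
  have le: "a \<bullet> b \<le> (a + vec l) \<bullet> b" if "b \<in> Basis" for b
    using that assms by (auto simp: Basis_vec_def inner_axis inner_add_left)
  have eq: "(\<Prod>b\<in>Basis. ((a + vec l) - a) \<bullet> b) = l ^ CARD('n)"
  proof -
    have "(\<Prod>b\<in>Basis. ((a + vec l) - a) \<bullet> b) = (\<Prod>b\<in>(Basis::(real^'n) set). l)"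
      by (intro prod.cong refl) (auto simp: Basis_vec_def inner_axis)
    then show ?thesis by simp
  qed
  show "emeasure lebesgue (cbox a (a + vec l)) = ennreal (l ^ CARD('n))"
    using le eq by (simp add: emeasure_lborel_cbox_eq)
  show "emeasure lebesgue (box a (a + vec l)) = ennreal (l ^ CARD('n))"
    using le eq by (simp add: emeasure_lborel_box_eq)
qed

text \<open>Take w in A_r. Hoelder applied to 1 = w^(1/r) * w^(-1/r) on E gives |E|^r \<le> w(E) *
  D^(r-1), where D is the integral of w^(-r'/r) over Q. The A_r condition bounds D^(r-1) by K *
  |Q|^r / w(Q), and |Q| \<le> 2 * |E| then yields w(Q) \<le> 2^r * K * w(E).\<close>

lemma A_infty_half:
  fixes w :: "real^'n \<Rightarrow> real"
  assumes "w \<in> A_infty"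
  obtains c where "0 \<le> c" "\<And>Q E. Q \<in> cubes \<Longrightarrow> E \<in> sets lebesgue \<Longrightarrow> E \<subseteq> Q \<Longrightarrow>
    emeasure lebesgue Q \<le> 2 * emeasure lebesgue E \<Longrightarrow>
    (\<integral>\<^sup>+x\<in>Q. ennreal (w x) \<partial>lebesgue) \<le> ennreal c * (\<integral>\<^sup>+x\<in>E. ennreal (w x) \<partial>lebesgue)"
proof -
  obtain r where r: "1 < r" and wr: "w \<in> A_p r" using assms unfolding A_infty_def by auto
  let ?e = "- conj_exp r / r"
  define K where "K = (SUP Q\<in>cubes.
      ennreal_powr ((\<integral>\<^sup>+x\<in>Q. ennreal (w x powr ?e) \<partial>lebesgue) / emeasure lebesgue Q) (r - 1)
      * ((\<integral>\<^sup>+x\<in>Q. ennreal (w x) \<partial>lebesgue) / emeasure lebesgue Q))"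
  have weight: "weight w" and K: "K < \<infinity>" using wr unfolding A_p_def K_def by auto
  define c where "c = enn2real K * 2 powr r"
  note r' = conj_exp_facts[OF r]
  have [measurable]: "w \<in> borel_measurable lebesgue" by (rule weight_measurable[OF weight])
  show thesis
  proof
    show "0 \<le> c" by (simp add: c_def)
    fix Q E :: "(real^'n) set"
    assume Q: "Q \<in> cubes" and E[measurable]: "E \<in> sets lebesgue" and EQ: "E \<subseteq> Q"
      and half: "emeasure lebesgue Q \<le> 2 * emeasure lebesgue E"
    obtain a l where al: "Q = cbox a (a + vec l)" "0 < l" using Q unfolding cubes_def by blast
    have Qm[measurable]: "Q \<in> sets lebesgue" by (simp add: al(1))
    define L where "L = l ^ CARD('n)"
    have L: "0 < L" "emeasure lebesgue Q = ennreal L"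
      using al(2) emeasure_cube(1)[OF al(2), of a] unfolding L_def al(1) by auto
    define W D e where "W = (\<integral>\<^sup>+x\<in>Q. ennreal (w x) \<partial>lebesgue)"
      and "D = (\<integral>\<^sup>+x\<in>Q. ennreal (w x powr ?e) \<partial>lebesgue)"
      and "e = (\<integral>\<^sup>+x\<in>E. ennreal (w x) \<partial>lebesgue)"
    have Wf: "W < \<infinity>" unfolding W_def by (rule weight_nn_integral_finite[OF weight cubes_compact[OF Q]])
    have W0: "0 < W" unfolding W_def using L by (intro weight_nn_integral_pos[OF weight]) auto
    have eW: "e \<le> W" unfolding e_def W_def
      using EQ by (intro nn_integral_mono) (auto simp: indicator_def)
    have EL: "emeasure lebesgue E \<le> ennreal L" unfolding L(2)[symmetric]
      by (rule emeasure_mono[OF EQ Qm])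
    define M where "M = enn2real (emeasure lebesgue E)"
    have M: "emeasure lebesgue E = ennreal M" "0 \<le> M"
      unfolding M_def using EL le_less_trans[OF EL] by auto
    have LM: "L \<le> 2 * M"
    proof -
      have "ennreal L \<le> ennreal (2 * M)" using half M unfolding L(2) by (simp add: ennreal_mult)
      then show ?thesis using M(2) by simp
    qed
    have M0: "0 < M" using LM L by linarith
    have e0: "0 < e" unfolding e_def using M M0 by (intro weight_nn_integral_pos[OF weight]) auto
    obtain W' e' where We: "W = ennreal W'" "0 < W'" "e = ennreal e'" "0 < e'"
    proof
      show "W = ennreal (enn2real W)" using Wf by simp
      show "e = ennreal (enn2real e)" using le_less_trans[OF eW Wf] by simp
      show "0 < enn2real W" using Wf W0 by (simp add: enn2real_positive_iff)
      show "0 < enn2real e" using le_less_trans[OF eW Wf] e0 by (simp add: enn2real_positive_iff)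
    qed
    have AK: "ennreal_powr (D / ennreal L) (r - 1) * (W / ennreal L) \<le> K"
      unfolding K_def D_def W_def L(2)[symmetric] by (rule SUP_upper[OF Q])
    have WL: "W / ennreal L = ennreal (W' / L)" using We L by (simp add: divide_ennreal)
    \<comment> \<open>Since w has positive integral over Q, an infinite D would make the A_r
      expression infinite.\<close>
    have Df: "D < \<infinity>"
    proof (rule ccontr)
      assume "\<not> ?thesis"
      then have "D = \<infinity>" by (metis infinity_ennreal_def less_top)
      then have "D / ennreal L = \<infinity>" by (simp add: ennreal_top_divide)
      then have "ennreal_powr (D / ennreal L) (r - 1) * (W / ennreal L) = \<infinity>"
        using We L unfolding WL by (simp add: ennreal_powr_def ennreal_top_mult)
      then show False using AK K by (simp add: top_unique)
    qed
    define D' where "D' = enn2real D"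
    have D': "D = ennreal D'" "0 \<le> D'" using Df unfolding D'_def by auto
    have AE_pos: "AE x in lebesgue. 0 < w x" using weight by (simp add: weight_def)
    \<comment> \<open>Stated for every positive upper bound d of D', so that it can also be used to
      exclude D' = 0.\<close>
    have Hol: "M \<le> e' powr (1 / r) * d powr (1 / conj_exp r)" if d: "D' \<le> d" "0 < d" for d
    proof -
      \<comment> \<open>The weight may be negative on a null set; \<open>max 0\<close> matches the
        truncation that \<open>ennreal\<close> performs in the integral e.\<close>
      let ?a = "\<lambda>x. (indicator E x * max 0 (w x)) powr (1 / r)"
      let ?b = "\<lambda>x. indicator E x * w x powr (- 1 / r)"
      have "emeasure lebesgue E = (\<integral>\<^sup>+x. indicator E x \<partial>lebesgue)" by simp
      also have "\<dots> = (\<integral>\<^sup>+x. ennreal (?a x * ?b x) \<partial>lebesgue)"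
      proof (rule nn_integral_cong_AE, use AE_pos in eventually_elim)
        case (elim x)
        have "w x powr (1 / r) * w x powr (- 1 / r) = 1" using elim by (simp flip: powr_add)
        then show ?case using elim by (simp add: indicator_def)
      qed
      also have "\<dots> \<le> ennreal (e' powr (1 / r) * d powr (1 / conj_exp r))"
      proof (rule Holder_nn_integral)
        have "(\<integral>\<^sup>+x. ennreal (?a x powr r) \<partial>lebesgue) = e"
          unfolding e_def using r by (intro nn_integral_cong) (auto simp: powr_powr indicator_def max_def ennreal_neg)
        then show "(\<integral>\<^sup>+x. ennreal (?a x powr r) \<partial>lebesgue) \<le> ennreal e'" using We by simp
        have "(\<integral>\<^sup>+x. ennreal (?b x powr conj_exp r) \<partial>lebesgue) \<le> D"
        proof (unfold D_def, rule nn_integral_mono)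
          fix x
          show "ennreal (?b x powr conj_exp r) \<le> ennreal (w x powr ?e) * indicator Q x"
            using EQ by (auto simp: indicator_def powr_powr)
        qed
        also have "\<dots> \<le> ennreal d" unfolding D' using d by (simp add: ennreal_leI)
        finally show "(\<integral>\<^sup>+x. ennreal (?b x powr conj_exp r) \<partial>lebesgue) \<le> ennreal d" .
      qed (use r r' We d in auto)
      finally show ?thesis unfolding M by (simp add: ennreal_le_iff)
    qed
    have D0: "0 < D'"
    proof (rule ccontr)
      assume "\<not> ?thesis"
      then have D'0: "D' = 0" using D'(2) by simp
      \<comment> \<open>Chosen so that the Hoelder bound becomes M / 2, which contradicts M >
        0.\<close>
      let ?d = "(M / (2 * e' powr (1 / r))) powr conj_exp r"
      have "0 < M / (2 * e' powr (1 / r))" using M0 We by simp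
      then have "M \<le> e' powr (1 / r) * ?d powr (1 / conj_exp r)" by (intro Hol) (auto simp: D'0)
      also have "?d powr (1 / conj_exp r) = M / (2 * e' powr (1 / r))"
        using r'(1) M0 We by (simp add: powr_powr)
      finally show False using M0 We by simp
    qed
    have "M powr r \<le> (e' powr (1 / r) * D' powr (1 / conj_exp r)) powr r"
      using Hol[of D'] D0 M0 r by (intro powr_mono2) auto
    also have "\<dots> = e' * D' powr (r - 1)"
      using We D0 r r'(4) by (simp add: powr_mult powr_powr)
    finally have Mr: "M powr r \<le> e' * D' powr (r - 1)" .
    have "D / ennreal L = ennreal (D' / L)" using D' L by (simp add: divide_ennreal)
    then have "ennreal ((D' / L) powr (r - 1) * (W' / L)) \<le> K"
      using AK L D'(2) unfolding WL by (subst ennreal_mult') (simp_all add: ennreal_powr_def)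
    then have "(D' / L) powr (r - 1) * (W' / L) \<le> enn2real K"
      using K L We D' by (metis ennreal_enn2real ennreal_le_iff enn2real_nonneg infinity_ennreal_def less_top)
    moreover have "(D' / L) powr (r - 1) * (W' / L) = D' powr (r - 1) * W' / L powr r"
    proof -
      have "L powr r = L powr (r - 1) * L" using L powr_add[of L "r - 1" 1] by simp
      then show ?thesis using D' L by (simp add: powr_divide)
    qed
    ultimately have "D' powr (r - 1) * W' / L powr r \<le> enn2real K" by (simp only:)
    then have "D' powr (r - 1) * W' \<le> enn2real K * L powr r"
      using L by (simp add: divide_le_eq)
    also have "\<dots> \<le> enn2real K * (2 * M) powr r"
      using LM L r by (intro mult_left_mono powr_mono2) auto
    also have "\<dots> = c * M powr r" unfolding c_def using M0 by (simp add: powr_mult)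
    also have "\<dots> \<le> c * (e' * D' powr (r - 1))"
      using Mr unfolding c_def by (intro mult_left_mono) auto
    finally have "D' powr (r - 1) * W' \<le> D' powr (r - 1) * (c * e')" by (simp add: mult_ac)
    then have "W' \<le> c * e'" using D0 by simp
    then show "(\<integral>\<^sup>+x\<in>Q. ennreal (w x) \<partial>lebesgue) \<le> ennreal c * (\<integral>\<^sup>+x\<in>E. ennreal (w x) \<partial>lebesgue)"
      unfolding W_def[symmetric] e_def[symmetric] We using We
      by (subst ennreal_mult[symmetric]) (auto simp: c_def ennreal_leI)
  qed
qed

section \<open>Translated dyadic grids and the Riesz potential\<close>

lemma sigma_finite_lebesgue: "sigma_finite_measure (lebesgue :: 'a::euclidean_space measure)"
proof
  obtain A :: "'a set set" where A: "countable A" "A \<subseteq> sets lborel" "\<Union>A = space lborel"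
    "\<forall>a\<in>A. emeasure lborel a \<noteq> \<infinity>"
    using sigma_finite_measure.sigma_finite_countable[OF sigma_finite_lborel] by blast
  then have "A \<subseteq> sets lebesgue" "\<forall>a\<in>A. emeasure lebesgue a \<noteq> \<infinity>"
    by (auto simp: emeasure_completion subset_iff)
  then show "\<exists>A. countable A \<and> A \<subseteq> sets lebesgue \<and> \<Union>A = space (lebesgue :: 'a measure)
      \<and> (\<forall>a\<in>A. emeasure lebesgue a \<noteq> \<infinity>)"
    using A by (intro exI[of _ A]) auto
qed

text \<open>The one-third trick: for \<open>b = True\<close> the grid of intervals of length \<open>2\<^sup>-\<^sup>k\<close> is translated by
  \<open>\<plusminus>2\<^sup>-\<^sup>k / 3\<close>; the alternating sign is what keeps consecutive translated grids nested.\<close>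

definition grid_shift :: "bool \<Rightarrow> int \<Rightarrow> real" where
  "grid_shift b k = (if b then if even k then 1 / 3 else - 1 / 3 else 0)"

text \<open>The integer coordinates of the cube of side 2^(-k) containing x. Cubes are the fibres of
  this map, so lying in a common cube is equality of indices and nestedness is arithmetic of floors.
  Each coordinate chooses its own shift through \<beta>, which gives 2^d grids.\<close>

definition grid_index :: "('n \<Rightarrow> bool) \<Rightarrow> int \<Rightarrow> real^'n \<Rightarrow> 'n \<Rightarrow> int" where
  "grid_index \<beta> k x i = \<lfloor>2 powr k * x $ i - grid_shift (\<beta> i) k\<rfloor>"

definition grid_cube :: "('n \<Rightarrow> bool) \<Rightarrow> int \<Rightarrow> ('n \<Rightarrow> int) \<Rightarrow> (real^'n) set" where
  "grid_cube \<beta> k m = {x. grid_index \<beta> k x = m}"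

definition grid :: "('n \<Rightarrow> bool) \<Rightarrow> (real^'n) set set" where
  "grid \<beta> = {grid_cube \<beta> k m | k m. True}"

section \<open>Nestedness and measure of grid cubes\<close>

lemma floor_half: "\<lfloor>y :: real\<rfloor> = \<lfloor>2 * y\<rfloor> div 2"
proof -
  have "2 * \<lfloor>y\<rfloor> \<le> \<lfloor>2 * y\<rfloor>" by (simp add: le_floor_iff)
  moreover have "\<lfloor>2 * y\<rfloor> < 2 * \<lfloor>y\<rfloor> + 2" by (simp add: floor_less_iff) linarith
  ultimately show ?thesis by presburger
qed

text \<open>Because 2/3 = 1 - 1/3, doubling a shift by one third gives the opposite shift of the
  next level up to an integer. The index at level k is therefore a function of the index at level k
  + 1.\<close>

lemma grid_index_refine:
  "grid_index \<beta> k x i = (grid_index \<beta> (k + 1) x i + (if \<beta> i then if even k then - 1 else 1 else 0)) div 2"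
proof -
  let ?e = "if \<beta> i then if even k then - 1 else 1 else 0 :: int"
  have "2 * (2 powr k * x $ i - grid_shift (\<beta> i) k)
      = (2 powr (k + 1) * x $ i - grid_shift (\<beta> i) (k + 1)) + of_int ?e"
    by (auto simp: grid_shift_def powr_add)
  then have "\<lfloor>2 * (2 powr k * x $ i - grid_shift (\<beta> i) k)\<rfloor> = grid_index \<beta> (k + 1) x i + ?e"
    unfolding grid_index_def by (simp only: floor_add_int)
  then show ?thesis unfolding grid_index_def[of \<beta> k] by (subst floor_half) simp
qed

lemma grid_index_eq_coarser:
  assumes "k \<le> k'" "grid_index \<beta> k' x = grid_index \<beta> k' y"
  shows "grid_index \<beta> k x = grid_index \<beta> k y"
  using assms
proof (induction k' rule: int_ge_induct)
  case (step j)
  then have "grid_index \<beta> j x = grid_index \<beta> j y"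
    by (intro ext) (simp add: grid_index_refine[of \<beta> j])
  then show ?case by (rule step.IH)
qed simp

lemma grid_cube_nested:
  assumes "k \<le> k'" "x \<in> grid_cube \<beta> k m" "x \<in> grid_cube \<beta> k' m'"
  shows "grid_cube \<beta> k' m' \<subseteq> grid_cube \<beta> k m"
proof
  fix y assume "y \<in> grid_cube \<beta> k' m'"
  then have "grid_index \<beta> k' y = grid_index \<beta> k' x" using assms(3) by (simp add: grid_cube_def)
  from grid_index_eq_coarser[OF assms(1) this] show "y \<in> grid_cube \<beta> k m"
    using assms(2) by (simp add: grid_cube_def)
qed

lemma laminar_grid: "laminar (grid \<beta>)"
  unfolding laminar_def
proof (intro ballI)
  fix A B assume "A \<in> grid \<beta>" "B \<in> grid \<beta>"
  then obtain k m k' m' where AB: "A = grid_cube \<beta> k m" "B = grid_cube \<beta> k' m'" unfolding grid_def by blast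
  show "A \<subseteq> B \<or> B \<subseteq> A \<or> A \<inter> B = {}"
    unfolding AB using grid_cube_nested[of k k' _ \<beta> m m'] grid_cube_nested[of k' k _ \<beta> m' m]
    by (cases "k \<le> k'") auto
qed

lemma grid_cube_disjoint: "m \<noteq> m' \<Longrightarrow> grid_cube \<beta> k m \<inter> grid_cube \<beta> k m' = {}"
  unfolding grid_cube_def by auto

text \<open>Grid cubes are half-open, whereas the weight conditions speak of closed cubes; enclosing
  a grid cube between an open and a closed cube of the same side transfers measures and weight
  bounds.\<close>

lemma grid_cube_between:
  fixes \<beta> :: "'n::finite \<Rightarrow> bool"
  obtains a where "box a (a + vec (2 powr - real_of_int k)) \<subseteq> grid_cube \<beta> k m"
    "grid_cube \<beta> k m \<subseteq> cbox a (a + vec (2 powr - real_of_int k))"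
proof
  let ?a = "(\<chi> i. 2 powr - real_of_int k * (m i + grid_shift (\<beta> i) k)) :: real^'n"
  have iff: "x \<in> grid_cube \<beta> k m \<longleftrightarrow> (\<forall>i. ?a $ i \<le> x $ i \<and> x $ i < ?a $ i + 2 powr - real_of_int k)" for x
  proof -
    have "grid_index \<beta> k x i = m i \<longleftrightarrow> ?a $ i \<le> x $ i \<and> x $ i < ?a $ i + 2 powr - real_of_int k" for i
    proof -
      have "grid_index \<beta> k x i = m i \<longleftrightarrow> m i \<le> 2 powr k * x $ i - grid_shift (\<beta> i) k
          \<and> 2 powr k * x $ i - grid_shift (\<beta> i) k < real_of_int (m i) + 1"
        unfolding grid_index_def by (rule floor_eq_iff)
      also have "\<dots> \<longleftrightarrow> ?a $ i \<le> x $ i \<and> x $ i < ?a $ i + 2 powr - real_of_int k"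
        by (simp add: powr_minus field_simps)
      finally show ?thesis .
    qed
    then show ?thesis unfolding grid_cube_def fun_eq_iff by simp
  qed
  show "box ?a (?a + vec (2 powr - real_of_int k)) \<subseteq> grid_cube \<beta> k m"
    unfolding subset_iff iff by (auto simp: mem_box_cart less_imp_le)
  show "grid_cube \<beta> k m \<subseteq> cbox ?a (?a + vec (2 powr - real_of_int k))"
    unfolding subset_iff iff by (auto simp: mem_box_cart less_imp_le)
qed

lemma grid_cube_borel: 
  fixes \<beta> :: "'n::finite \<Rightarrow> bool"
  shows "grid_cube \<beta> k m \<in> sets borel"
proof -
  have "grid_cube \<beta> k m = (\<Inter>i\<in>UNIV. (\<lambda>x. \<lfloor>2 powr k * x $ i - grid_shift (\<beta> i) k\<rfloor>) -` {m i})"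
    unfolding grid_cube_def grid_index_def by auto
  also have "\<dots> \<in> sets borel"
  proof (rule sets.finite_INT)
    fix i
    have "(\<lambda>x :: real^'n. x $ i) \<in> borel_measurable borel"
      by (intro borel_measurable_continuous_onI continuous_intros)
    then have "(\<lambda>x :: real^'n. \<lfloor>2 powr k * x $ i - grid_shift (\<beta> i) k\<rfloor>) \<in> measurable borel (count_space UNIV)"
      by measurable
    from measurable_sets[OF this, of "{m i}"]
    show "(\<lambda>x :: real^'n. \<lfloor>2 powr k * x $ i - grid_shift (\<beta> i) k\<rfloor>) -` {m i} \<in> sets borel" by simp
  qed auto
  finally show ?thesis .
qed

lemma emeasure_grid_cube:
  fixes \<beta> :: "'n::finite \<Rightarrow> bool"
  shows "emeasure lebesgue (grid_cube \<beta> k m) = ennreal (2 powr (- real CARD('n) * k))"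
proof -
  obtain a where a: "box a (a + vec (2 powr - real_of_int k)) \<subseteq> grid_cube \<beta> k m"
    "grid_cube \<beta> k m \<subseteq> cbox a (a + vec (2 powr - real_of_int k))" by (rule grid_cube_between)
  have pos: "0 < (2::real) powr - real_of_int k" by simp
  have eq: "((2::real) powr - real_of_int k) ^ CARD('n) = 2 powr (- real CARD('n) * k)"
    by (subst powr_realpow[symmetric]) (simp_all add: powr_powr mult.commute)
  have "emeasure lebesgue (grid_cube \<beta> k m) \<le> ennreal (2 powr (- real CARD('n) * k))"
    unfolding eq[symmetric] emeasure_cube(1)[OF pos, of a, symmetric] by (rule emeasure_mono[OF a(2)]) simp
  moreover have "ennreal (2 powr (- real CARD('n) * k)) \<le> emeasure lebesgue (grid_cube \<beta> k m)"
    unfolding eq[symmetric] emeasure_cube(2)[OF pos, of a, symmetric]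
    by (rule emeasure_mono[OF a(1)]) (simp add: grid_cube_borel)
  ultimately show ?thesis by simp
qed

text \<open>Families are handled as sets of sets, so the level has to be recovered from the point
  set. It is unique because the measure of a grid cube determines k.\<close>

definition cube_level :: "(real^'n) set \<Rightarrow> int" where
  "cube_level Q = (THE k. \<exists>\<beta> m. Q = grid_cube \<beta> k m)"

lemma cube_level_grid_cube [simp]:
  fixes \<beta> :: "'n::finite \<Rightarrow> bool"
  shows "cube_level (grid_cube \<beta> k m) = k"
  unfolding cube_level_def
proof (rule the_equality)
  fix k' assume "\<exists>\<beta>' m'. grid_cube \<beta> k m = grid_cube \<beta>' k' m'"
  then obtain \<beta>' m' where "grid_cube \<beta> k m = grid_cube \<beta>' k' m'" by blast
  then have "ennreal (2 powr (- real CARD('n) * k)) = ennreal (2 powr (- real CARD('n) * k'))"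
    using emeasure_grid_cube[of \<beta> k m] emeasure_grid_cube[of \<beta>' k' m'] by simp
  then have "(2::real) powr (- real CARD('n) * k) = 2 powr (- real CARD('n) * k')" by simp
  then have "log 2 ((2::real) powr (- real CARD('n) * k)) = log 2 (2 powr (- real CARD('n) * k'))"
    by (rule arg_cong)
  then show "k' = k" by (simp del: log_powr add: log_powr_cancel)
qed blast

lemma grid_level_mono:
  fixes Q R :: "(real^'n) set"
  assumes "Q \<in> grid \<beta>" "R \<in> grid \<beta>" "Q \<subseteq> R"
  shows "cube_level R \<le> cube_level Q"
proof -
  obtain k m k' m' where QR: "Q = grid_cube \<beta> k m" "R = grid_cube \<beta> k' m'"
    using assms unfolding grid_def by blast
  have "emeasure lebesgue Q \<le> emeasure lebesgue R"
    using assms(3) by (rule emeasure_mono) (simp add: QR(2) grid_cube_borel)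
  then have "(2::real) powr (- real CARD('n) * k) \<le> 2 powr (- real CARD('n) * k')"
    unfolding QR emeasure_grid_cube by (simp add: ennreal_le_iff)
  then show ?thesis by (simp add: QR)
qed

text \<open>If an integer separates X from Y, both lie within 1/3 of it. A translation by 1/3 in
  either direction then moves both to the same side of that integer without reaching another
  one.\<close>

lemma one_third_trick:
  fixes X Y :: real
  assumes "\<bar>X - Y\<bar> < 1 / 3"
  shows "\<exists>b. \<lfloor>X - grid_shift b k\<rfloor> = \<lfloor>Y - grid_shift b k\<rfloor>"
proof (cases "\<lfloor>X\<rfloor> = \<lfloor>Y\<rfloor>")
  case True
  then show ?thesis by (intro exI[of _ False]) (simp add: grid_shift_def)
next
  case False
  have main: "\<lfloor>X - grid_shift True k\<rfloor> = \<lfloor>Y - grid_shift True k\<rfloor>"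
    if "\<lfloor>X\<rfloor> < \<lfloor>Y\<rfloor>" "\<bar>X - Y\<bar> < 1 / 3" for X Y :: real
  proof -
    have X: "X < \<lfloor>Y\<rfloor>" using that(1) by linarith
    have Y: "\<lfloor>Y\<rfloor> \<le> Y" by simp
    have bounds: "\<lfloor>Y\<rfloor> - 1/3 < X" "Y < \<lfloor>Y\<rfloor> + 1/3" using X Y that(2) by linarith+
    show ?thesis
    proof (cases "even k")
      case True
      have "\<lfloor>X - 1/3\<rfloor> = \<lfloor>Y\<rfloor> - 1"
        by (rule floor_unique; use X Y bounds in linarith)
      moreover have "\<lfloor>Y - 1/3\<rfloor> = \<lfloor>Y\<rfloor> - 1"
        by (rule floor_unique; use X Y bounds in linarith)
      ultimately have "\<lfloor>X - 1/3\<rfloor> = \<lfloor>Y - 1/3\<rfloor>" by simp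
      then show ?thesis using True by (simp add: grid_shift_def)
    next
      case False
      have "\<lfloor>X + 1/3\<rfloor> = \<lfloor>Y\<rfloor>"
        by (rule floor_unique; use X Y bounds in linarith)
      moreover have "\<lfloor>Y + 1/3\<rfloor> = \<lfloor>Y\<rfloor>"
        by (rule floor_unique; use X Y bounds in linarith)
      ultimately have "\<lfloor>X + 1/3\<rfloor> = \<lfloor>Y + 1/3\<rfloor>" by simp
      then show ?thesis using False by (simp add: grid_shift_def)
    qed
  qed
  show ?thesis
  proof (cases "\<lfloor>X\<rfloor> < \<lfloor>Y\<rfloor>")
    case True
    then show ?thesis using main[of X Y] assms by blast
  next
    case no: False
    then have "\<lfloor>Y - grid_shift True k\<rfloor> = \<lfloor>X - grid_shift True k\<rfloor>"
      using False assms by (intro main) (auto simp: abs_minus_commute)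
    then show ?thesis by metis
  qed
qed

lemma common_grid_cube:
  fixes x y :: "real^'n"
  assumes "x \<noteq> y"
  obtains \<beta> :: "'n \<Rightarrow> bool" and k where "grid_index \<beta> k x = grid_index \<beta> k y" "2 powr - real_of_int k \<le> 6 * norm (x - y)"
proof -
  define M where "M = infnorm (x - y)"
  have M: "0 < M" unfolding M_def using assms by (simp add: infnorm_pos_lt)
  \<comment> \<open>With M the distance in the sup norm, the side 2^(-k) is the power of two
    satisfying 3 * M < 2^(-k) \<le> 6 * M; after rescaling by 2^k every pair of coordinates is less
    than 1/3 apart.\<close>
  define k where "k = - (\<lfloor>log 2 (3 * M)\<rfloor> + 1)"
  have k: "2 powr - real_of_int k \<le> 6 * M" "3 * M < 2 powr - real_of_int k"
    using floor_log2_bounds[of "3 * M"] M unfolding k_def by (auto simp: powr_add)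
  have ex: "\<exists>b. \<lfloor>2 powr k * x $ i - grid_shift b k\<rfloor> = \<lfloor>2 powr k * y $ i - grid_shift b k\<rfloor>" for i
  proof (rule one_third_trick)
    have "\<bar>(x - y) $ i\<bar> \<le> M" unfolding M_def by (rule component_le_infnorm_cart)
    then have "\<bar>2 powr k * x $ i - 2 powr k * y $ i\<bar> \<le> 2 powr k * M"
      by (simp add: abs_mult flip: right_diff_distrib)
    also have "\<dots> < 2 powr k * (2 powr - real_of_int k / 3)" using k(2) by (intro mult_strict_left_mono) auto
    also have "\<dots> = 1 / 3" by (simp flip: powr_add)
    finally show "\<bar>2 powr k * x $ i - 2 powr k * y $ i\<bar> < 1 / 3" .
  qed
  then obtain \<beta> where "\<forall>i. \<lfloor>2 powr k * x $ i - grid_shift (\<beta> i) k\<rfloor> = \<lfloor>2 powr k * y $ i - grid_shift (\<beta> i) k\<rfloor>"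
    by metis
  then have "grid_index \<beta> k x = grid_index \<beta> k y" unfolding grid_index_def by auto
  moreover have "2 powr - real_of_int k \<le> 6 * norm (x - y)" using k(1) infnorm_le_norm[of "x - y"] unfolding M_def by linarith
  ultimately show thesis by (rule that)
qed

lemma A_pq_weights: "(v, w) \<in> A_pq \<alpha> p q \<Longrightarrow> weight v \<and> weight w"
  unfolding A_pq_def by auto

lemma grid_level_eq_disjoint:
  fixes Q R :: "(real^'n) set"
  assumes "Q \<in> grid \<beta>" "R \<in> grid \<beta>" "cube_level Q = cube_level R" "Q \<noteq> R"
  shows "Q \<inter> R = {}"
proof -
  obtain k m k' m' where QR: "Q = grid_cube \<beta> k m" "R = grid_cube \<beta> k' m'"
    using assms(1,2) unfolding grid_def by blast
  then have "k = k'" using assms(3) by simp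
  then show ?thesis using assms(4) grid_cube_disjoint[of m m' \<beta> k] unfolding QR by auto
qed

text \<open>Supplies the hypotheses of the abstract dyadic bound from the weight conditions. These
  are stated for closed cubes; a grid cube has a closed hull of the same Lebesgue measure, so
  enlarging to the hull costs nothing. The constant is fixed before the grid, the family and
  h.\<close>

lemma grid_fractional_integral_bound:
  fixes v w :: "real^'n \<Rightarrow> real"
  assumes pq: "1 < p" "p \<le> q" and \<alpha>: "0 < \<alpha>"
    and vw: "(v, w) \<in> A_pq \<alpha> p q"
    and \<sigma>A: "(\<lambda>x. v x powr (- conj_exp p / p)) \<in> A_infty" and wA: "w \<in> A_infty"
  obtains C where "0 \<le> C"
    "\<And>\<beta> F h I J. finite F \<Longrightarrow> F \<subseteq> grid \<beta> \<Longrightarrow> h \<in> borel_measurable lebesgue \<Longrightarrow> (\<And>x. 0 \<le> h x) \<Longrightarrow>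
      (\<And>Q. Q \<in> F \<Longrightarrow> 0 \<le> I Q) \<Longrightarrow> (\<And>Q. Q \<in> F \<Longrightarrow> (\<integral>\<^sup>+x\<in>Q. ennreal (h x) \<partial>lebesgue) = ennreal (I Q)) \<Longrightarrow> 0 \<le> J \<Longrightarrow>
      (\<integral>\<^sup>+x. ennreal (h x powr p * v x) \<partial>lebesgue) \<le> ennreal J \<Longrightarrow>
      (\<integral>\<^sup>+x. ennreal ((\<Sum>Q\<in>F. 2 powr (- \<alpha> * cube_level Q) / 2 powr (- real CARD('n) * cube_level Q)
          * I Q * indicator Q x) powr q) \<partial>density lebesgue (\<lambda>x. ennreal (w x)))
        \<le> ennreal (C * J powr (q / p))"
proof -
  let ?d = "real CARD('n)"
  define \<sigma> where "\<sigma> x = v x powr (- conj_exp p / p)" for x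
  have weights: "weight v" "weight w" "weight \<sigma>"
    using A_pq_weights[OF vw] \<sigma>A unfolding A_infty_def A_p_def \<sigma>_def by auto
  note meas[measurable] = weights[THEN weight_measurable]
  obtain c1 where c1: "0 \<le> c1" "\<And>Q E. Q \<in> cubes \<Longrightarrow> E \<in> sets lebesgue \<Longrightarrow> E \<subseteq> Q \<Longrightarrow>
    emeasure lebesgue Q \<le> 2 * emeasure lebesgue E \<Longrightarrow>
    (\<integral>\<^sup>+x\<in>Q. ennreal (w x) \<partial>lebesgue) \<le> ennreal c1 * (\<integral>\<^sup>+x\<in>E. ennreal (w x) \<partial>lebesgue)"
    by (rule A_infty_half[OF wA], rule that)
  obtain c2 where c2: "0 \<le> c2" "\<And>Q E. Q \<in> cubes \<Longrightarrow> E \<in> sets lebesgue \<Longrightarrow> E \<subseteq> Q \<Longrightarrow>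
    emeasure lebesgue Q \<le> 2 * emeasure lebesgue E \<Longrightarrow>
    (\<integral>\<^sup>+x\<in>Q. ennreal (\<sigma> x) \<partial>lebesgue) \<le> ennreal c2 * (\<integral>\<^sup>+x\<in>E. ennreal (\<sigma> x) \<partial>lebesgue)"
    by (rule A_infty_half[OF \<sigma>A], rule that) (simp_all add: \<sigma>_def)
  define c where "c = max c1 c2"
  define Ks where "Ks = (SUP Q\<in>cubes.
        ennreal (measure lebesgue Q powr (\<alpha> / ?d - 1))
        * ennreal_powr (\<integral>\<^sup>+x\<in>Q. ennreal (\<sigma> x) \<partial>lebesgue) (1 / conj_exp p)
        * ennreal_powr (\<integral>\<^sup>+x\<in>Q. ennreal (w x) \<partial>lebesgue) (1 / q))"
  have Ks: "Ks < \<infinity>" using vw unfolding A_pq_def Ks_def \<sigma>_def by auto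
  define K where "K = enn2real Ks"
  have K_nn: "0 \<le> K" by (simp add: K_def)
  define C where "C = dyadic_const \<alpha> p q K c"
  show thesis
  proof (rule that)
    show "0 \<le> C" by (simp add: C_def dyadic_const_def)
    fix \<beta> :: "'n \<Rightarrow> bool" and F h I J
    assume F: "finite F" "F \<subseteq> grid \<beta>" and h[measurable]: "h \<in> borel_measurable lebesgue" and h0: "\<And>x. 0 \<le> h x"
      and I: "\<And>Q. Q \<in> F \<Longrightarrow> 0 \<le> I Q" "\<And>Q. Q \<in> F \<Longrightarrow> (\<integral>\<^sup>+x\<in>Q. ennreal (h x) \<partial>lebesgue) = ennreal (I Q)"
      and J: "0 \<le> J" "(\<integral>\<^sup>+x. ennreal (h x powr p * v x) \<partial>lebesgue) \<le> ennreal J"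
    have Fg: "Q \<in> grid \<beta>" if "Q \<in> F" for Q using that F by blast
    have Qm: "Q \<in> sets lebesgue" if "Q \<in> F" for Q
      using Fg[OF that] by (auto simp: grid_def grid_cube_borel)
    have mQ: "emeasure lebesgue Q = ennreal (2 powr (- ?d * cube_level Q))" if "Q \<in> F" for Q
      using Fg[OF that] by (auto simp: grid_def emeasure_grid_cube)
    have hull: "\<exists>Q'\<in>cubes. Q \<subseteq> Q' \<and> emeasure lebesgue Q' = emeasure lebesgue Q" if QF: "Q \<in> F" for Q
    proof -
      obtain k m where Q: "Q = grid_cube \<beta> k m" using Fg[OF QF] unfolding grid_def by blast
      obtain a where "box a (a + vec (2 powr - real_of_int k)) \<subseteq> Q"
        and a: "Q \<subseteq> cbox a (a + vec (2 powr - real_of_int k))"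
        unfolding Q by (rule grid_cube_between)
      have "((2::real) powr - real_of_int k) ^ CARD('n) = 2 powr (- real CARD('n) * k)"
        by (subst powr_realpow[symmetric]) (simp_all add: powr_powr mult.commute)
      then have "emeasure lebesgue (cbox a (a + vec (2 powr - real_of_int k))) = emeasure lebesgue Q"
        unfolding Q emeasure_grid_cube by (subst emeasure_cube(1)) auto
      moreover have "cbox a (a + vec (2 powr - real_of_int k)) \<in> cubes"
        unfolding cubes_def by force
      ultimately show ?thesis using a by blast
    qed
    have dens: "emeasure (density lebesgue (\<lambda>x. ennreal (\<rho> x))) A = (\<integral>\<^sup>+x\<in>A. ennreal (\<rho> x) \<partial>lebesgue)"
      if "weight \<rho>" "A \<in> sets lebesgue" for \<rho> :: "real^'n \<Rightarrow> real" and A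
      using weight_measurable[OF that(1)] that(2) by (simp add: emeasure_density)
    have fin: "0 < (\<integral>\<^sup>+x\<in>Q. ennreal (\<rho> x) \<partial>lebesgue) \<and> (\<integral>\<^sup>+x\<in>Q. ennreal (\<rho> x) \<partial>lebesgue) < \<infinity>"
      if Q: "Q \<in> F" and \<rho>: "weight \<rho>" for Q and \<rho> :: "real^'n \<Rightarrow> real"
    proof
      show "0 < (\<integral>\<^sup>+x\<in>Q. ennreal (\<rho> x) \<partial>lebesgue)"
        using Qm[OF Q] mQ[OF Q] by (intro weight_nn_integral_pos[OF \<rho>]) auto
      obtain Q' where Q': "Q' \<in> cubes" "Q \<subseteq> Q'" using hull[OF Q] by blast
      have "(\<integral>\<^sup>+x\<in>Q. ennreal (\<rho> x) \<partial>lebesgue) \<le> (\<integral>\<^sup>+x\<in>Q'. ennreal (\<rho> x) \<partial>lebesgue)"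
        using Q'(2) by (intro nn_integral_mono) (auto simp: indicator_def)
      also have "\<dots> < \<infinity>" by (rule weight_nn_integral_finite[OF \<rho> cubes_compact[OF Q'(1)]])
      finally show "(\<integral>\<^sup>+x\<in>Q. ennreal (\<rho> x) \<partial>lebesgue) < \<infinity>" .
    qed
    define n where "n Q = enn2real (\<integral>\<^sup>+x\<in>Q. ennreal (w x) \<partial>lebesgue)" for Q
    define s where "s Q = enn2real (\<integral>\<^sup>+x\<in>Q. ennreal (\<sigma> x) \<partial>lebesgue)" for Q
    have n: "0 < n Q" "(\<integral>\<^sup>+x\<in>Q. ennreal (w x) \<partial>lebesgue) = ennreal (n Q)" if "Q \<in> F" for Q
      using fin[OF that weights(2)] unfolding n_def by (auto simp: enn2real_positive_iff)
    have s: "0 < s Q" "(\<integral>\<^sup>+x\<in>Q. ennreal (\<sigma> x) \<partial>lebesgue) = ennreal (s Q)" if "Q \<in> F" for Q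
      using fin[OF that weights(3)] unfolding s_def by (auto simp: enn2real_positive_iff)
    have half: "emeasure (density lebesgue (\<lambda>x. ennreal (\<rho> x))) Q
        \<le> ennreal c * emeasure (density lebesgue (\<lambda>x. ennreal (\<rho> x))) E"
      if Q: "Q \<in> F" and E: "E \<in> sets lebesgue" "E \<subseteq> Q" "emeasure lebesgue Q \<le> 2 * emeasure lebesgue E"
        and \<rho>: "weight \<rho>" and c': "c' \<le> c" and *: "\<And>Q E. Q \<in> cubes \<Longrightarrow> E \<in> sets lebesgue \<Longrightarrow> E \<subseteq> Q \<Longrightarrow>
    emeasure lebesgue Q \<le> 2 * emeasure lebesgue E \<Longrightarrow>
    (\<integral>\<^sup>+x\<in>Q. ennreal (\<rho> x) \<partial>lebesgue) \<le> ennreal c' * (\<integral>\<^sup>+x\<in>E. ennreal (\<rho> x) \<partial>lebesgue)"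
      for Q E c' and \<rho> :: "real^'n \<Rightarrow> real"
    proof -
      obtain Q' where Q': "Q' \<in> cubes" "Q \<subseteq> Q'" "emeasure lebesgue Q' = emeasure lebesgue Q"
        using hull[OF Q] by blast
      have "(\<integral>\<^sup>+x\<in>Q. ennreal (\<rho> x) \<partial>lebesgue) \<le> (\<integral>\<^sup>+x\<in>Q'. ennreal (\<rho> x) \<partial>lebesgue)"
        using Q'(2) by (intro nn_integral_mono) (auto simp: indicator_def)
      also have "\<dots> \<le> ennreal c' * (\<integral>\<^sup>+x\<in>E. ennreal (\<rho> x) \<partial>lebesgue)"
        using Q' E by (intro *) auto
      also have "\<dots> \<le> ennreal c * (\<integral>\<^sup>+x\<in>E. ennreal (\<rho> x) \<partial>lebesgue)"
        using c' by (intro mult_right_mono ennreal_leI) auto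
      finally show ?thesis by (simp only: dens[OF \<rho> Qm[OF Q]] dens[OF \<rho> E(1)])
    qed
    have AK: "2 powr (- \<alpha> * cube_level Q) / 2 powr (- ?d * cube_level Q) * s Q powr (1 / conj_exp p) * n Q powr (1 / q) \<le> K"
      if Q: "Q \<in> F" for Q
    proof -
      obtain Q' where Q': "Q' \<in> cubes" "Q \<subseteq> Q'" "emeasure lebesgue Q' = emeasure lebesgue Q"
        using hull[OF Q] by blast
      define S' N' where "S' = (\<integral>\<^sup>+x\<in>Q'. ennreal (\<sigma> x) \<partial>lebesgue)" and "N' = (\<integral>\<^sup>+x\<in>Q'. ennreal (w x) \<partial>lebesgue)"
      have "ennreal (s Q) \<le> S'" unfolding S'_def s(2)[OF Q, symmetric]
        using Q'(2) by (intro nn_integral_mono) (auto simp: indicator_def)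
      moreover have "S' < \<infinity>" unfolding S'_def
        by (rule weight_nn_integral_finite[OF weights(3) cubes_compact[OF Q'(1)]])
      ultimately obtain S where S: "S' = ennreal S" "s Q \<le> S"
        using s(1)[OF Q] by (cases S') auto
      have "ennreal (n Q) \<le> N'" unfolding N'_def n(2)[OF Q, symmetric]
        using Q'(2) by (intro nn_integral_mono) (auto simp: indicator_def)
      moreover have "N' < \<infinity>" unfolding N'_def
        by (rule weight_nn_integral_finite[OF weights(2) cubes_compact[OF Q'(1)]])
      ultimately obtain N where N: "N' = ennreal N" "n Q \<le> N"
        using n(1)[OF Q] by (cases N') auto
      have mQ': "measure lebesgue Q' = 2 powr (- ?d * cube_level Q)"
        using Q'(3) mQ[OF Q] unfolding measure_def by simp
      have "ennreal (measure lebesgue Q' powr (\<alpha> / ?d - 1)) * ennreal_powr S' (1 / conj_exp p) * ennreal_powr N' (1 / q) \<le> Ks"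
        unfolding Ks_def S'_def N'_def by (rule SUP_upper[OF Q'(1)])
      then have "ennreal (measure lebesgue Q' powr (\<alpha> / ?d - 1) * S powr (1 / conj_exp p) * N powr (1 / q)) \<le> Ks"
        unfolding S(1) N(1) using s(1)[OF Q] n(1)[OF Q] S(2) N(2) by (simp add: ennreal_powr_def ennreal_mult')
      then have "measure lebesgue Q' powr (\<alpha> / ?d - 1) * S powr (1 / conj_exp p) * N powr (1 / q) \<le> K"
        unfolding K_def using Ks
        by (metis ennreal_enn2real ennreal_le_iff enn2real_nonneg infinity_ennreal_def)
      \<comment> \<open>At level k the hull has measure 2^(-d k), and its power \<alpha>/d - 1 is
        the coefficient of the dyadic operator.\<close>
      moreover have "measure lebesgue Q' powr (\<alpha> / ?d - 1) = 2 powr (- \<alpha> * cube_level Q) / 2 powr (- ?d * cube_level Q)"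
      proof -
        have "- ?d * cube_level Q * (\<alpha> / ?d - 1) = - \<alpha> * cube_level Q - - ?d * cube_level Q"
          by (simp add: algebra_simps)
        then show ?thesis unfolding mQ' powr_powr powr_diff[symmetric] by (simp only:)
      qed
      moreover have "2 powr (- \<alpha> * cube_level Q) / 2 powr (- ?d * cube_level Q) * s Q powr (1 / conj_exp p) * n Q powr (1 / q)
          \<le> 2 powr (- \<alpha> * cube_level Q) / 2 powr (- ?d * cube_level Q) * S powr (1 / conj_exp p) * N powr (1 / q)"
        using s(1)[OF Q] n(1)[OF Q] S(2) N(2) conj_exp_facts(1)[OF pq(1)] pq
        by (intro mult_mono powr_mono2) auto
      ultimately show ?thesis by simp
    qed
    have J': "(\<integral>\<^sup>+x. ennreal ((h x / \<sigma> x) powr p) \<partial>density lebesgue (\<lambda>x. ennreal (\<sigma> x))) \<le> ennreal J"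
    proof -
      have "AE x in lebesgue. 0 < v x" using weights(1) by (simp add: weight_def)
      then have "AE x in lebesgue. ennreal (\<sigma> x) * ennreal ((h x / \<sigma> x) powr p) = ennreal (h x powr p * v x)"
      proof eventually_elim
        case (elim x)
        let ?e = "conj_exp p / p"
        \<comment> \<open>As p'/p = 1/(p - 1), one has \<sigma>^(1-p) = v, which identifies the norm
          of h / \<sigma> in L^p(\<sigma>) with that of h in L^p(v).\<close>
        have "\<sigma> x powr p = v x powr (- ?e * p)" using elim by (simp add: \<sigma>_def powr_powr)
        also have "- ?e * p = - ?e - 1" using pq(1) unfolding conj_exp_def by (simp add: field_simps)
        also have "v x powr (- ?e - 1) = \<sigma> x / v x"
          using elim by (simp add: \<sigma>_def powr_diff)
        finally have "\<sigma> x * (h x / \<sigma> x) powr p = h x powr p * v x"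
          using h0[of x] elim by (simp add: powr_divide \<sigma>_def)
        then show ?case by (simp add: \<sigma>_def flip: ennreal_mult)
      qed
      then have "(\<integral>\<^sup>+x. ennreal (\<sigma> x) * ennreal ((h x / \<sigma> x) powr p) \<partial>lebesgue)
          = (\<integral>\<^sup>+x. ennreal (h x powr p * v x) \<partial>lebesgue)"
        by (rule nn_integral_cong_AE)
      then show ?thesis using J(2) by (subst nn_integral_density) auto
    qed
    show "(\<integral>\<^sup>+x. ennreal ((\<Sum>Q\<in>F. 2 powr (- \<alpha> * cube_level Q) / 2 powr (- ?d * cube_level Q)
          * I Q * indicator Q x) powr q) \<partial>density lebesgue (\<lambda>x. ennreal (w x)))
        \<le> ennreal (C * J powr (q / p))"
      unfolding C_def
    proof (rule dyadic_fractional_integral_bound[where \<sigma> = \<sigma> and f = h and n = n and s = s])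
      show "AE x in lebesgue. 0 < \<sigma> x" using weights(3) by (simp add: weight_def)
      show "laminar F" by (rule laminar_subset[OF laminar_grid F(2)])
      show "Q \<inter> Q' = {}" if "Q \<in> F" "Q' \<in> F" "cube_level Q = cube_level Q'" "Q \<noteq> Q'" for Q Q'
        using grid_level_eq_disjoint[OF Fg[OF that(1)] Fg[OF that(2)] that(3,4)] .
      show "cube_level R \<le> cube_level Q" if "Q \<in> F" "R \<in> F" "Q \<subseteq> R" for Q R
        using Fg that by (intro grid_level_mono) auto
      show "emeasure (density lebesgue (\<lambda>x. ennreal (w x))) Q = ennreal (n Q)" if "Q \<in> F" for Q
        using n(2)[OF that] by (simp add: dens[OF weights(2) Qm[OF that]])
      show "emeasure (density lebesgue (\<lambda>x. ennreal (\<sigma> x))) Q = ennreal (s Q)" if "Q \<in> F" for Q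
        using s(2)[OF that] by (simp add: dens[OF weights(3) Qm[OF that]])
      show "emeasure (density lebesgue (\<lambda>x. ennreal (w x))) Q
          \<le> ennreal c * emeasure (density lebesgue (\<lambda>x. ennreal (w x))) E"
        if "Q \<in> F" "E \<in> sets lebesgue" "E \<subseteq> Q" "emeasure lebesgue Q \<le> 2 * emeasure lebesgue E" for Q E
        by (rule half[OF that weights(2), of c1]) (use c1(2) in \<open>auto simp: c_def\<close>)
      show "emeasure (density lebesgue (\<lambda>x. ennreal (\<sigma> x))) Q
          \<le> ennreal c * emeasure (density lebesgue (\<lambda>x. ennreal (\<sigma> x))) E"
        if "Q \<in> F" "E \<in> sets lebesgue" "E \<subseteq> Q" "emeasure lebesgue Q \<le> 2 * emeasure lebesgue E" for Q E
        by (rule half[OF that weights(3), of c2]) (use c2(2) in \<open>auto simp: c_def\<close>)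
      show "F \<subseteq> sets lebesgue" using Qm by blast
      show "0 \<le> c" using c1(1) by (simp add: c_def)
    qed (fact F meas h sigma_finite_lebesgue h0 mQ n(1) s(1) I pq \<alpha> K_nn AK J(1) J' | simp)+
  qed
qed

section \<open>Truncated dyadic kernels and the passage to the limit\<close>

lemma ennreal_powr_le_SUP:
  fixes a :: "nat \<Rightarrow> real"
  assumes "ennreal u \<le> (SUP N. ennreal (a N))" "0 \<le> u" "0 < q"
  shows "ennreal (u powr q) \<le> (SUP N. ennreal (a N powr q))"
proof (rule dense_le)
  fix z assume z: "z < ennreal (u powr q)"
  then obtain z' where z': "z = ennreal z'" "0 \<le> z'" by (cases z) auto
  then have "z' < u powr q" using z by (simp add: ennreal_less_iff)
  \<comment> \<open>A value below u^q has its q-th root below u, hence below some a N; raising to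
    the power q again gives the claim.\<close>
  then have "z' powr (1 / q) < (u powr q) powr (1 / q)"
    using z'(2) assms(3) by (intro powr_less_mono2) auto
  then have "z' powr (1 / q) < u" using assms by (simp add: powr_powr)
  then have "ennreal (z' powr (1 / q)) < (SUP N. ennreal (a N))"
    using assms(1) by (intro less_le_trans[OF _ assms(1)]) (simp add: ennreal_less_iff)
  then obtain N where "ennreal (z' powr (1 / q)) < ennreal (a N)" by (auto simp: less_SUP_iff)
  then have "z' powr (1 / q) < a N" by (simp add: ennreal_less_iff)
  then have "(z' powr (1 / q)) powr q < a N powr q" using assms(3) by (intro powr_less_mono2) auto
  then have "z' < a N powr q" using z' assms(3) by (simp add: powr_powr)
  then have "z \<le> ennreal (a N powr q)" unfolding z' by (intro ennreal_leI) simp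
  also have "\<dots> \<le> (SUP N. ennreal (a N powr q))" by (rule SUP_upper) simp
  finally show "z \<le> (SUP N. ennreal (a N powr q))" .
qed

text \<open>Every summand is replaced by the largest one. The cost depends only on the number of
  summands, which in the application is the number of grids.\<close>

lemma powr_sum_le:
  fixes a :: "'a \<Rightarrow> real"
  assumes "finite S" "\<And>i. i \<in> S \<Longrightarrow> 0 \<le> a i" "0 < q"
  shows "(\<Sum>i\<in>S. a i) powr q \<le> real (card S) powr q * (\<Sum>i\<in>S. a i powr q)"
proof (cases "S = {}")
  case False
  define b where "b = Max (a ` S)"
  have "b \<in> a ` S" unfolding b_def using assms(1) False by (intro Max_in) auto
  then obtain j where j: "j \<in> S" "b = a j" by blast
  have "(\<Sum>i\<in>S. a i) \<le> (\<Sum>i\<in>S. b)" unfolding b_def using assms(1) by (intro sum_mono Max_ge) auto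
  then have "(\<Sum>i\<in>S. a i) powr q \<le> (real (card S) * b) powr q"
    using assms by (intro powr_mono2 sum_nonneg) auto
  also have "\<dots> = real (card S) powr q * a j powr q" using j assms(2)[OF j(1)] by (simp add: powr_mult)
  also have "\<dots> \<le> real (card S) powr q * (\<Sum>i\<in>S. a i powr q)"
    using assms(1) j(1) by (intro mult_left_mono member_le_sum) auto
  finally show ?thesis .
qed simp

text \<open>A finite truncation: the dyadic bound holds for finite families with a constant
  independent of N, and the truncations increase to the whole grid.\<close>

definition grid_cubes_upto :: "nat \<Rightarrow> ('n \<Rightarrow> bool) \<Rightarrow> (real^'n) set set" where
  "grid_cubes_upto N \<beta> = (\<lambda>(k, m). grid_cube \<beta> k m) ` ({- int N..int N} \<times> {m. \<forall>i. m i \<in> {- int N..int N}})"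

lemma finite_grid_cubes_upto: "finite (grid_cubes_upto N (\<beta> :: 'n::finite \<Rightarrow> bool))"
proof -
  have "{m :: 'n \<Rightarrow> int. \<forall>i. m i \<in> {- int N..int N}} = PiE UNIV (\<lambda>_. {- int N..int N})"
    by (auto simp: PiE_def Pi_def)
  then have "finite {m :: 'n \<Rightarrow> int. \<forall>i. m i \<in> {- int N..int N}}" by (simp add: finite_PiE)
  then show ?thesis unfolding grid_cubes_upto_def by (intro finite_imageI finite_cartesian_product) auto
qed

lemma grid_cubes_upto_grid: "grid_cubes_upto N \<beta> \<subseteq> grid \<beta>"
  unfolding grid_cubes_upto_def grid_def by auto

lemma grid_cubes_upto_mono: "N \<le> N' \<Longrightarrow> grid_cubes_upto N \<beta> \<subseteq> grid_cubes_upto N' \<beta>"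
proof -
  assume le: "N \<le> N'"
  have "m i \<in> {- int N'..int N'}" if "\<forall>i. m i \<in> {- int N..int N}" for m :: "'a \<Rightarrow> int" and i
    using spec[OF that, of i] le by auto
  then show ?thesis unfolding grid_cubes_upto_def using le by (intro image_mono Sigma_mono) auto
qed

text \<open>For a grid cube this is its side length to the power \<alpha> - d, the size of the Riesz
  kernel at the distance of one side.\<close>

definition cube_coeff :: "real \<Rightarrow> (real^'n) set \<Rightarrow> real" where
  "cube_coeff \<alpha> Q = 2 powr (- \<alpha> * cube_level Q) / 2 powr (- real CARD('n) * cube_level Q)"

lemma cube_coeff_nonneg: "0 \<le> cube_coeff \<alpha> Q"
  by (simp add: cube_coeff_def)

definition dyadic_kernel :: "real \<Rightarrow> nat \<Rightarrow> real^'n \<Rightarrow> real^'n \<Rightarrow> real" where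
  "dyadic_kernel \<alpha> N x y =
     (\<Sum>\<beta>\<in>UNIV. \<Sum>Q\<in>grid_cubes_upto N \<beta>. cube_coeff \<alpha> Q * indicator Q x * indicator Q y)"

lemma dyadic_kernel_mono: "N \<le> N' \<Longrightarrow> dyadic_kernel \<alpha> N x y \<le> dyadic_kernel \<alpha> N' x y"
  unfolding dyadic_kernel_def
  by (intro sum_mono sum_mono2 finite_grid_cubes_upto grid_cubes_upto_mono) (auto simp: cube_coeff_def)

lemma dyadic_kernel_nonneg: "0 \<le> dyadic_kernel \<alpha> N x y"
  unfolding dyadic_kernel_def by (intro sum_nonneg) (auto simp: cube_coeff_def)

lemma int_nat_ge: "k \<le> int (nat k)"
  by simp

text \<open>One term suffices: some grid has a cube containing both points with side at most 6 * |x
  - y|. Since \<alpha> - d is negative, the kernel is at most 6^(d - \<alpha>) times the coefficient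
  of that cube.\<close>

lemma riesz_kernel_le_dyadic_kernel:
  fixes x y :: "real^'n"
  assumes "\<alpha> < real CARD('n)"
  shows "\<exists>N. norm (x - y) powr (\<alpha> - real CARD('n)) \<le> 6 powr (real CARD('n) - \<alpha>) * dyadic_kernel \<alpha> N x y"
proof (cases "x = y")
  \<comment> \<open>On the diagonal the left-hand side is 0, because \<open>0 powr\<close> is 0 even
    for negative exponents.\<close>
  case True
  then show ?thesis by (simp add: dyadic_kernel_nonneg)
next
  case False
  let ?d = "real CARD('n)"
  obtain \<beta> :: "'n \<Rightarrow> bool" and k where k: "grid_index \<beta> k x = grid_index \<beta> k y"
    "2 powr - real_of_int k \<le> 6 * norm (x - y)"
    using common_grid_cube[OF False] .
  define m where "m = grid_index \<beta> k x"
  define N where "N = nat (max \<bar>k\<bar> (Max (range (\<lambda>i. \<bar>m i\<bar>))))"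
  let ?Q = "grid_cube \<beta> k m"
  have "\<bar>m i\<bar> \<le> Max (range (\<lambda>i. \<bar>m i\<bar>))" for i by (intro Max_ge) auto
  then have mi: "\<bar>m i\<bar> \<le> int N" for i unfolding N_def by (intro order_trans[OF _ int_nat_ge]) (auto intro: max.coboundedI2)
  have "\<bar>k\<bar> \<le> int N" unfolding N_def by (intro order_trans[OF _ int_nat_ge]) simp
  then have Q: "?Q \<in> grid_cubes_upto N \<beta>"
    unfolding grid_cubes_upto_def using mi by (intro image_eqI[of _ _ "(k, m)"]) (auto simp: abs_le_iff minus_le_iff)
  have "cube_coeff \<alpha> ?Q = cube_coeff \<alpha> ?Q * indicator ?Q x * indicator ?Q y"
    using k(1) by (simp add: grid_cube_def m_def)
  also have "\<dots> \<le> (\<Sum>Q\<in>grid_cubes_upto N \<beta>. cube_coeff \<alpha> Q * indicator Q x * indicator Q y)"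
    using Q by (intro member_le_sum) (auto simp: cube_coeff_def finite_grid_cubes_upto)
  also have "\<dots> \<le> dyadic_kernel \<alpha> N x y"
    unfolding dyadic_kernel_def
    by (rule member_le_sum[where f = "\<lambda>\<beta>. \<Sum>Q\<in>grid_cubes_upto N \<beta>. cube_coeff \<alpha> Q * indicator Q x * indicator Q y"])
       (auto intro!: sum_nonneg simp: cube_coeff_def)
  finally have le: "cube_coeff \<alpha> ?Q \<le> dyadic_kernel \<alpha> N x y" .
  have "norm (x - y) powr (\<alpha> - ?d) \<le> (2 powr - real_of_int k / 6) powr (\<alpha> - ?d)"
    using k(2) assms by (intro powr_mono2') auto
  also have "\<dots> = 6 powr (?d - \<alpha>) * cube_coeff \<alpha> ?Q"
  proof -
    have "(6::real) powr (\<alpha> - ?d) = 1 / 6 powr (?d - \<alpha>)" by (simp add: powr_minus_divide[symmetric])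
    moreover have "cube_coeff \<alpha> ?Q = 2 powr (- real_of_int k * (\<alpha> - ?d))"
      by (simp add: cube_coeff_def powr_diff[symmetric] algebra_simps)
    ultimately show ?thesis by (simp add: powr_divide powr_powr)
  qed
  also have "\<dots> \<le> 6 powr (?d - \<alpha>) * dyadic_kernel \<alpha> N x y" by (intro mult_left_mono le) simp
  finally show ?thesis by blast
qed

text \<open>Phrased for a real function u lying below the Riesz potential of h, so that the
  potential itself never has to be real-valued. Boundedness of h only ensures finite integrals over
  cubes; the bound B does not enter C.\<close>

theorem riesz_potential_two_weight:
  fixes v w :: "real^'n \<Rightarrow> real"
  assumes pq: "1 < p" "p \<le> q" and \<alpha>: "0 < \<alpha>" "\<alpha> < real CARD('n)"
    and vw: "(v, w) \<in> A_pq \<alpha> p q"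
    and \<sigma>A: "(\<lambda>x. v x powr (- conj_exp p / p)) \<in> A_infty" and wA: "w \<in> A_infty"
  obtains C where "0 \<le> C"
    "\<And>h u B J. h \<in> borel_measurable borel \<Longrightarrow> (\<And>x. 0 \<le> h x) \<Longrightarrow> (\<And>x. h x \<le> B) \<Longrightarrow> 0 \<le> J \<Longrightarrow>
      (\<integral>\<^sup>+x. ennreal (h x powr p * v x) \<partial>lebesgue) \<le> ennreal J \<Longrightarrow> (\<And>x. 0 \<le> u x) \<Longrightarrow>
      (\<And>x. ennreal (u x) \<le> (\<integral>\<^sup>+y. ennreal (norm (x - y) powr (\<alpha> - real CARD('n)) * h y) \<partial>lborel)) \<Longrightarrow>
      (\<integral>\<^sup>+x. ennreal (u x powr q * w x) \<partial>lebesgue) \<le> ennreal (C * J powr (q / p))"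
proof -
  let ?d = "real CARD('n)"
  obtain C1 where C1: "0 \<le> C1"
    "\<And>\<beta> F h I J. finite F \<Longrightarrow> F \<subseteq> grid \<beta> \<Longrightarrow> h \<in> borel_measurable lebesgue \<Longrightarrow> (\<And>x. 0 \<le> h x) \<Longrightarrow>
      (\<And>Q. Q \<in> F \<Longrightarrow> 0 \<le> I Q) \<Longrightarrow> (\<And>Q. Q \<in> F \<Longrightarrow> (\<integral>\<^sup>+x\<in>Q. ennreal (h x) \<partial>lebesgue) = ennreal (I Q)) \<Longrightarrow> 0 \<le> J \<Longrightarrow>
      (\<integral>\<^sup>+x. ennreal (h x powr p * v x) \<partial>lebesgue) \<le> ennreal J \<Longrightarrow>
      (\<integral>\<^sup>+x. ennreal ((\<Sum>Q\<in>F. 2 powr (- \<alpha> * cube_level Q) / 2 powr (- ?d * cube_level Q)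
          * I Q * indicator Q x) powr q) \<partial>density lebesgue (\<lambda>x. ennreal (w x)))
        \<le> ennreal (C1 * J powr (q / p))"
  proof (rule grid_fractional_integral_bound[OF pq \<alpha>(1) vw \<sigma>A wA], goal_cases)
    case (1 C)
    show ?thesis by (rule that[OF 1(2)], rule 1(3))
  qed
  have "weight w" using A_pq_weights[OF vw] by simp
  note [measurable] = weight_measurable[OF this]
  define A where "A = 6 powr (?d - \<alpha>)"
  define b where "b = real (card (UNIV :: ('n \<Rightarrow> bool) set))"
  define C where "C = A powr q * b powr q * b * C1"
  let ?N = "density lebesgue (\<lambda>x. ennreal (w x))"
  show thesis
  proof (rule that)
    show "0 \<le> C" using C1(1) by (simp add: C_def b_def)
    fix h u :: "real^'n \<Rightarrow> real" and B J :: real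
    assume h[measurable]: "h \<in> borel_measurable borel" and h0: "\<And>x. 0 \<le> h x" and hB: "\<And>x. h x \<le> B"
      and J: "0 \<le> J" "(\<integral>\<^sup>+x. ennreal (h x powr p * v x) \<partial>lebesgue) \<le> ennreal J"
      and u: "\<And>x. 0 \<le> u x"
        "\<And>x. ennreal (u x) \<le> (\<integral>\<^sup>+y. ennreal (norm (x - y) powr (\<alpha> - ?d) * h y) \<partial>lborel)"
    define I where "I Q = enn2real (\<integral>\<^sup>+x\<in>Q. ennreal (h x) \<partial>lborel)" for Q
    have I0: "0 \<le> I Q" for Q by (simp add: I_def)
    have Qb: "Q \<in> sets borel" if "Q \<in> grid \<beta>" for Q and \<beta> :: "'n \<Rightarrow> bool"
      using that by (auto simp: grid_def grid_cube_borel)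
    have Qu: "Q \<in> sets borel" if "Q \<in> grid_cubes_upto N \<beta>" for Q N and \<beta> :: "'n \<Rightarrow> bool"
      using that grid_cubes_upto_grid by (intro Qb[of Q \<beta>]) blast
    have I: "(\<integral>\<^sup>+x\<in>Q. ennreal (h x) \<partial>lborel) = ennreal (I Q)" if "Q \<in> grid \<beta>" for Q and \<beta> :: "'n \<Rightarrow> bool"
    proof -
      have "(\<integral>\<^sup>+x\<in>Q. ennreal (h x) \<partial>lborel) \<le> (\<integral>\<^sup>+x. ennreal B * indicator Q x \<partial>lborel)"
        by (intro nn_integral_mono mult_right_mono ennreal_leI hB) simp
      also have "\<dots> = ennreal B * emeasure lebesgue Q"
        using Qb[OF that] by (simp add: nn_integral_cmult_indicator)
      also have "\<dots> < \<infinity>" using that by (auto simp: grid_def emeasure_grid_cube ennreal_mult_less_top simp del: emeasure_completion)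
      finally show ?thesis unfolding I_def by simp
    qed
    define T where "T N \<beta> x = (\<Sum>Q\<in>grid_cubes_upto N \<beta>. cube_coeff \<alpha> Q * I Q * indicator Q x)" for N \<beta> and x :: "real^'n"
    define S where "S N x = (\<Sum>\<beta>\<in>UNIV. T N \<beta> x)" for N x
    have T0: "0 \<le> T N \<beta> x" for N \<beta> x
      unfolding T_def by (intro sum_nonneg mult_nonneg_nonneg) (auto simp: cube_coeff_def I0)
    have S0: "0 \<le> S N x" for N x unfolding S_def by (intro sum_nonneg T0)
    have Tm[measurable]: "T N \<beta> \<in> borel_measurable lebesgue" for N \<beta>
    proof -
      have "Q \<in> sets lebesgue" if "Q \<in> grid_cubes_upto N \<beta>" for Q
        using that grid_cubes_upto_grid[of N \<beta>] Qb by auto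
      then show ?thesis unfolding T_def by (intro borel_measurable_sum borel_measurable_times) auto
    qed
    have Sm[measurable]: "S N \<in> borel_measurable lebesgue" for N unfolding S_def by measurable
    have Smono: "S N x \<le> S N' x" if "N \<le> N'" for N N' x
      unfolding S_def T_def using that
      by (intro sum_mono sum_mono2 finite_grid_cubes_upto grid_cubes_upto_mono) (auto simp: cube_coeff_def I0)
    have A0: "0 < A" by (simp add: A_def)
    have km: "(\<lambda>y. dyadic_kernel \<alpha> N x y) \<in> borel_measurable borel" for N and x :: "real^'n"
      unfolding dyadic_kernel_def
      by (intro borel_measurable_sum borel_measurable_times borel_measurable_indicator Qu) auto
    have kernel: "(\<integral>\<^sup>+y. ennreal (dyadic_kernel \<alpha> N x y * h y) \<partial>lborel) = ennreal (S N x)" for N x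
    proof -
      have "(\<integral>\<^sup>+y. ennreal (dyadic_kernel \<alpha> N x y * h y) \<partial>lborel)
        = (\<integral>\<^sup>+y. (\<Sum>\<beta>\<in>UNIV. \<Sum>Q\<in>grid_cubes_upto N \<beta>. ennreal (cube_coeff \<alpha> Q * indicator Q x) * (ennreal (h y) * indicator Q y)) \<partial>lborel)"
      proof (intro nn_integral_cong)
        fix y
        have "ennreal (dyadic_kernel \<alpha> N x y * h y)
          = ennreal (\<Sum>\<beta>\<in>UNIV. \<Sum>Q\<in>grid_cubes_upto N \<beta>. cube_coeff \<alpha> Q * indicator Q x * (h y * indicator Q y))"
          unfolding dyadic_kernel_def sum_distrib_right by (intro arg_cong[of _ _ ennreal] sum.cong) (auto simp: mult_ac)
        also have "\<dots> = (\<Sum>\<beta>\<in>UNIV. \<Sum>Q\<in>grid_cubes_upto N \<beta>. ennreal (cube_coeff \<alpha> Q * indicator Q x * (h y * indicator Q y)))"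
          using h0 by (subst sum_ennreal[symmetric]; intro sum_nonneg mult_nonneg_nonneg sum.cong refl sum_ennreal[symmetric])
            (auto simp: cube_coeff_def)
        also have "\<dots> = (\<Sum>\<beta>\<in>UNIV. \<Sum>Q\<in>grid_cubes_upto N \<beta>. ennreal (cube_coeff \<alpha> Q * indicator Q x) * (ennreal (h y) * indicator Q y))"
          by (intro sum.cong refl) (auto simp: indicator_def ennreal_mult' cube_coeff_nonneg)
        finally show "ennreal (dyadic_kernel \<alpha> N x y * h y) = \<dots>" .
      qed
      also have "\<dots> = (\<Sum>\<beta>\<in>UNIV. \<integral>\<^sup>+y. (\<Sum>Q\<in>grid_cubes_upto N \<beta>. ennreal (cube_coeff \<alpha> Q * indicator Q x) * (ennreal (h y) * indicator Q y)) \<partial>lborel)"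
        using Qu by (intro nn_integral_sum) auto
      also have "\<dots> = (\<Sum>\<beta>\<in>UNIV. \<Sum>Q\<in>grid_cubes_upto N \<beta>. \<integral>\<^sup>+y. ennreal (cube_coeff \<alpha> Q * indicator Q x) * (ennreal (h y) * indicator Q y) \<partial>lborel)"
        using Qu by (intro sum.cong refl nn_integral_sum) auto
      also have "\<dots> = (\<Sum>\<beta>\<in>UNIV. \<Sum>Q\<in>grid_cubes_upto N \<beta>. ennreal (cube_coeff \<alpha> Q * I Q * indicator Q x))"
      proof (intro sum.cong refl)
        fix \<beta> Q assume "Q \<in> grid_cubes_upto N (\<beta> :: 'n \<Rightarrow> bool)"
        then have Q: "Q \<in> grid \<beta>" using grid_cubes_upto_grid by blast
        have "(\<integral>\<^sup>+y. ennreal (cube_coeff \<alpha> Q * indicator Q x) * (ennreal (h y) * indicator Q y) \<partial>lborel)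
          = ennreal (cube_coeff \<alpha> Q * indicator Q x) * ennreal (I Q)"
          using Qb[OF Q] by (subst nn_integral_cmult) (auto simp: I[OF Q])
        also have "\<dots> = ennreal (cube_coeff \<alpha> Q * I Q * indicator Q x)"
          using I0 by (subst ennreal_mult[symmetric]) (auto simp: cube_coeff_def mult_ac)
        finally show "(\<integral>\<^sup>+y. ennreal (cube_coeff \<alpha> Q * indicator Q x) * (ennreal (h y) * indicator Q y) \<partial>lborel) = \<dots>" .
      qed
      also have "\<dots> = (\<Sum>\<beta>\<in>UNIV. ennreal (T N \<beta> x))"
        unfolding T_def by (intro sum.cong refl sum_ennreal) (auto simp: cube_coeff_def I0)
      also have "\<dots> = ennreal (S N x)" unfolding S_def by (intro sum_ennreal T0)
      finally show ?thesis .
    qed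
    have u_le: "ennreal (u x) \<le> (SUP N. ennreal (A * S N x))" for x
    proof -
      have "(\<integral>\<^sup>+y. ennreal (norm (x - y) powr (\<alpha> - ?d) * h y) \<partial>lborel)
        \<le> (\<integral>\<^sup>+y. (SUP N. ennreal A * ennreal (dyadic_kernel \<alpha> N x y * h y)) \<partial>lborel)"
      proof (intro nn_integral_mono)
        fix y
        \<comment> \<open>This N depends on x and y, so the supremum stays inside the integral until
          monotone convergence moves it out.\<close>
        obtain N where N: "norm (x - y) powr (\<alpha> - ?d) \<le> A * dyadic_kernel \<alpha> N x y"
          using riesz_kernel_le_dyadic_kernel[OF \<alpha>(2), of x y] unfolding A_def by blast
        have "norm (x - y) powr (\<alpha> - ?d) * h y \<le> A * (dyadic_kernel \<alpha> N x y * h y)"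
          using mult_right_mono[OF N h0[of y]] by (simp add: mult.assoc)
        then have "ennreal (norm (x - y) powr (\<alpha> - ?d) * h y) \<le> ennreal A * ennreal (dyadic_kernel \<alpha> N x y * h y)"
          using A0 by (simp add: ennreal_leI flip: ennreal_mult')
        also have "\<dots> \<le> (SUP N. ennreal A * ennreal (dyadic_kernel \<alpha> N x y * h y))" by (rule SUP_upper) simp
        finally show "ennreal (norm (x - y) powr (\<alpha> - ?d) * h y)
          \<le> (SUP N. ennreal A * ennreal (dyadic_kernel \<alpha> N x y * h y))" .
      qed
      also have "\<dots> = (SUP N. \<integral>\<^sup>+y. ennreal A * ennreal (dyadic_kernel \<alpha> N x y * h y) \<partial>lborel)"
      proof (rule nn_integral_monotone_convergence_SUP)
        show "incseq (\<lambda>N y. ennreal A * ennreal (dyadic_kernel \<alpha> N x y * h y))"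
          using h0 by (intro incseq_SucI le_funI mult_left_mono ennreal_leI mult_right_mono dyadic_kernel_mono) auto
        show "(\<lambda>y. ennreal A * ennreal (dyadic_kernel \<alpha> N x y * h y)) \<in> borel_measurable lborel" for N
          using km[of N x] h by measurable
      qed
      also have "\<dots> = (SUP N. ennreal (A * S N x))"
      proof (intro SUP_cong refl)
        fix N
        have "(\<lambda>y. ennreal (dyadic_kernel \<alpha> N x y * h y)) \<in> borel_measurable lborel"
          using km[of N x] h by measurable
        then show "(\<integral>\<^sup>+y. ennreal A * ennreal (dyadic_kernel \<alpha> N x y * h y) \<partial>lborel) = ennreal (A * S N x)"
          using A0 S0 by (simp add: nn_integral_cmult kernel ennreal_mult)
      qed
      finally show ?thesis using u(2)[of x] by (rule order_trans[rotated])
    qed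
    have q0: "0 < q" using pq by simp
    have "(\<integral>\<^sup>+x. ennreal (u x powr q * w x) \<partial>lebesgue) \<le> (\<integral>\<^sup>+x. ennreal (w x) * (SUP N. ennreal ((A * S N x) powr q)) \<partial>lebesgue)"
      by (intro nn_integral_mono)
        (auto simp: ennreal_mult' mult.commute[of _ "ennreal (w _)"] intro!: mult_left_mono ennreal_powr_le_SUP u_le u(1) q0)
    also have "\<dots> = (\<integral>\<^sup>+x. (SUP N. ennreal ((A * S N x) powr q)) \<partial>?N)"
      by (rule nn_integral_density[symmetric]) measurable
    also have "\<dots> = (SUP N. \<integral>\<^sup>+x. ennreal ((A * S N x) powr q) \<partial>?N)"
    proof (rule nn_integral_monotone_convergence_SUP)
      show "incseq (\<lambda>N x. ennreal ((A * S N x) powr q))"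
        using A0 q0 S0 by (intro incseq_SucI le_funI ennreal_leI powr_mono2 mult_left_mono Smono) auto
      show "(\<lambda>x. ennreal ((A * S N x) powr q)) \<in> borel_measurable ?N" for N by simp
    qed
    also have "\<dots> \<le> ennreal (C * J powr (q / p))"
    proof (rule SUP_least)
      fix N
      have "(\<integral>\<^sup>+x. ennreal ((A * S N x) powr q) \<partial>?N)
        \<le> (\<integral>\<^sup>+x. ennreal (A powr q * b powr q) * (\<Sum>\<beta>\<in>UNIV. ennreal (T N \<beta> x powr q)) \<partial>?N)"
      proof (intro nn_integral_mono)
        fix x
        have "(A * S N x) powr q = A powr q * S N x powr q" using A0 S0[of N x] by (simp add: powr_mult)
        also have "\<dots> \<le> A powr q * (b powr q * (\<Sum>\<beta>\<in>UNIV. T N \<beta> x powr q))"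
          unfolding S_def b_def by (intro mult_left_mono powr_sum_le T0 q0) auto
        finally have "ennreal ((A * S N x) powr q) \<le> ennreal (A powr q * b powr q * (\<Sum>\<beta>\<in>UNIV. T N \<beta> x powr q))"
          by (intro ennreal_leI) (simp add: mult.assoc)
        then show "ennreal ((A * S N x) powr q) \<le> ennreal (A powr q * b powr q) * (\<Sum>\<beta>\<in>UNIV. ennreal (T N \<beta> x powr q))"
          by (simp add: ennreal_mult' sum_ennreal)
      qed
      also have "\<dots> = ennreal (A powr q * b powr q) * (\<Sum>\<beta>\<in>UNIV. \<integral>\<^sup>+x. ennreal (T N \<beta> x powr q) \<partial>?N)"
        by (subst nn_integral_cmult, simp) (subst nn_integral_sum, simp_all)
      also have "\<dots> \<le> ennreal (A powr q * b powr q) * (\<Sum>\<beta>\<in>(UNIV :: ('n \<Rightarrow> bool) set). ennreal (C1 * J powr (q / p)))"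
      proof (intro mult_left_mono sum_mono)
        fix \<beta> :: "'n \<Rightarrow> bool"
        show "(\<integral>\<^sup>+x. ennreal (T N \<beta> x powr q) \<partial>?N) \<le> ennreal (C1 * J powr (q / p))"
          unfolding T_def cube_coeff_def
        proof (rule C1(2)[where h = h and \<beta> = \<beta>])
          show "(\<integral>\<^sup>+x\<in>Q. ennreal (h x) \<partial>lebesgue) = ennreal (I Q)" if "Q \<in> grid_cubes_upto N \<beta>" for Q
            using I[of Q \<beta>] that grid_cubes_upto_grid by (auto simp: nn_integral_completion)
          show "h \<in> borel_measurable lebesgue" using h by (simp add: measurable_completion)
        qed (use finite_grid_cubes_upto grid_cubes_upto_grid h0 I0 J in simp_all)
      qed simp
      also have "\<dots> = ennreal (C * J powr (q / p))"
      proof -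
        have "(\<Sum>\<beta>\<in>(UNIV :: ('n \<Rightarrow> bool) set). ennreal (C1 * J powr (q / p)))
            = ennreal (b * (C1 * J powr (q / p)))"
          using C1(1) by (subst sum_ennreal) (auto simp: b_def)
        then show ?thesis
          using C1(1) by (simp add: C_def b_def mult_ac flip: ennreal_mult')
      qed
      finally show "(\<integral>\<^sup>+x. ennreal ((A * S N x) powr q) \<partial>?N) \<le> ennreal (C * J powr (q / p))" .
    qed
    finally show "(\<integral>\<^sup>+x. ennreal (u x powr q * w x) \<partial>lebesgue) \<le> ennreal (C * J powr (q / p))" .
  qed
qed

section \<open>Gaussians and the inverse Fourier transform\<close>

lemma integral_lborel_prod:
  fixes f :: "'a::euclidean_space \<Rightarrow> real \<Rightarrow> complex"
  assumes int: "\<And>b. b \<in> Basis \<Longrightarrow> integrable lborel (f b)"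
  shows "integrable lborel (\<lambda>x. \<Prod>b\<in>Basis. f b (x \<bullet> b))"
    and "(LINT x|lborel. (\<Prod>b\<in>Basis. f b (x \<bullet> b))) = (\<Prod>b\<in>Basis. LINT x|lborel. f b x)"
proof -
  interpret product_sigma_finite "\<lambda>_::'a. lborel :: real measure"
    by standard
  let ?P = "PiM (Basis :: 'a set) (\<lambda>_. lborel :: real measure)"
  let ?T = "\<lambda>f. \<Sum>b\<in>Basis. f b *\<^sub>R b :: 'a"
  have lb: "(lborel :: 'a measure) = distr ?P borel ?T"
    by (subst lborel_def) (simp add: lborel_eq_real)
  have T[measurable]: "?T \<in> measurable ?P borel" by measurable
  have [measurable]: "f b \<in> borel_measurable borel" if "b \<in> Basis" for b
    using borel_measurable_integrable[OF int[OF that]] by simp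
  have m: "(\<lambda>x. \<Prod>b\<in>Basis. f b (x \<bullet> b)) \<in> borel_measurable borel" by measurable
  have eq: "(\<Prod>b\<in>Basis. f b (?T g \<bullet> b)) = (\<Prod>b\<in>Basis. f b (g b))" for g
    by (intro prod.cong refl) simp
  have i: "integrable ?P (\<lambda>g. \<Prod>b\<in>Basis. f b (g b))"
    by (rule product_integrable_prod) (use int in auto)
  show "integrable lborel (\<lambda>x. \<Prod>b\<in>Basis. f b (x \<bullet> b))"
    unfolding lb integrable_distr_eq[OF T m] eq by (rule i)
  show "(LINT x|lborel. (\<Prod>b\<in>Basis. f b (x \<bullet> b))) = (\<Prod>b\<in>Basis. LINT x|lborel. f b x)"
    unfolding lb integral_distr[OF T m] eq
    by (rule product_integral_prod) (use int in auto)
qed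

text \<open>The substitution x = c * t with c^2 = 2 * pi * u turns the integral into the
  characteristic function of the standard normal distribution.\<close>

lemma gaussian_fourier_real:
  fixes u \<xi> :: real
  assumes "0 < u"
  shows "integrable lborel (\<lambda>t. exp (2 * of_real pi * \<i> * of_real (t * \<xi>)) * of_real (exp (- pi * u * t\<^sup>2)))" (is "integrable _ ?f")
    and "(LINT t|lborel. exp (2 * of_real pi * \<i> * of_real (t * \<xi>)) * of_real (exp (- pi * u * t\<^sup>2)))
      = of_real (u powr (- 1 / 2) * exp (- pi * \<xi>\<^sup>2 / u))"
proof -
  define c where "c = sqrt (2 * pi * u)"
  have c: "0 < c" "c\<^sup>2 = 2 * pi * u" using assms by (auto simp: c_def)
  define \<tau> where "\<tau> = 2 * pi * \<xi> / c"
  let ?g = "\<lambda>x. std_normal_density x *\<^sub>R iexp (\<tau> * x) :: complex"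
  have g: "integrable lborel ?g"
  proof (rule Bochner_Integration.integrable_bound)
    show "integrable lborel (\<lambda>x. std_normal_density x)" by simp
  qed auto
  have gi: "(LINT x|lborel. ?g x) = of_real (exp (- (\<tau>\<^sup>2) / 2))"
  proof -
    have "(LINT x|lborel. ?g x) = char std_normal_distribution \<tau>"
      unfolding char_def by (subst integral_density) auto
    then show ?thesis using char_std_normal_distribution by metis
  qed
  have gc: "?g (0 + c * t) = (1 / sqrt (2 * pi)) *\<^sub>R ?f t" for t
  proof -
    have "std_normal_density (c * t) = 1 / sqrt (2 * pi) * exp (- pi * u * t\<^sup>2)"
      using c by (simp add: std_normal_density_def power_mult_distrib)
    moreover have "\<tau> * (c * t) = 2 * pi * (t * \<xi>)" using c(1) by (simp add: \<tau>_def)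
    moreover have "exp (2 * of_real pi * \<i> * complex_of_real (t * \<xi>)) = iexp (2 * pi * (t * \<xi>))"
      by (simp add: mult_ac)
    ultimately show ?thesis by (simp only: add_0) (simp add: scaleR_conv_of_real)
  qed
  have "integrable lborel (\<lambda>t. ?g (0 + c * t))"
    using c(1) g by (subst lborel_integrable_real_affine_iff) auto
  then have i: "integrable lborel (\<lambda>t. (1 / sqrt (2 * pi)) *\<^sub>R ?f t)" unfolding gc .
  have "integrable lborel (\<lambda>t. sqrt (2 * pi) *\<^sub>R ((1 / sqrt (2 * pi)) *\<^sub>R ?f t))"
    by (intro integrable_scaleR_right i)
  then show "integrable lborel ?f" by (simp only: scaleR_scaleR) simp
  have "of_real (exp (- (\<tau>\<^sup>2) / 2)) = \<bar>c\<bar> *\<^sub>R (LINT t|lborel. ?g (0 + c * t))"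
    unfolding gi[symmetric] using c(1) by (intro lborel_integral_real_affine) auto
  also have "\<dots> = (c / sqrt (2 * pi)) *\<^sub>R (LINT t|lborel. ?f t)"
    unfolding gc using c(1) by simp
  also have "c / sqrt (2 * pi) = sqrt u" using assms by (simp add: c_def real_sqrt_mult)
  finally have "(LINT t|lborel. ?f t) = (1 / sqrt u) *\<^sub>R of_real (exp (- (\<tau>\<^sup>2) / 2))"
    using assms by (simp add: scaleR_conv_of_real)
  moreover have "1 / sqrt u = u powr (- 1 / 2)"
    using assms by (simp add: powr_minus_divide powr_half_sqrt)
  moreover have "\<tau>\<^sup>2 / 2 = pi * \<xi>\<^sup>2 / u"
    unfolding \<tau>_def power_divide c(2) power_mult_distrib using assms by (simp add: power2_eq_square)
  ultimately show "(LINT t|lborel. ?f t) = of_real (u powr (- 1 / 2) * exp (- pi * \<xi>\<^sup>2 / u))"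
    by (simp add: scaleR_conv_of_real)
qed

lemma gaussian_fourier:
  fixes \<xi> :: "'a::euclidean_space"
  assumes "0 < u"
  shows "integrable lborel (\<lambda>x::'a. exp (2 * of_real pi * \<i> * of_real (x \<bullet> \<xi>)) * complex_of_real (exp (- pi * u * (norm x)\<^sup>2)))" (is "integrable _ ?f")
    and "(LINT x|lborel. exp (2 * of_real pi * \<i> * of_real (x \<bullet> \<xi>)) * complex_of_real (exp (- pi * u * (norm x)\<^sup>2)))
      = of_real (u powr (- real DIM('a) / 2) * exp (- pi * (norm \<xi>)\<^sup>2 / u))"
proof -
  let ?h = "\<lambda>b t. exp (2 * of_real pi * \<i> * of_real (t * (\<xi> \<bullet> b))) * complex_of_real (exp (- pi * u * t\<^sup>2))"
  have n2: "(norm x)\<^sup>2 = (\<Sum>b\<in>Basis. (x \<bullet> b)\<^sup>2)" for x :: 'a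
    unfolding power2_norm_eq_inner unfolding power2_eq_square by (rule euclidean_inner)
  have f: "?f x = (\<Prod>b\<in>Basis. ?h b (x \<bullet> b))" for x
  proof -
    have "(\<Prod>b\<in>Basis. ?h b (x \<bullet> b))
      = exp (\<Sum>b\<in>Basis. 2 * of_real pi * \<i> * of_real ((x \<bullet> b) * (\<xi> \<bullet> b))) * of_real (exp (\<Sum>b\<in>Basis. - pi * u * (x \<bullet> b)\<^sup>2))"
      by (simp add: prod.distrib exp_sum)
    also have "(\<Sum>b\<in>Basis. 2 * of_real pi * \<i> * of_real ((x \<bullet> b) * (\<xi> \<bullet> b))) = 2 * of_real pi * \<i> * complex_of_real (x \<bullet> \<xi>)"
      by (simp add: euclidean_inner[of x \<xi>] sum_distrib_left)
    also have "(\<Sum>b\<in>Basis. - pi * u * (x \<bullet> b)\<^sup>2) = - pi * u * (norm x)\<^sup>2"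
      by (simp add: n2 sum_distrib_left sum_negf)
    finally show ?thesis by simp
  qed
  show "integrable lborel ?f"
    unfolding f by (rule integral_lborel_prod(1)) (rule gaussian_fourier_real(1)[OF assms])
  have "(LINT x|lborel. ?f x) = (\<Prod>b\<in>(Basis :: 'a set). of_real (u powr (- 1 / 2) * exp (- pi * (\<xi> \<bullet> b)\<^sup>2 / u)))"
    unfolding f gaussian_fourier_real(2)[OF assms, symmetric]
    by (rule integral_lborel_prod(2)) (rule gaussian_fourier_real(1)[OF assms])
  also have "\<dots> = of_real ((u powr (- 1 / 2)) ^ DIM('a) * exp (\<Sum>b\<in>Basis. - pi * (\<xi> \<bullet> b)\<^sup>2 / u))"
    by (simp add: prod.distrib exp_sum)
  also have "(u powr (- 1 / 2)) ^ DIM('a) = u powr (- real DIM('a) / 2)"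
    using assms by (simp add: powr_realpow[symmetric] powr_powr)
  also have "(\<Sum>b\<in>Basis. - pi * (\<xi> \<bullet> b)\<^sup>2 / u) = - pi * (norm \<xi>)\<^sup>2 / u"
    by (simp add: n2 sum_distrib_left sum_negf sum_divide_distrib)
  finally show "(LINT x|lborel. ?f x) = of_real (u powr (- real DIM('a) / 2) * exp (- pi * (norm \<xi>)\<^sup>2 / u))" .
qed

section \<open>Inverse Fourier transforms of integrable functions\<close>

definition inv_fourier :: "('a::euclidean_space \<Rightarrow> complex) \<Rightarrow> 'a \<Rightarrow> complex" where
  "inv_fourier H x = (LINT \<xi>|lborel. exp (2 * of_real pi * \<i> * of_real (x \<bullet> \<xi>)) * H \<xi>)"

lemma norm_exp_2pi_i [simp]: "norm (exp (2 * of_real pi * \<i> * complex_of_real t)) = 1"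
  by (simp add: norm_exp_eq_Re)

lemma inv_fourier_integrable:
  assumes "integrable lborel H"
  shows "integrable lborel (\<lambda>\<xi>. exp (2 * of_real pi * \<i> * of_real (x \<bullet> \<xi>)) * H \<xi>)"
proof (rule Bochner_Integration.integrable_bound[OF assms])
  have [measurable]: "H \<in> borel_measurable borel" using borel_measurable_integrable[OF assms] by simp
  show "(\<lambda>\<xi>. exp (2 * of_real pi * \<i> * of_real (x \<bullet> \<xi>)) * H \<xi>) \<in> borel_measurable lborel" by measurable
qed (simp add: norm_mult)

lemma norm_inv_fourier_le: "norm (inv_fourier H x) \<le> (LINT \<xi>|lborel. norm (H \<xi>))"
  unfolding inv_fourier_def
  by (rule order_trans[OF integral_norm_bound]) (simp add: norm_mult)

lemma continuous_inv_fourier: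
  assumes "integrable lborel H"
  shows "continuous_on UNIV (inv_fourier H)"
proof -
  have "inv_fourier H \<midarrow>x\<rightarrow> inv_fourier H x" for x
    unfolding inv_fourier_def
  proof (rule tendsto_at_iff_sequentially[THEN iffD2], intro allI impI)
    fix X :: "nat \<Rightarrow> 'a" assume X: "X \<longlonglongrightarrow> x"
    have [measurable]: "H \<in> borel_measurable borel" using borel_measurable_integrable[OF assms] by simp
    show "((\<lambda>y. LINT \<xi>|lborel. exp (2 * of_real pi * \<i> * of_real (y \<bullet> \<xi>)) * H \<xi>) \<circ> X)
      \<longlonglongrightarrow> (LINT \<xi>|lborel. exp (2 * of_real pi * \<i> * of_real (x \<bullet> \<xi>)) * H \<xi>)"
      unfolding comp_def
    proof (rule integral_dominated_convergence[where w = "\<lambda>\<xi>. norm (H \<xi>)"])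
      show "AE \<xi> in lborel. (\<lambda>i. exp (2 * of_real pi * \<i> * of_real (X i \<bullet> \<xi>)) * H \<xi>)
        \<longlonglongrightarrow> exp (2 * of_real pi * \<i> * of_real (x \<bullet> \<xi>)) * H \<xi>"
        by (intro AE_I2 tendsto_intros X)
    qed (use assms in \<open>auto simp: norm_mult\<close>)
  qed
  then show ?thesis by (simp add: continuous_on_def)
qed

text \<open>Fubini and the symmetry of the kernel in x and \<xi>. This formula, tested with
  Gaussians, takes the place of Fourier inversion in all that follows.\<close>

lemma inv_fourier_multiplication:
  fixes H \<Phi> :: "'a::euclidean_space \<Rightarrow> complex"
  assumes H: "integrable lborel H" and \<Phi>: "integrable lborel \<Phi>"
  shows "(LINT \<xi>|lborel. H \<xi> * inv_fourier \<Phi> \<xi>) = (LINT x|lborel. \<Phi> x * inv_fourier H x)"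
proof -
  have [measurable]: "H \<in> borel_measurable borel" "\<Phi> \<in> borel_measurable borel"
    using borel_measurable_integrable[OF H] borel_measurable_integrable[OF \<Phi>] by auto
  let ?f = "\<lambda>\<xi> x. exp (2 * of_real pi * \<i> * of_real (x \<bullet> \<xi>)) * (H \<xi> * \<Phi> x)"
  have int: "integrable (lborel \<Otimes>\<^sub>M lborel) (case_prod ?f)"
  proof (rule lborel_pair.Fubini_integrable)
    have "(\<lambda>\<xi>. LINT x|lborel. norm (case_prod ?f (\<xi>, x))) = (\<lambda>\<xi>. norm (H \<xi>) * (LINT x|lborel. norm (\<Phi> x)))"
      by (simp add: norm_mult)
    then show "integrable lborel (\<lambda>\<xi>. LINT x|lborel. norm (case_prod ?f (\<xi>, x)))"
      using H by simp
    show "AE \<xi> in lborel. integrable lborel (\<lambda>x. case_prod ?f (\<xi>, x))"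
    proof (intro AE_I2)
      fix \<xi>
      have "(\<lambda>x. case_prod ?f (\<xi>, x)) = (\<lambda>x. H \<xi> * (exp (2 * of_real pi * \<i> * of_real (\<xi> \<bullet> x)) * \<Phi> x))"
        by (simp add: inner_commute mult_ac)
      then show "integrable lborel (\<lambda>x. case_prod ?f (\<xi>, x))"
        using inv_fourier_integrable[OF \<Phi>] by simp
    qed
  qed measurable
  have "(LINT \<xi>|lborel. H \<xi> * inv_fourier \<Phi> \<xi>) = (LINT \<xi>|lborel. LINT x|lborel. ?f \<xi> x)"
    unfolding inv_fourier_def integral_mult_right_zero[symmetric]
    by (intro Bochner_Integration.integral_cong refl) (simp add: inner_commute mult_ac)
  also have "\<dots> = (LINT x|lborel. LINT \<xi>|lborel. ?f \<xi> x)"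
    by (rule lborel_pair.Fubini_integral[OF int, symmetric])
  also have "\<dots> = (LINT x|lborel. \<Phi> x * inv_fourier H x)"
    unfolding inv_fourier_def integral_mult_right_zero[symmetric]
    by (intro Bochner_Integration.integral_cong refl) (simp add: mult_ac)
  finally show ?thesis .
qed

lemma integral_lborel_translate:
  fixes f :: "'a::euclidean_space \<Rightarrow> 'b::{banach, second_countable_topology}"
  assumes "f \<in> borel_measurable borel"
  shows "(LINT x|lborel. f (c + x)) = (LINT x|lborel. f x)"
    and "integrable lborel (\<lambda>x. f (c + x)) \<longleftrightarrow> integrable lborel f"
proof -
  have "(LINT x|distr lborel borel ((+) c). f x) = (LINT x|lborel. f (c + x))"
    by (rule integral_distr) (use assms in auto)
  then show "(LINT x|lborel. f (c + x)) = (LINT x|lborel. f x)" by (simp add: lborel_distr_plus)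
  have "integrable (distr lborel borel ((+) c)) f \<longleftrightarrow> integrable lborel (\<lambda>x. f (c + x))"
    by (rule integrable_distr_eq) (use assms in auto)
  then show "integrable lborel (\<lambda>x. f (c + x)) \<longleftrightarrow> integrable lborel f" by (simp add: lborel_distr_plus)
qed

text \<open>The usual heat kernel at time u / (4 * pi); in this parametrization its mass is 1 and
  its transform is exp (- pi * u * |\<xi>|^2).\<close>

definition heat_kernel :: "real \<Rightarrow> 'a::euclidean_space \<Rightarrow> real" where
  "heat_kernel u z = u powr (- real DIM('a) / 2) * exp (- pi * (norm z)\<^sup>2 / u)"

lemma heat_kernel_nonneg: "0 \<le> heat_kernel u z"
  by (simp add: heat_kernel_def)

lemma heat_kernel_fourier:
  fixes \<xi> :: "'a::euclidean_space"
  assumes "0 < u"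
  shows "integrable lborel (\<lambda>x::'a. exp (2 * of_real pi * \<i> * of_real (x \<bullet> \<xi>)) * complex_of_real (heat_kernel u x))"
    and "(LINT x|lborel. exp (2 * of_real pi * \<i> * of_real (x \<bullet> \<xi>)) * complex_of_real (heat_kernel u x))
      = of_real (exp (- pi * u * (norm \<xi>)\<^sup>2))"
proof -
  let ?c = "complex_of_real (u powr (- real DIM('a) / 2))"
  have "0 < 1 / u" using assms by simp
  note G = gaussian_fourier[OF this, of \<xi>]
  have eq: "exp (2 * of_real pi * \<i> * of_real (x \<bullet> \<xi>)) * complex_of_real (heat_kernel u x)
    = ?c * (exp (2 * of_real pi * \<i> * of_real (x \<bullet> \<xi>)) * complex_of_real (exp (- pi * (1 / u) * (norm x)\<^sup>2)))" for x :: 'a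
    by (simp add: heat_kernel_def mult_ac)
  show "integrable lborel (\<lambda>x::'a. exp (2 * of_real pi * \<i> * of_real (x \<bullet> \<xi>)) * complex_of_real (heat_kernel u x))"
    unfolding eq using G(1) by simp
  have one: "u powr (- real DIM('a) / 2) * (1 / u) powr (- real DIM('a) / 2) = 1"
    using assms by (simp flip: powr_mult)
  have "(LINT x|lborel. exp (2 * of_real pi * \<i> * of_real (x \<bullet> \<xi>)) * complex_of_real (heat_kernel u x))
    = ?c * of_real ((1 / u) powr (- real DIM('a) / 2) * exp (- pi * (norm \<xi>)\<^sup>2 / (1 / u)))"
    unfolding eq integral_mult_right_zero G(2) ..
  also have "\<dots> = of_real ((u powr (- real DIM('a) / 2) * (1 / u) powr (- real DIM('a) / 2)) * exp (- pi * u * (norm \<xi>)\<^sup>2))"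
    by (simp add: mult_ac)
  finally show "(LINT x|lborel. exp (2 * of_real pi * \<i> * of_real (x \<bullet> \<xi>)) * complex_of_real (heat_kernel u x))
      = of_real (exp (- pi * u * (norm \<xi>)\<^sup>2))" unfolding one by simp
qed

lemma integral_heat_kernel:
  assumes "0 < u"
  shows "integrable lborel (\<lambda>x. heat_kernel u (x - \<eta>))" "(LINT x|lborel. heat_kernel u (x - \<eta>)) = 1"
proof -
  have m: "(\<lambda>x::'a. heat_kernel u x) \<in> borel_measurable borel" unfolding heat_kernel_def by measurable
  have "integrable lborel (\<lambda>x::'a. complex_of_real (heat_kernel u x))"
    "(LINT x|lborel. complex_of_real (heat_kernel u (x::'a))) = 1"
    using heat_kernel_fourier[OF assms, of "0::'a"] by simp_all
  then have *: "integrable lborel (\<lambda>x::'a. heat_kernel u x)" "(LINT x|lborel. heat_kernel u (x::'a)) = 1"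
    by (simp_all add: complex_of_real_integrable_eq)
  show "integrable lborel (\<lambda>x. heat_kernel u (x - \<eta>))" "(LINT x|lborel. heat_kernel u (x - \<eta>)) = 1"
    using integral_lborel_translate[OF m, of "- \<eta>"] * by simp_all
qed

text \<open>The multiplication formula with the heat kernel centred at x as test function: its
  transform is the Gaussian factor times the exponential that evaluates at x.\<close>

lemma heat_smoothing:
  fixes H :: "'a::euclidean_space \<Rightarrow> complex"
  assumes H: "integrable lborel H" and "0 < u"
  shows "inv_fourier (\<lambda>\<xi>. of_real (exp (- pi * u * (norm \<xi>)\<^sup>2)) * H \<xi>) x
    = (LINT y|lborel. of_real (heat_kernel u (x - y)) * inv_fourier H y)"
proof -
  let ?\<Phi> = "\<lambda>y. complex_of_real (heat_kernel u (x - y))"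
  have sym: "?\<Phi> y = complex_of_real (heat_kernel u (y - x))" for y
    by (simp add: heat_kernel_def norm_minus_commute)
  have \<Phi>: "integrable lborel ?\<Phi>"
    unfolding sym using integral_heat_kernel(1)[OF assms(2), of x] by simp
  have m: "(\<lambda>y. exp (2 * of_real pi * \<i> * of_real (y \<bullet> \<xi>)) * ?\<Phi> y) \<in> borel_measurable borel" for \<xi>
    unfolding heat_kernel_def by measurable
  have F: "inv_fourier ?\<Phi> \<xi> = exp (2 * of_real pi * \<i> * of_real (x \<bullet> \<xi>)) * of_real (exp (- pi * u * (norm \<xi>)\<^sup>2))" for \<xi>
  proof -
    have "inv_fourier ?\<Phi> \<xi> = (LINT y|lborel. exp (2 * of_real pi * \<i> * of_real (y \<bullet> \<xi>)) * ?\<Phi> y)"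
      unfolding inv_fourier_def by (simp add: inner_commute)
    also have "\<dots> = (LINT z|lborel. exp (2 * of_real pi * \<i> * of_real ((x + z) \<bullet> \<xi>)) * ?\<Phi> (x + z))"
      by (rule integral_lborel_translate(1)[OF m, symmetric])
    also have "\<dots> = (LINT z|lborel. exp (2 * of_real pi * \<i> * of_real (x \<bullet> \<xi>))
        * (exp (2 * of_real pi * \<i> * of_real (z \<bullet> \<xi>)) * complex_of_real (heat_kernel u z)))"
      by (intro Bochner_Integration.integral_cong refl)
        (simp add: sym inner_add_left distrib_left exp_add mult.assoc heat_kernel_def)
    also have "\<dots> = exp (2 * of_real pi * \<i> * of_real (x \<bullet> \<xi>)) * of_real (exp (- pi * u * (norm \<xi>)\<^sup>2))"
      unfolding integral_mult_right_zero heat_kernel_fourier(2)[OF assms(2)] ..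
    finally show ?thesis .
  qed
  have "inv_fourier (\<lambda>\<xi>. of_real (exp (- pi * u * (norm \<xi>)\<^sup>2)) * H \<xi>) x = (LINT \<xi>|lborel. H \<xi> * inv_fourier ?\<Phi> \<xi>)"
    unfolding inv_fourier_def[of _ x] F by (intro Bochner_Integration.integral_cong refl) (simp add: mult_ac)
  also have "\<dots> = (LINT y|lborel. ?\<Phi> y * inv_fourier H y)"
    by (rule inv_fourier_multiplication[OF H \<Phi>])
  finally show ?thesis .
qed

section \<open>Injectivity of the inverse Fourier transform\<close>

lemma powr_mult_exp_inverse_tendsto_0:
  assumes "0 < c"
  shows "((\<lambda>u::real. u powr a * exp (- c / u)) \<longlongrightarrow> 0) (at_right 0)"
proof -
  have "((\<lambda>t::real. (1 / t) powr a * exp (- c / (1 / t))) \<longlongrightarrow> 0) at_top"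
  proof -
    have lim: "((\<lambda>t::real. exp (- a * ln t - c * t)) \<longlongrightarrow> 0) at_top"
    proof -
      have "((\<lambda>t::real. ln t / t) \<longlongrightarrow> 0) at_top" by (rule ln_x_over_x_tendsto_0)
      then have "((\<lambda>t::real. - a * (ln t / t) - c) \<longlongrightarrow> - a * 0 - c) at_top" by (intro tendsto_intros)
      then have "filterlim (\<lambda>t::real. (- a * (ln t / t) - c) * t) at_bot at_top"
        using assms by (intro filterlim_tendsto_neg_mult_at_bot[OF _ _ filterlim_ident]) auto
      moreover have "\<forall>\<^sub>F t::real in at_top. (- a * (ln t / t) - c) * t = - a * ln t - c * t"
        using eventually_gt_at_top[of 0] by eventually_elim (simp add: field_simps)
      ultimately have "filterlim (\<lambda>t::real. - a * ln t - c * t) at_bot at_top"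
        using filterlim_cong[OF refl refl] by fast
      then show ?thesis by (rule filterlim_compose[OF exp_at_bot])
    qed
    moreover have "\<forall>\<^sub>F t::real in at_top. exp (- a * ln t - c * t) = (1 / t) powr a * exp (- c / (1 / t))"
      using eventually_gt_at_top[of 0]
      by eventually_elim (simp add: powr_def ln_div mult_exp_exp)
    ultimately show ?thesis by (rule Lim_transform_eventually)
  qed
  then have "((\<lambda>t::real. (inverse t) powr a * exp (- c / inverse t)) \<longlongrightarrow> 0) at_top"
    by (simp add: divide_inverse)
  then show ?thesis unfolding filterlim_at_right_to_top .
qed

text \<open>Testing against Gaussians concentrating at \<open>\<eta>\<close>; \<open>H\<close> may be unbounded away from \<open>\<eta>\<close>,
  as \<open>|\<xi>|\<^sup>b\<close> is near the origin for \<open>b < 0\<close>.\<close>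

lemma inv_fourier_eq_0_imp_eq_0:
  fixes H :: "'a::euclidean_space \<Rightarrow> complex"
  assumes H: "integrable lborel H" and cont: "isCont H \<eta>" and zero: "AE x in lborel. inv_fourier H x = 0"
  shows "H \<eta> = 0"
proof -
  let ?d = "real DIM('a)"
  have [measurable]: "H \<in> borel_measurable borel" using borel_measurable_integrable[OF H] by simp
  have hk[measurable]: "(\<lambda>\<xi>::'a. heat_kernel u \<xi>) \<in> borel_measurable borel" for u
    unfolding heat_kernel_def by measurable
  have test: "(LINT \<xi>|lborel. H \<xi> * of_real (heat_kernel u (\<xi> - \<eta>))) = 0" if "0 < u" for u
  proof -
    \<comment> \<open>A modulated Gaussian, whose transform is the heat kernel centred at
      \<eta>.\<close>
    let ?\<Phi> = "\<lambda>x. exp (2 * of_real pi * \<i> * of_real (x \<bullet> - \<eta>)) * complex_of_real (exp (- pi * u * (norm x)\<^sup>2))"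
    have \<Phi>: "integrable lborel ?\<Phi>" by (rule gaussian_fourier(1)[OF that])
    have F: "inv_fourier ?\<Phi> \<xi> = of_real (heat_kernel u (\<xi> - \<eta>))" for \<xi>
    proof -
      have "inv_fourier ?\<Phi> \<xi> = (LINT x|lborel. exp (2 * of_real pi * \<i> * of_real (x \<bullet> (\<xi> - \<eta>))) * complex_of_real (exp (- pi * u * (norm x)\<^sup>2)))"
        unfolding inv_fourier_def
      proof (intro Bochner_Integration.integral_cong refl)
        fix x
        have "exp (2 * of_real pi * \<i> * of_real (\<xi> \<bullet> x)) * exp (2 * of_real pi * \<i> * of_real (x \<bullet> - \<eta>))
          = exp (2 * of_real pi * \<i> * complex_of_real (x \<bullet> (\<xi> - \<eta>)))"
          unfolding mult_exp_exp by (simp add: inner_diff_right inner_commute algebra_simps)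
        then show "exp (2 * of_real pi * \<i> * of_real (\<xi> \<bullet> x)) * ?\<Phi> x
          = exp (2 * of_real pi * \<i> * of_real (x \<bullet> (\<xi> - \<eta>))) * complex_of_real (exp (- pi * u * (norm x)\<^sup>2))"
          by (simp only: mult.assoc[symmetric])
      qed
      then show ?thesis unfolding gaussian_fourier(2)[OF that] heat_kernel_def .
    qed
    have "(LINT \<xi>|lborel. H \<xi> * of_real (heat_kernel u (\<xi> - \<eta>))) = (LINT x|lborel. ?\<Phi> x * inv_fourier H x)"
      unfolding F[symmetric] by (rule inv_fourier_multiplication[OF H \<Phi>])
    also have "\<dots> = (LINT x|(lborel :: 'a measure). 0)"
    proof (rule Bochner_Integration.integral_cong_AE)
      have "inv_fourier H \<in> borel_measurable borel"
        using continuous_inv_fourier[OF H] by (rule borel_measurable_continuous_onI)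
      then show "(\<lambda>x. ?\<Phi> x * inv_fourier H x) \<in> borel_measurable lborel" by measurable
      show "AE x in lborel. ?\<Phi> x * inv_fourier H x = 0" using zero by eventually_elim simp
    qed simp
    finally show ?thesis by simp
  qed
  define L where "L = (LINT \<xi>|lborel. norm (H \<xi>))"
  have "norm (H \<eta>) \<le> \<epsilon>" if eps: "0 < \<epsilon>" for \<epsilon>
  proof -
    obtain \<delta> where \<delta>: "0 < \<delta>" "\<And>\<xi>. norm (\<xi> - \<eta>) < \<delta> \<Longrightarrow> norm (H \<xi> - H \<eta>) < \<epsilon>"
      using cont eps unfolding continuous_at_eps_delta dist_norm by blast
    \<comment> \<open>\<open>E1\<close> and \<open>E2\<close> control the heat kernel at distance at
      least \<delta> from \<eta>. The uniform bound \<open>E1\<close> suffices against the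
      integrable H. The constant H \<eta> is not integrable, so there the kernel is instead bounded
      by \<open>E2\<close> times the heat kernel with parameter 2 * u, of mass 1.\<close>
    define E1 where "E1 u = u powr (- ?d / 2) * exp (- (pi * \<delta>\<^sup>2) / u)" for u
    define E2 where "E2 u = 2 powr (?d / 2) * exp (- (pi * \<delta>\<^sup>2 / 2) / u)" for u
    have bound: "norm (H \<eta>) \<le> \<epsilon> + E1 u * L + norm (H \<eta>) * E2 u" if "0 < u" for u
    proof -
      let ?g = "\<lambda>\<xi>. heat_kernel u (\<xi> - \<eta>)" and ?g2 = "\<lambda>\<xi>. heat_kernel (2 * u) (\<xi> - \<eta>)"
      have gi: "integrable lborel ?g" "(LINT \<xi>|lborel. ?g \<xi>) = 1" by (rule integral_heat_kernel[OF that])+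
      have g2i: "integrable lborel ?g2" "(LINT \<xi>|lborel. ?g2 \<xi>) = 1"
        using integral_heat_kernel[of "2 * u" \<eta>] that by simp_all
      have g_le: "?g \<xi> \<le> u powr (- ?d / 2)" for \<xi>
        unfolding heat_kernel_def using that by simp
      have Hg: "integrable lborel (\<lambda>\<xi>. H \<xi> * of_real (?g \<xi>))"
      proof (rule Bochner_Integration.integrable_bound[where f = "\<lambda>\<xi>. u powr (- ?d / 2) * norm (H \<xi>)"])
        show "AE \<xi> in lborel. norm (H \<xi> * of_real (?g \<xi>)) \<le> norm (u powr (- ?d / 2) * norm (H \<xi>))"
          using g_le heat_kernel_nonneg[of u] by (intro AE_I2) (auto simp: norm_mult mult.commute abs_of_nonneg[OF heat_kernel_nonneg] intro!: mult_left_mono)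
      qed (use H in auto)
      have Eg: "integrable lborel (\<lambda>\<xi>. H \<eta> * complex_of_real (?g \<xi>))" using gi(1) by simp
      have "(LINT \<xi>|lborel. (H \<xi> - H \<eta>) * of_real (?g \<xi>)) = (LINT \<xi>|lborel. H \<xi> * of_real (?g \<xi>)) - (LINT \<xi>|lborel. H \<eta> * of_real (?g \<xi>))"
        unfolding left_diff_distrib by (rule Bochner_Integration.integral_diff[OF Hg Eg])
      also have "\<dots> = - H \<eta>" unfolding test[OF that] using gi(2) by simp
      finally have "norm (H \<eta>) = norm (LINT \<xi>|lborel. (H \<xi> - H \<eta>) * of_real (?g \<xi>))" by simp
      also have "\<dots> \<le> (LINT \<xi>|lborel. norm (H \<xi> - H \<eta>) * ?g \<xi>)"
        by (rule order_trans[OF integral_norm_bound]) (simp add: norm_mult heat_kernel_nonneg)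
      also have "\<dots> \<le> (LINT \<xi>|lborel. \<epsilon> * ?g \<xi> + E1 u * norm (H \<xi>) + norm (H \<eta>) * E2 u * ?g2 \<xi>)"
      proof (rule integral_mono')
        show "integrable lborel (\<lambda>\<xi>. \<epsilon> * ?g \<xi> + E1 u * norm (H \<xi>) + norm (H \<eta>) * E2 u * ?g2 \<xi>)"
          using gi g2i H by simp
        have E0: "0 \<le> E1 u" "0 \<le> E2 u" by (simp_all add: E1_def E2_def)
        fix \<xi>
        show "norm (H \<xi> - H \<eta>) * ?g \<xi> \<le> \<epsilon> * ?g \<xi> + E1 u * norm (H \<xi>) + norm (H \<eta>) * E2 u * ?g2 \<xi>"
        proof (cases "norm (\<xi> - \<eta>) < \<delta>")
          case True
          then have "norm (H \<xi> - H \<eta>) * ?g \<xi> \<le> \<epsilon> * ?g \<xi>"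
            using \<delta>(2) by (intro mult_right_mono heat_kernel_nonneg) (auto intro: less_imp_le)
          moreover have "0 \<le> E1 u * norm (H \<xi>)" "0 \<le> norm (H \<eta>) * E2 u * ?g2 \<xi>"
            using E0 heat_kernel_nonneg[of "2 * u"] by (auto intro!: mult_nonneg_nonneg)
          ultimately show ?thesis by linarith
        next
          case False
          then have far: "\<delta>\<^sup>2 \<le> (norm (\<xi> - \<eta>))\<^sup>2" using \<delta>(1) by (intro power_mono) auto
          have gE1: "?g \<xi> \<le> E1 u"
            unfolding heat_kernel_def E1_def using that far
            by (intro mult_left_mono) (auto simp: divide_right_mono)
          have gE2: "?g \<xi> \<le> E2 u * ?g2 \<xi>"
          proof -
            have "exp (- (pi * \<delta>\<^sup>2 / 2) / u) \<ge> exp (- (pi * (norm (\<xi> - \<eta>))\<^sup>2 / 2) / u)"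
              using that far by (auto simp: divide_right_mono)
            then have "E2 u * ?g2 \<xi> \<ge> (2 powr (?d / 2) * exp (- (pi * (norm (\<xi> - \<eta>))\<^sup>2 / 2) / u)) * ?g2 \<xi>"
              unfolding E2_def by (intro mult_right_mono mult_left_mono heat_kernel_nonneg) auto
            moreover have "(2 powr (?d / 2) * exp (- (pi * (norm (\<xi> - \<eta>))\<^sup>2 / 2) / u)) * ?g2 \<xi> = ?g \<xi>"
            proof -
              have 1: "2 powr (?d / 2) * (2 * u) powr (- ?d / 2) = u powr (- ?d / 2)"
                using that by (simp add: powr_mult powr_minus field_simps)
              have 2: "exp (- (pi * (norm (\<xi> - \<eta>))\<^sup>2 / 2) / u) * exp (- pi * (norm (\<xi> - \<eta>))\<^sup>2 / (2 * u))
                = exp (- pi * (norm (\<xi> - \<eta>))\<^sup>2 / u)"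
                unfolding mult_exp_exp by (simp add: field_simps)
              have swap: "(a * b) * (c * d) = (a * c) * (b * d)" for a b c d :: real by simp
              show ?thesis unfolding heat_kernel_def swap 1 2 ..
            qed
            ultimately show ?thesis by simp
          qed
          have "norm (H \<xi> - H \<eta>) * ?g \<xi> \<le> (norm (H \<xi>) + norm (H \<eta>)) * ?g \<xi>"
            by (intro mult_right_mono norm_triangle_ineq4 heat_kernel_nonneg)
          also have "\<dots> = ?g \<xi> * norm (H \<xi>) + norm (H \<eta>) * ?g \<xi>" by (simp add: algebra_simps)
          also have "\<dots> \<le> E1 u * norm (H \<xi>) + norm (H \<eta>) * (E2 u * ?g2 \<xi>)"
            by (intro add_mono mult_right_mono mult_left_mono gE1 gE2) auto
          finally have "norm (H \<xi> - H \<eta>) * ?g \<xi> \<le> E1 u * norm (H \<xi>) + norm (H \<eta>) * (E2 u * ?g2 \<xi>)" .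
          moreover have "0 \<le> \<epsilon> * ?g \<xi>" using eps heat_kernel_nonneg[of u "\<xi> - \<eta>"] by simp
          ultimately show ?thesis by (simp add: mult.assoc)
        qed
        show "0 \<le> \<epsilon> * ?g \<xi> + E1 u * norm (H \<xi>) + norm (H \<eta>) * E2 u * ?g2 \<xi>"
          using E0 eps by (intro add_nonneg_nonneg mult_nonneg_nonneg heat_kernel_nonneg) auto
      qed
      also have "\<dots> = \<epsilon> + E1 u * L + norm (H \<eta>) * E2 u"
        using gi g2i H by (simp add: L_def)
      finally show ?thesis .
    qed
    have "(E1 \<longlongrightarrow> 0) (at_right 0)"
      unfolding E1_def by (rule powr_mult_exp_inverse_tendsto_0) (use \<delta> in auto)
    moreover have "(E2 \<longlongrightarrow> 2 powr (?d / 2) * 0) (at_right 0)"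
    proof -
      have "((\<lambda>u. exp (- (pi * \<delta>\<^sup>2 / 2) / u)) \<longlongrightarrow> 0) (at_right 0)"
      proof (rule Lim_transform_eventually[OF powr_mult_exp_inverse_tendsto_0[of "pi * \<delta>\<^sup>2 / 2" 0]])
        show "\<forall>\<^sub>F u in at_right 0. u powr 0 * exp (- (pi * \<delta>\<^sup>2 / 2) / u) = exp (- (pi * \<delta>\<^sup>2 / 2) / u)"
          by (auto simp: eventually_at_right_less eventually_at_filter)
      qed (use \<delta> in auto)
      then show ?thesis unfolding E2_def by (intro tendsto_mult tendsto_const)
    qed
    ultimately have "((\<lambda>u. \<epsilon> + E1 u * L + norm (H \<eta>) * E2 u) \<longlongrightarrow> \<epsilon> + 0 * L + norm (H \<eta>) * (2 powr (?d / 2) * 0)) (at_right 0)"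
      by (intro tendsto_intros)
    then have "((\<lambda>u. \<epsilon> + E1 u * L + norm (H \<eta>) * E2 u) \<longlongrightarrow> \<epsilon>) (at_right 0)" by simp
    then show ?thesis
    proof (rule tendsto_lowerbound)
      show "\<forall>\<^sub>F u in at_right 0. norm (H \<eta>) \<le> \<epsilon> + E1 u * L + norm (H \<eta>) * E2 u"
        using bound eventually_at_right_less[of "0::real"] by (auto elim: eventually_mono)
    qed simp
  qed
  then show ?thesis using field_le_epsilon[of "norm (H \<eta>)" 0] by simp
qed

section \<open>Gamma integrals and subordination to the heat kernel\<close>

lemma nn_integral_gamma_scaled:
  fixes a c :: real
  assumes "0 < a" "0 < c"
  shows "(\<integral>\<^sup>+u. ennreal (u powr (a - 1) * exp (- c * u) * indicator {0<..} u) \<partial>lborel) = ennreal (Gamma a * c powr - a)"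
proof -
  let ?f = "\<lambda>t. ennreal (indicator {0..} t * t powr (a - 1) / exp t)"
  have "ennreal (Gamma a) = (\<integral>\<^sup>+t. ?f t \<partial>lborel)" by (rule Gamma_conv_nn_integral_real[OF assms(1)])
  also have "\<dots> = ennreal \<bar>c\<bar> * (\<integral>\<^sup>+u. ?f (0 + c * u) \<partial>lborel)"
    using assms by (intro nn_integral_real_affine) auto
  also have "(\<integral>\<^sup>+u. ?f (0 + c * u) \<partial>lborel)
    = (\<integral>\<^sup>+u. ennreal (c powr (a - 1)) * ennreal (u powr (a - 1) * exp (- c * u) * indicator {0<..} u) \<partial>lborel)"
    using assms by (intro nn_integral_cong)
      (auto simp: indicator_def powr_mult exp_minus divide_inverse zero_le_mult_iff mult.assoc simp flip: ennreal_mult)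
  also have "\<dots> = ennreal (c powr (a - 1)) * (\<integral>\<^sup>+u. ennreal (u powr (a - 1) * exp (- c * u) * indicator {0<..} u) \<partial>lborel)"
    by (intro nn_integral_cmult) measurable
  finally have *: "ennreal (Gamma a) = ennreal (c powr a) * (\<integral>\<^sup>+u. ennreal (u powr (a - 1) * exp (- c * u) * indicator {0<..} u) \<partial>lborel)"
    using assms powr_add[of c 1 "a - 1"] by (simp add: mult.assoc[symmetric] flip: ennreal_mult)
  have "ennreal (Gamma a * c powr - a) = ennreal (c powr - a) * ennreal (Gamma a)"
    using assms by (simp add: ennreal_mult' mult.commute)
  also have "\<dots> = (ennreal (c powr - a) * ennreal (c powr a)) * (\<integral>\<^sup>+u. ennreal (u powr (a - 1) * exp (- c * u) * indicator {0<..} u) \<partial>lborel)"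
    unfolding * by (simp only: mult.assoc)
  also have "ennreal (c powr - a) * ennreal (c powr a) = 1"
    using assms by (simp flip: ennreal_mult powr_add)
  finally show ?thesis by simp
qed

lemma nn_integral_inverse_gamma_finite:
  fixes b :: real
  assumes "0 < b"
  shows "(\<integral>\<^sup>+s. ennreal (s powr (- b - 1) * exp (- pi / s) * indicator {0<..} s) \<partial>lborel) < \<infinity>"
proof -
  let ?c = "b + 1"
  have small: "s powr (- b - 1) * exp (- pi / s) \<le> ?c powr ?c" if "0 < s" for s :: real
  proof -
    \<comment> \<open>The inequality x \<le> exp x at x = 1 / (s * (b + 1)), raised to the power b +
      1, bounds s^(-b-1) by a constant times exp (1 / s), and hence by one times exp (pi /
      s).\<close>
    have "1 / s / ?c \<le> exp (1 / s / ?c)" using exp_ge_add_one_self[of "1 / s / ?c"] by linarith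
    then have le: "(1 / s / ?c) powr ?c \<le> exp (1 / s / ?c) powr ?c"
      using that assms by (intro powr_mono2) auto
    have "s powr (- b - 1) / ?c powr ?c = (1 / s) powr ?c / ?c powr ?c"
      using that assms by (simp add: powr_divide powr_minus_divide[symmetric])
    also have "\<dots> = (1 / s / ?c) powr ?c" by (rule powr_divide[symmetric])
    also note le
    also have "exp (1 / s / ?c) powr ?c = exp (1 / s)" using assms by (simp add: powr_def)
    also have "exp (1 / s) \<le> exp (pi / s)" using that pi_gt3 by (simp add: divide_right_mono)
    finally have "s powr (- b - 1) / ?c powr ?c \<le> exp (pi / s)" .
    then have "s powr (- b - 1) \<le> exp (pi / s) * ?c powr ?c" using assms by (simp add: divide_le_eq)
    then have "s powr (- b - 1) * exp (- pi / s) \<le> exp (pi / s) * ?c powr ?c * exp (- pi / s)"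
      by (rule mult_right_mono) simp
    then show ?thesis by (simp add: exp_minus field_simps)
  qed
  have "((\<lambda>x. x powr (- b - 1)) has_integral - (1 powr (- b - 1 + 1)) / (- b - 1 + 1)) {1..}"
    using assms by (intro has_integral_powr_to_inf) auto
  then have large: "(\<integral>\<^sup>+s. ennreal (s powr (- b - 1)) * indicator {1..} s \<partial>lborel) = ennreal (1 / b)"
    using nn_integral_has_integral_lebesgue'[of "{1..}" "\<lambda>x. x powr (- b - 1)" "1 / b"] assms by simp
  have "(\<integral>\<^sup>+s. ennreal (s powr (- b - 1) * exp (- pi / s) * indicator {0<..} s) \<partial>lborel)
    \<le> (\<integral>\<^sup>+s. ennreal (?c powr ?c) * indicator {0..1} s + ennreal (s powr (- b - 1)) * indicator {1..} s \<partial>lborel)"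
  proof (intro nn_integral_mono)
    fix s :: real
    show "ennreal (s powr (- b - 1) * exp (- pi / s) * indicator {0<..} s)
      \<le> ennreal (?c powr ?c) * indicator {0..1} s + ennreal (s powr (- b - 1)) * indicator {1..} s"
    proof (cases "0 < s")
      case True
      have "s powr (- b - 1) * exp (- pi / s) \<le> s powr (- b - 1)"
        using True pi_gt_zero by (simp add: mult_le_cancel_left2)
      then show ?thesis
        using True small[OF True] by (cases "s \<le> 1") (auto simp: indicator_def ennreal_leI add_increasing2)
    qed simp
  qed
  also have "\<dots> = ennreal (?c powr ?c) * emeasure lborel {0..1::real} + ennreal (1 / b)"
    by (subst nn_integral_add) (auto simp: nn_integral_cmult_indicator large)
  also have "\<dots> < \<infinity>" by simp
  finally show ?thesis .
qed

lemma nn_integral_inverse_gamma_scaled: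
  fixes b :: real
  assumes "0 < b"
  obtains K where "0 \<le> K" "\<And>r. 0 < r \<Longrightarrow>
    (\<integral>\<^sup>+u. ennreal (u powr (- b - 1) * exp (- pi * r\<^sup>2 / u) * indicator {0<..} u) \<partial>lborel) = ennreal (K * r powr (- 2 * b))"
proof
  let ?f = "\<lambda>r u. ennreal (u powr (- b - 1) * exp (- pi * r\<^sup>2 / u) * indicator {0<..} u)"
  let ?I = "\<integral>\<^sup>+s. ?f 1 s \<partial>lborel"
  define K where "K = enn2real ?I"
  show "0 \<le> K" by (simp add: K_def)
  have K: "?I = ennreal K"
    using nn_integral_inverse_gamma_finite[OF assms] by (simp add: K_def)
  fix r :: real assume r: "0 < r"
  have "(\<integral>\<^sup>+u. ?f r u \<partial>lborel) = ennreal \<bar>r\<^sup>2\<bar> * (\<integral>\<^sup>+s. ?f r (0 + r\<^sup>2 * s) \<partial>lborel)"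
    using r by (intro nn_integral_real_affine) auto
  also have "(\<integral>\<^sup>+s. ?f r (0 + r\<^sup>2 * s) \<partial>lborel) = (\<integral>\<^sup>+s. ennreal ((r\<^sup>2) powr (- b - 1)) * ?f 1 s \<partial>lborel)"
    using r by (intro nn_integral_cong)
      (auto simp: indicator_def powr_mult zero_less_mult_iff mult.assoc simp flip: ennreal_mult)
  also have "\<dots> = ennreal ((r\<^sup>2) powr (- b - 1)) * ?I"
    by (intro nn_integral_cmult) measurable
  also have "ennreal \<bar>r\<^sup>2\<bar> * (ennreal ((r\<^sup>2) powr (- b - 1)) * ?I) = ennreal (r\<^sup>2 * (r\<^sup>2) powr (- b - 1) * K)"
    unfolding K by (simp add: K_def mult.assoc flip: ennreal_mult)
  also have "r\<^sup>2 * (r\<^sup>2) powr (- b - 1) = r powr (- 2 * b)"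
  proof -
    have r2: "r\<^sup>2 = r powr 2" using r by simp
    show ?thesis unfolding r2 powr_powr powr_add[symmetric] by (simp add: algebra_simps)
  qed
  finally show "(\<integral>\<^sup>+u. ?f r u \<partial>lborel) = ennreal (K * r powr (- 2 * b))" by (simp add: mult.commute)
qed

lemma ennreal_norm_integral_le:
  fixes f :: "'a \<Rightarrow> 'b::{banach, second_countable_topology}"
  shows "ennreal (norm (integral\<^sup>L M f)) \<le> (\<integral>\<^sup>+x. ennreal (norm (f x)) \<partial>M)"
  by (cases "integrable M f") (auto simp: not_integrable_integral_eq intro: integral_norm_bound_ennreal)

text \<open>Up to constants, |\<xi>|^(-\<alpha>) is the integral of u^(\<alpha>/2 - 1) * exp (- pi *
  u * |\<xi>|^2) over u > 0, which needs \<alpha> > 0. By \<open>heat_smoothing\<close> each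
  Gaussian acts as averaging with the heat kernel, and the same superposition of heat kernels is a
  multiple of |z|^(\<alpha> - d), which needs \<alpha> < d. Passing to norms early avoids any
  question of convergence of the potential.\<close>

lemma inv_fourier_riesz_bound:
  assumes \<alpha>: "0 < \<alpha>" "\<alpha> < real DIM('a::euclidean_space)"
  obtains c where "0 \<le> c"
    "\<And>(H :: 'a \<Rightarrow> complex) x. integrable lborel H \<Longrightarrow> integrable lborel (\<lambda>\<xi>. of_real (norm \<xi> powr - \<alpha>) * H \<xi>) \<Longrightarrow>
      ennreal (norm (inv_fourier (\<lambda>\<xi>. of_real (norm \<xi> powr - \<alpha>) * H \<xi>) x))
      \<le> (\<integral>\<^sup>+y. ennreal (norm (x - y) powr (\<alpha> - real DIM('a)) * (c * norm (inv_fourier H y))) \<partial>lborel)"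
proof -
  let ?d = "real DIM('a)"
  define a where "a = \<alpha> / 2"
  define b where "b = (?d - \<alpha>) / 2"
  have ab: "0 < a" "0 < b" using \<alpha> by (auto simp: a_def b_def)
  obtain K where K: "0 \<le> K" "\<And>r. 0 < r \<Longrightarrow>
    (\<integral>\<^sup>+u. ennreal (u powr (- b - 1) * exp (- pi * r\<^sup>2 / u) * indicator {0<..} u) \<partial>lborel) = ennreal (K * r powr (- 2 * b))"
    by (rule nn_integral_inverse_gamma_scaled[OF ab(2)], rule that)
  define \<kappa> where "\<kappa> = Gamma a * pi powr - a"
  have \<kappa>: "0 < \<kappa>" using ab(1) by (simp add: \<kappa>_def Gamma_real_pos)
  define \<phi> where "\<phi> u = u powr (a - 1) * indicator {0<..} u" for u :: real
  have \<phi>0: "0 \<le> \<phi> u" for u by (simp add: \<phi>_def)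
  have [measurable]: "\<phi> \<in> borel_measurable borel" unfolding \<phi>_def by measurable
  have hb: "has_bochner_integral lborel (\<lambda>u. \<phi> u * exp (- pi * u * (norm \<xi>)\<^sup>2)) (\<kappa> * norm \<xi> powr - \<alpha>)"
    if "\<xi> \<noteq> 0" for \<xi> :: 'a
  proof (rule has_bochner_integral_nn_integral)
    have "(\<integral>\<^sup>+u. ennreal (\<phi> u * exp (- pi * u * (norm \<xi>)\<^sup>2)) \<partial>lborel)
      = (\<integral>\<^sup>+u. ennreal (u powr (a - 1) * exp (- (pi * (norm \<xi>)\<^sup>2) * u) * indicator {0<..} u) \<partial>lborel)"
      by (intro nn_integral_cong) (simp add: \<phi>_def mult_ac)
    also have "\<dots> = ennreal (Gamma a * (pi * (norm \<xi>)\<^sup>2) powr - a)"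
      using that ab by (intro nn_integral_gamma_scaled) auto
    also have "Gamma a * (pi * (norm \<xi>)\<^sup>2) powr - a = \<kappa> * norm \<xi> powr - \<alpha>"
    proof -
      have "((norm \<xi>)\<^sup>2) powr - a = norm \<xi> powr - \<alpha>"
        using that by (simp add: a_def powr_powr flip: powr_numeral)
      then show ?thesis by (simp add: \<kappa>_def powr_mult)
    qed
    finally show "(\<integral>\<^sup>+u. ennreal (\<phi> u * exp (- pi * u * (norm \<xi>)\<^sup>2)) \<partial>lborel) = ennreal (\<kappa> * norm \<xi> powr - \<alpha>)" .
  qed (use \<kappa> \<phi>0 in \<open>auto intro!: AE_I2 mult_nonneg_nonneg\<close>)
  show thesis
  proof (rule that)
    show "0 \<le> K / \<kappa>" using K \<kappa> by simp
    fix H :: "'a \<Rightarrow> complex" and x :: 'a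
    assume H: "integrable lborel H" and H\<alpha>: "integrable lborel (\<lambda>\<xi>. of_real (norm \<xi> powr - \<alpha>) * H \<xi>)"
    have [measurable]: "H \<in> borel_measurable borel" using borel_measurable_integrable[OF H] by simp
    let ?e = "\<lambda>\<xi>. exp (2 * of_real pi * \<i> * complex_of_real (x \<bullet> \<xi>))"
    let ?f = "\<lambda>\<xi> u. of_real (\<phi> u * exp (- pi * u * (norm \<xi>)\<^sup>2)) * (?e \<xi> * H \<xi>)"
    let ?F = "inv_fourier (\<lambda>\<xi>. of_real (norm \<xi> powr - \<alpha>) * H \<xi>) x"
    \<comment> \<open>The integral over u of the absolute values is \<kappa> * |\<xi>|^(-\<alpha>) *
      |H \<xi>|, so the hypothesis on the divided symbol is exactly what Fubini requires.\<close>
    have int: "integrable (lborel \<Otimes>\<^sub>M lborel) (case_prod ?f)"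
    proof (rule lborel_pair.Fubini_integrable)
      have "integrable lborel (\<lambda>\<xi>. \<kappa> * norm (of_real (norm \<xi> powr - \<alpha>) * H \<xi>))"
        using H\<alpha> by simp
      moreover have "AE \<xi> in lborel. \<kappa> * norm (of_real (norm \<xi> powr - \<alpha>) * H \<xi>) = (LINT u|lborel. norm (case_prod ?f (\<xi>, u)))"
        using AE_lborel_singleton[of "0::'a"]
      proof eventually_elim
        case (elim \<xi>)
        have "(LINT u|lborel. norm (case_prod ?f (\<xi>, u))) = (LINT u|lborel. \<phi> u * exp (- pi * u * (norm \<xi>)\<^sup>2) * norm (H \<xi>))"
          using \<phi>0 by (intro Bochner_Integration.integral_cong refl) (simp add: norm_mult)
        also have "\<dots> = \<kappa> * norm \<xi> powr - \<alpha> * norm (H \<xi>)"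
          using has_bochner_integral_integral_eq[OF hb[OF elim]] by simp
        finally show ?case by (simp only: norm_mult norm_of_real abs_of_nonneg[OF powr_ge_zero] mult.assoc)
      qed
      ultimately show "integrable lborel (\<lambda>\<xi>. LINT u|lborel. norm (case_prod ?f (\<xi>, u)))"
        by (subst (asm) integrable_cong_AE[where g = "\<lambda>\<xi>. LINT u|lborel. norm (case_prod ?f (\<xi>, u))"]) auto
      show "AE \<xi> in lborel. integrable lborel (\<lambda>u. case_prod ?f (\<xi>, u))"
        using AE_lborel_singleton[of "0::'a"]
      proof eventually_elim
        case (elim \<xi>)
        have "integrable lborel (\<lambda>u. complex_of_real (\<phi> u * exp (- pi * u * (norm \<xi>)\<^sup>2)))"
          using hb[OF elim] by (intro integrable_of_real) (simp add: has_bochner_integral_iff)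
        then show ?case by simp
      qed
    qed measurable
    have "of_real \<kappa> * ?F = (LINT \<xi>|lborel. LINT u|lborel. ?f \<xi> u)"
    proof -
      have "of_real \<kappa> * ?F = (LINT \<xi>|lborel. of_real \<kappa> * (?e \<xi> * (of_real (norm \<xi> powr - \<alpha>) * H \<xi>)))"
        unfolding inv_fourier_def by simp
      also have "\<dots> = (LINT \<xi>|lborel. LINT u|lborel. ?f \<xi> u)"
      proof (rule Bochner_Integration.integral_cong_AE)
        show "AE \<xi> in lborel. of_real \<kappa> * (?e \<xi> * (of_real (norm \<xi> powr - \<alpha>) * H \<xi>)) = (LINT u|lborel. ?f \<xi> u)"
          using AE_lborel_singleton[of "0::'a"]
        proof eventually_elim
          case (elim \<xi>)
          have "(LINT u|lborel. ?f \<xi> u) = (LINT u|lborel. of_real (\<phi> u * exp (- pi * u * (norm \<xi>)\<^sup>2))) * (?e \<xi> * H \<xi>)"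
            by (rule integral_mult_left_zero)
          also have "(LINT u|lborel. complex_of_real (\<phi> u * exp (- pi * u * (norm \<xi>)\<^sup>2))) = of_real (\<kappa> * norm \<xi> powr - \<alpha>)"
            unfolding integral_complex_of_real has_bochner_integral_integral_eq[OF hb[OF elim]] ..
          finally have e: "(LINT u|lborel. ?f \<xi> u) = of_real (\<kappa> * norm \<xi> powr - \<alpha>) * (?e \<xi> * H \<xi>)" .
          show ?case unfolding e by (simp add: mult_ac)
        qed
      qed measurable
      finally show ?thesis .
    qed
    also have "\<dots> = (LINT u|lborel. LINT \<xi>|lborel. ?f \<xi> u)"
      by (rule lborel_pair.Fubini_integral[OF int, symmetric])
    finally have "ennreal (norm (of_real \<kappa> * ?F)) \<le> (\<integral>\<^sup>+u. ennreal (norm (LINT \<xi>|lborel. ?f \<xi> u)) \<partial>lborel)"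
      by (simp only: ennreal_norm_integral_le)
    also have "\<dots> \<le> (\<integral>\<^sup>+u. (\<integral>\<^sup>+y. ennreal (\<phi> u * heat_kernel u (x - y) * norm (inv_fourier H y)) \<partial>lborel) \<partial>lborel)"
    proof (intro nn_integral_mono)
      fix u :: real
      show "ennreal (norm (LINT \<xi>|lborel. ?f \<xi> u)) \<le> (\<integral>\<^sup>+y. ennreal (\<phi> u * heat_kernel u (x - y) * norm (inv_fourier H y)) \<partial>lborel)"
      proof (cases "0 < u")
        case True
        have "(LINT \<xi>|lborel. ?f \<xi> u) = (LINT \<xi>|lborel. of_real (\<phi> u) * (?e \<xi> * (of_real (exp (- pi * u * (norm \<xi>)\<^sup>2)) * H \<xi>)))"
          by (intro Bochner_Integration.integral_cong refl) (simp add: mult_ac)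
        also have "\<dots> = of_real (\<phi> u) * inv_fourier (\<lambda>\<xi>. of_real (exp (- pi * u * (norm \<xi>)\<^sup>2)) * H \<xi>) x"
          unfolding inv_fourier_def by simp
        also have "\<dots> = (LINT y|lborel. of_real (\<phi> u) * (of_real (heat_kernel u (x - y)) * inv_fourier H y))"
          unfolding heat_smoothing[OF H True] by simp
        finally have "ennreal (norm (LINT \<xi>|lborel. ?f \<xi> u))
          \<le> (\<integral>\<^sup>+y. ennreal (norm (of_real (\<phi> u) * (of_real (heat_kernel u (x - y)) * inv_fourier H y))) \<partial>lborel)"
          by (simp only: ennreal_norm_integral_le)
        also have "\<dots> = (\<integral>\<^sup>+y. ennreal (\<phi> u * heat_kernel u (x - y) * norm (inv_fourier H y)) \<partial>lborel)"
          using \<phi>0 by (intro nn_integral_cong) (simp add: norm_mult mult_ac abs_of_nonneg[OF heat_kernel_nonneg])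
        finally show ?thesis .
      qed (simp add: \<phi>_def)
    qed
    also have "\<dots> = (\<integral>\<^sup>+y. (\<integral>\<^sup>+u. ennreal (\<phi> u * heat_kernel u (x - y) * norm (inv_fourier H y)) \<partial>lborel) \<partial>lborel)"
    proof (rule lborel_pair.Fubini')
      have [measurable]: "inv_fourier H \<in> borel_measurable borel"
        using continuous_inv_fourier[OF H] by (rule borel_measurable_continuous_onI)
      show "(\<lambda>(y, u). ennreal (\<phi> u * heat_kernel u (x - y) * norm (inv_fourier H y))) \<in> borel_measurable (lborel \<Otimes>\<^sub>M lborel)"
        unfolding heat_kernel_def by measurable
    qed
    also have "\<dots> = (\<integral>\<^sup>+y. ennreal (K * norm (x - y) powr (\<alpha> - ?d) * norm (inv_fourier H y)) \<partial>lborel)"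
    proof (rule nn_integral_cong_AE, use AE_lborel_singleton[of x] in eventually_elim)
      case (elim y)
      have eq: "\<phi> u * heat_kernel u (x - y) = u powr (- b - 1) * exp (- pi * (norm (x - y))\<^sup>2 / u) * indicator {0<..} u" for u
      proof (cases "0 < u")
        case True
        have "a - 1 + - ?d / 2 = - b - 1" by (simp add: a_def b_def field_simps)
        then have "u powr (a - 1) * u powr (- ?d / 2) = u powr (- b - 1)" by (metis powr_add)
        then show ?thesis using True by (simp add: \<phi>_def heat_kernel_def)
      qed (simp add: \<phi>_def)
      have "(\<integral>\<^sup>+u. ennreal (\<phi> u * heat_kernel u (x - y) * norm (inv_fourier H y)) \<partial>lborel)
        = (\<integral>\<^sup>+u. ennreal (u powr (- b - 1) * exp (- pi * (norm (x - y))\<^sup>2 / u) * indicator {0<..} u) * ennreal (norm (inv_fourier H y)) \<partial>lborel)"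
        unfolding eq by (intro nn_integral_cong ennreal_mult'') simp
      also have "\<dots> = ennreal (K * norm (x - y) powr (- 2 * b)) * ennreal (norm (inv_fourier H y))"
        using elim by (subst nn_integral_multc, measurable, subst K(2)) auto
      also have "\<dots> = ennreal (K * norm (x - y) powr (\<alpha> - ?d) * norm (inv_fourier H y))"
      proof -
        have "- 2 * b = \<alpha> - ?d" by (simp add: b_def)
        then show ?thesis by (simp only: ennreal_mult''[OF norm_ge_zero])
      qed
      finally show ?case .
    qed
    finally have le: "ennreal (\<kappa> * norm ?F) \<le> (\<integral>\<^sup>+y. ennreal (K * norm (x - y) powr (\<alpha> - ?d) * norm (inv_fourier H y)) \<partial>lborel)"
      using \<kappa> by (simp add: norm_mult)
    have [measurable]: "inv_fourier H \<in> borel_measurable borel"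
      using continuous_inv_fourier[OF H] by (rule borel_measurable_continuous_onI)
    have "ennreal (norm ?F) = ennreal (1 / \<kappa>) * ennreal (\<kappa> * norm ?F)"
      using \<kappa> by (simp flip: ennreal_mult)
    also have "\<dots> \<le> ennreal (1 / \<kappa>) * (\<integral>\<^sup>+y. ennreal (K * norm (x - y) powr (\<alpha> - ?d) * norm (inv_fourier H y)) \<partial>lborel)"
      by (intro mult_left_mono le) simp
    also have "\<dots> = (\<integral>\<^sup>+y. ennreal (1 / \<kappa>) * ennreal (K * norm (x - y) powr (\<alpha> - ?d) * norm (inv_fourier H y)) \<partial>lborel)"
      by (rule nn_integral_cmult[symmetric]) measurable
    also have "\<dots> = (\<integral>\<^sup>+y. ennreal (norm (x - y) powr (\<alpha> - ?d) * (K / \<kappa> * norm (inv_fourier H y))) \<partial>lborel)"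
      using \<kappa> K(1) by (intro nn_integral_cong) (simp add: mult_ac flip: ennreal_mult)
    finally show "ennreal (norm ?F) \<le> (\<integral>\<^sup>+y. ennreal (norm (x - y) powr (\<alpha> - ?d) * (K / \<kappa> * norm (inv_fourier H y))) \<partial>lborel)" .
  qed
qed

section \<open>Schwartz functions and fractional derivatives\<close>

lemma nn_integral_singular_decay_finite:
  fixes c :: real
  assumes "-1 < c" "c \<le> 0"
  shows "(\<integral>\<^sup>+u. ennreal (\<bar>u\<bar> powr c / (1 + u\<^sup>2)) \<partial>lborel) < \<infinity>"
proof -
  define F where "F u = ennreal (u powr c) * indicator {0<..<1} u + ennreal (u powr - 2) * indicator {1..} u" for u :: real
  have [measurable]: "F \<in> borel_measurable borel" unfolding F_def by measurable
  have "(\<integral>\<^sup>+u. ennreal (u powr c) * indicator {0<..<1} u \<partial>lborel)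
    = (\<integral>\<^sup>+u. ennreal (u powr c) * indicator {0..1} u \<partial>lborel)"
    using AE_lborel_singleton[of "0::real"] AE_lborel_singleton[of "1::real"]
    by (intro nn_integral_cong_AE) (auto simp: indicator_def)
  also have "\<dots> = ennreal (1 powr (c + 1) / (c + 1))"
    using assms has_integral_powr_from_0[of c 1] by (intro nn_integral_has_integral_lebesgue') auto
  finally have 1: "(\<integral>\<^sup>+u. ennreal (u powr c) * indicator {0<..<1} u \<partial>lborel) < \<infinity>" by simp
  have 2: "(\<integral>\<^sup>+u. ennreal (u powr - 2) * indicator {1..} u \<partial>lborel) < \<infinity>"
  proof -
    have "((\<lambda>x. x powr - 2) has_integral - (1 powr (- 2 + 1)) / (- 2 + 1)) {1::real..}"
      by (intro has_integral_powr_to_inf) auto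
    then show ?thesis using nn_integral_has_integral_lebesgue'[of "{1..}" "\<lambda>x::real. x powr - 2" 1] by simp
  qed
  have F: "(\<integral>\<^sup>+u. F u \<partial>lborel) < \<infinity>"
    unfolding F_def using 1 2 by (subst nn_integral_add) auto
  have F': "(\<integral>\<^sup>+u. F (- u) \<partial>lborel) < \<infinity>"
    using F nn_integral_real_affine[of F "-1" 0] by simp
  have "(\<integral>\<^sup>+u. ennreal (\<bar>u\<bar> powr c / (1 + u\<^sup>2)) \<partial>lborel) \<le> (\<integral>\<^sup>+u. F u + F (- u) \<partial>lborel)"
  proof (intro nn_integral_mono)
    fix u :: real
    have pos: "ennreal (\<bar>u\<bar> powr c / (1 + u\<^sup>2)) \<le> F u" if "0 < u" for u :: real
    proof (cases "u < 1")
      case True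
      have "u powr c / (1 + u\<^sup>2) \<le> u powr c / 1" by (intro divide_left_mono) (auto simp: add_pos_nonneg)
      then show ?thesis using that True by (simp add: F_def ennreal_leI)
    next
      case False
      have "u powr c \<le> 1" using False assms that powr_mono[of c 0 u] by simp
      then have "u powr c / (1 + u\<^sup>2) \<le> 1 / u\<^sup>2" using that by (intro frac_le) auto
      also have "\<dots> = u powr - 2" using that by (simp add: powr_minus_divide)
      finally show ?thesis using that False by (simp add: F_def ennreal_leI)
    qed
    show "ennreal (\<bar>u\<bar> powr c / (1 + u\<^sup>2)) \<le> F u + F (- u)"
      using pos[of u] pos[of "- u"] by (cases "u = 0"; cases "0 < u") (auto intro: add_increasing add_increasing2)
  qed
  also have "\<dots> = (\<integral>\<^sup>+u. F u \<partial>lborel) + (\<integral>\<^sup>+u. F (- u) \<partial>lborel)"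
    by (rule nn_integral_add) measurable
  also have "\<dots> < \<infinity>" using F F' by simp
  finally show ?thesis .
qed

text \<open>An integrable majorant in product form: the power c allows a singularity on the
  coordinate hyperplanes, the denominators provide decay at infinity, and integrability reduces to
  one dimension.\<close>

definition decay :: "real \<Rightarrow> 'a::euclidean_space \<Rightarrow> real" where
  "decay c x = (\<Prod>b\<in>Basis. \<bar>x \<bullet> b\<bar> powr c / (1 + (x \<bullet> b)\<^sup>2))"

lemma decay_nonneg: "0 \<le> decay c x"
  unfolding decay_def by (intro prod_nonneg) auto

lemma integrable_decay:
  assumes "-1 < c" "c \<le> 0"
  shows "integrable lborel (decay c :: 'a::euclidean_space \<Rightarrow> real)"
proof -
  have "(\<integral>\<^sup>+x. ennreal (decay c (x::'a)) \<partial>lborel)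
      = (\<integral>\<^sup>+x. (\<Prod>b\<in>Basis. ennreal (\<bar>(x::'a) \<bullet> b\<bar> powr c / (1 + (x \<bullet> b)\<^sup>2))) \<partial>lborel)"
    unfolding decay_def by (intro nn_integral_cong prod_ennreal[symmetric]) auto
  also have "\<dots> = (\<Prod>b\<in>(Basis::'a set). \<integral>\<^sup>+u. ennreal (\<bar>u\<bar> powr c / (1 + u\<^sup>2)) \<partial>lborel)"
    by (rule nn_integral_lborel_prod) auto
  also have "\<dots> < \<infinity>"
    using nn_integral_singular_decay_finite[OF assms] by (simp add: power_less_top_ennreal)
  finally have "(\<integral>\<^sup>+x. ennreal (decay c (x::'a)) \<partial>lborel) < \<infinity>" .
  moreover have "decay c \<in> borel_measurable (borel :: 'a measure)"
    unfolding decay_def by measurable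
  ultimately show ?thesis
    by (intro integrableI_bounded) (simp_all add: decay_nonneg)
qed

lemma AE_inner_Basis_nonzero: "AE x in lborel. \<forall>b\<in>Basis. (x::'a::euclidean_space) \<bullet> b \<noteq> 0"
proof (rule AE_finite_allI)
  fix b :: 'a assume b: "b \<in> Basis"
  have m: "{x. x \<bullet> b = 0} \<in> sets lborel" by simp
  have "{x. x \<bullet> b = 0} \<in> null_sets lebesgue"
    using negligible_standard_hyperplane[OF b, of 0] by (simp add: negligible_iff_null_sets)
  then have "{x. x \<bullet> b = 0} \<in> null_sets lborel"
    using null_sets_completion_iff[OF m] by simp
  then show "AE x in lborel. x \<bullet> b \<noteq> 0" by (intro AE_I'[of "{x. x \<bullet> b = 0}"]) auto
qed simp

text \<open>For b \<le> 0 put c = b / d, so that c > -1. As |\<xi>| is at least each |\<xi>_i|, the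
  power |\<xi>|^b is at most the product of the |\<xi>_i|^c. This replaces the radial singularity by
  the integrable product \<open>decay\<close>.\<close>

lemma integrable_powr_rapid_decay:
  fixes G :: "'a::euclidean_space \<Rightarrow> complex"
  assumes [measurable]: "G \<in> borel_measurable borel" and "- real DIM('a) < b"
    and rapid: "\<And>m. \<exists>C. \<forall>\<xi>. norm \<xi> ^ m * norm (G \<xi>) \<le> C"
  shows "integrable lborel (\<lambda>\<xi>. of_real (norm \<xi> powr b) * G \<xi>)"
proof -
  let ?d = "DIM('a)"
  \<comment> \<open>Only the negative part of b is left as a singularity; the remaining power is at
    most |\<xi>|^k outside the unit ball and is absorbed by the rapid decay of G.\<close>
  define b0 where "b0 = min b 0"
  define c where "c = b0 / ?d"
  have c: "-1 < c" "c \<le> 0" using assms(2) by (auto simp: c_def b0_def field_simps min_def)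
  obtain k :: nat where k: "b - b0 \<le> real k" using real_arch_simple by blast
  obtain C0 where C0: "\<And>\<xi>. norm (G \<xi>) \<le> C0" using rapid[of 0] by auto
  obtain C1 where C1: "\<And>\<xi>. norm \<xi> ^ (k + 2 * ?d) * norm (G \<xi>) \<le> C1" using rapid[of "k + 2 * ?d"] by auto
  define C where "C = 2 ^ ?d * max C0 C1"
  have C0_nn: "0 \<le> C0" using C0[of 0] norm_ge_zero order_trans by blast
  have prod_le: "(\<Prod>b\<in>Basis. 1 + (\<xi> \<bullet> b)\<^sup>2) \<le> (1 + (norm \<xi>)\<^sup>2) ^ ?d" for \<xi> :: 'a
  proof -
    have "(\<Prod>b\<in>Basis. 1 + (\<xi> \<bullet> b)\<^sup>2) \<le> (\<Prod>b\<in>(Basis::'a set). 1 + (norm \<xi>)\<^sup>2)"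
    proof (intro prod_mono conjI)
      fix b :: 'a assume "b \<in> Basis"
      then have "\<bar>\<xi> \<bullet> b\<bar> \<le> norm \<xi>" by (rule Basis_le_norm)
      then have "\<bar>\<xi> \<bullet> b\<bar>\<^sup>2 \<le> (norm \<xi>)\<^sup>2" by (intro power_mono) auto
      then show "1 + (\<xi> \<bullet> b)\<^sup>2 \<le> 1 + (norm \<xi>)\<^sup>2" by simp
    qed simp
    then show ?thesis by simp
  qed
  have main: "norm \<xi> powr b * norm (G \<xi>) * (1 + (norm \<xi>)\<^sup>2) ^ ?d \<le> C * norm \<xi> powr b0" if "\<xi> \<noteq> 0" for \<xi>
  proof (cases "norm \<xi> \<le> 1")
    case True
    have "norm \<xi> powr b \<le> norm \<xi> powr b0" using True that by (intro powr_mono') (auto simp: b0_def)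
    moreover have "(1 + (norm \<xi>)\<^sup>2) ^ ?d \<le> 2 ^ ?d" using True by (intro power_mono) (auto simp: power_le_one)
    ultimately have "norm \<xi> powr b * norm (G \<xi>) * (1 + (norm \<xi>)\<^sup>2) ^ ?d \<le> norm \<xi> powr b0 * max C0 C1 * 2 ^ ?d"
      using C0[of \<xi>] C0_nn by (intro mult_mono) auto
    then show ?thesis by (simp add: C_def mult_ac)
  next
    case False
    have "norm \<xi> powr b = norm \<xi> powr b0 * norm \<xi> powr (b - b0)" by (simp flip: powr_add)
    also have "\<dots> \<le> norm \<xi> powr b0 * norm \<xi> powr (real k)"
      using False k by (intro mult_left_mono powr_mono) auto
    also have "norm \<xi> powr (real k) = norm \<xi> ^ k" using that by (simp add: powr_realpow)
    finally have 1: "norm \<xi> powr b \<le> norm \<xi> powr b0 * norm \<xi> ^ k" .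
    have "(1::real) \<le> (norm \<xi>)\<^sup>2" using False by (simp add: one_le_power)
    then have "(1 + (norm \<xi>)\<^sup>2) ^ ?d \<le> (2 * (norm \<xi>)\<^sup>2) ^ ?d" by (intro power_mono) auto
    also have "\<dots> = 2 ^ ?d * norm \<xi> ^ (2 * ?d)" by (simp add: power_mult_distrib power_mult)
    finally have 2: "(1 + (norm \<xi>)\<^sup>2) ^ ?d \<le> 2 ^ ?d * norm \<xi> ^ (2 * ?d)" .
    have "norm \<xi> powr b * norm (G \<xi>) * (1 + (norm \<xi>)\<^sup>2) ^ ?d
      \<le> (norm \<xi> powr b0 * norm \<xi> ^ k) * norm (G \<xi>) * (2 ^ ?d * norm \<xi> ^ (2 * ?d))"
      using 1 2 by (intro mult_mono mult_nonneg_nonneg) auto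
    also have "\<dots> = 2 ^ ?d * norm \<xi> powr b0 * (norm \<xi> ^ (k + 2 * ?d) * norm (G \<xi>))"
      by (simp add: power_add)
    also have "\<dots> \<le> 2 ^ ?d * norm \<xi> powr b0 * max C0 C1"
      using C1[of \<xi>] by (intro mult_left_mono) auto
    finally show ?thesis by (simp add: C_def mult_ac)
  qed
  have C_nn: "0 \<le> C" using C0_nn by (simp add: C_def)
  show ?thesis
  proof (rule Bochner_Integration.integrable_bound)
    show "integrable lborel (\<lambda>\<xi>::'a. C * decay c \<xi>)" using integrable_decay[OF c, where 'a = 'a] by simp
    show "AE \<xi> in lborel. norm (of_real (norm \<xi> powr b) * G \<xi>) \<le> norm (C * decay c \<xi>)"
      using AE_inner_Basis_nonzero
    proof eventually_elim
      case (elim \<xi>)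
      have \<xi>0: "\<xi> \<noteq> 0" using elim SOME_Basis by auto
      let ?P = "\<Prod>b\<in>Basis. 1 + (\<xi> \<bullet> b)\<^sup>2"
      have P: "0 < ?P" by (intro prod_pos) (simp add: add_pos_nonneg)
      have "norm \<xi> powr b0 = (\<Prod>b\<in>(Basis::'a set). norm \<xi> powr c)"
        using \<xi>0 by (simp add: c_def powr_realpow[symmetric] powr_powr)
      also have "\<dots> \<le> (\<Prod>b\<in>Basis. \<bar>\<xi> \<bullet> b\<bar> powr c)"
        using elim c by (intro prod_mono conjI powr_mono2' Basis_le_norm) auto
      finally have b0: "norm \<xi> powr b0 \<le> (\<Prod>b\<in>Basis. \<bar>\<xi> \<bullet> b\<bar> powr c)" .
      have "norm \<xi> powr b * norm (G \<xi>) * ?P \<le> norm \<xi> powr b * norm (G \<xi>) * (1 + (norm \<xi>)\<^sup>2) ^ ?d"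
        by (intro mult_left_mono prod_le) auto
      also have "\<dots> \<le> C * norm \<xi> powr b0" by (rule main[OF \<xi>0])
      also have "\<dots> \<le> C * (\<Prod>b\<in>Basis. \<bar>\<xi> \<bullet> b\<bar> powr c)" by (intro mult_left_mono b0 C_nn)
      finally have "norm \<xi> powr b * norm (G \<xi>) \<le> C * (\<Prod>b\<in>Basis. \<bar>\<xi> \<bullet> b\<bar> powr c) / ?P"
        using P by (simp add: le_divide_eq)
      also have "\<dots> = C * decay c \<xi>" by (simp add: decay_def prod_dividef)
      finally show ?case using C_nn decay_nonneg[of c \<xi>] by (simp add: norm_mult)
    qed
  qed measurable
qed

section \<open>Decay and differentiation of Schwartz functions\<close>

lemma iter_partial_deriv_append:
  "iter_partial_deriv js (iter_partial_deriv ks g) = iter_partial_deriv (js @ ks) g"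
  by (induction js) auto

lemma partial_deriv_schwartz:
  assumes "g \<in> schwartz"
  shows "partial_deriv i g \<in> schwartz"
proof -
  have "iter_partial_deriv js (partial_deriv i g) = iter_partial_deriv (js @ [i]) g" for js
    using iter_partial_deriv_append[of js "[i]" g] by simp
  then show ?thesis using assms unfolding schwartz_def by auto
qed

lemma schwartz_differentiable:
  assumes "g \<in> schwartz"
  shows "g differentiable (at x)"
proof -
  have "iter_partial_deriv [] g differentiable (at x)" using assms unfolding schwartz_def by blast
  then show ?thesis by simp
qed

lemma schwartz_borel: 
  fixes g :: "real^'n \<Rightarrow> complex"
  assumes "g \<in> schwartz"
  shows "g \<in> borel_measurable borel"
proof -
  have "isCont g x" for x using schwartz_differentiable[OF assms] by (rule differentiable_imp_continuous_within)
  then show ?thesis by (intro borel_measurable_continuous_onI continuous_at_imp_continuous_on) auto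
qed

lemma prod_Basis_vec:
  fixes f :: "real^'n \<Rightarrow> 'b::comm_monoid_mult"
  shows "(\<Prod>b\<in>Basis. f b) = (\<Prod>i\<in>UNIV. f (axis i 1))"
proof -
  have "(Basis :: (real^'n) set) = range (\<lambda>i. axis i 1)" by (auto simp: Basis_vec_def)
  then have "(\<Prod>b\<in>Basis. f b) = (\<Prod>b\<in>range (\<lambda>i. axis i 1). f b)" by (rule arg_cong)
  also have "\<dots> = (\<Prod>i\<in>UNIV. f (axis i 1))"
    by (subst prod.reindex) (auto simp: inj_on_def axis_eq_axis)
  finally show ?thesis .
qed

lemma monomial_square_support:
  "monomial (\<lambda>i. if i \<in> A then 2 else 0) x = (\<Prod>i\<in>A. (x $ i)\<^sup>2)"
proof -
  have "(\<Prod>i\<in>A. (x $ i)\<^sup>2) = (\<Prod>i\<in>UNIV. (x $ i) ^ (if i \<in> A then 2 else 0))"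
    by (rule prod.mono_neutral_cong_left) auto
  then show ?thesis by (simp add: monomial_def)
qed

text \<open>The product of the factors 1 + x_i^2 expands into monomials with exponents 0 and 2, one
  for each set of coordinates, and each of them times g is bounded.\<close>

lemma schwartz_decay:
  fixes g :: "real^'n \<Rightarrow> complex"
  assumes "g \<in> schwartz"
  obtains C where "0 \<le> C" "\<And>x. norm (g x) \<le> C * (\<Prod>i\<in>UNIV. 1 / (1 + (x $ i)\<^sup>2))"
proof -
  have "\<exists>B. \<forall>x. norm (of_real (monomial \<alpha> x) * g x) \<le> B" for \<alpha>
  proof -
    have "bounded (range (\<lambda>x. of_real (monomial \<alpha> x) * iter_partial_deriv [] g x))"
      using assms unfolding schwartz_def by blast
    then show ?thesis by (auto simp: bounded_iff)
  qed
  then obtain B where B: "\<And>\<alpha> x. norm (of_real (monomial \<alpha> x) * g x) \<le> B \<alpha>" by metis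
  let ?\<alpha> = "\<lambda>A i. if i \<in> A then 2 else 0 :: nat"
  define C where "C = (\<Sum>A\<in>Pow (UNIV :: 'n set). B (?\<alpha> A))"
  have B0: "0 \<le> B \<alpha>" for \<alpha> using B[of \<alpha> 0] norm_ge_zero order_trans by blast
  show thesis
  proof (rule that)
    show "0 \<le> C" unfolding C_def by (intro sum_nonneg B0)
    fix x :: "real^'n"
    let ?P = "\<Prod>i\<in>UNIV. 1 + (x $ i)\<^sup>2"
    have P: "0 < ?P" by (intro prod_pos) (simp add: add_pos_nonneg)
    have "?P = (\<Prod>i\<in>UNIV. (x $ i)\<^sup>2 + 1)" by (simp add: add.commute)
    also have "\<dots> = (\<Sum>A\<in>Pow UNIV. (\<Prod>i\<in>A. (x $ i)\<^sup>2) * (\<Prod>i\<in>UNIV - A. 1))"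
      by (rule prod_add) simp
    also have "\<dots> = (\<Sum>A\<in>Pow UNIV. monomial (?\<alpha> A) x)" by (simp add: monomial_square_support)
    finally have Pe: "?P = (\<Sum>A\<in>Pow UNIV. monomial (?\<alpha> A) x)" .
    have "norm (g x) * ?P = (\<Sum>A\<in>Pow UNIV. norm (g x) * monomial (?\<alpha> A) x)"
      unfolding Pe by (rule sum_distrib_left)
    also have "\<dots> \<le> (\<Sum>A\<in>Pow UNIV. B (?\<alpha> A))"
    proof (intro sum_mono)
      fix A :: "'n set"
      have "norm (g x) * monomial (?\<alpha> A) x \<le> norm (of_real (monomial (?\<alpha> A) x) * g x)"
        by (simp add: norm_mult mult.commute[of "norm (g x)"] mult_right_mono)
      also have "\<dots> \<le> B (?\<alpha> A)" by (rule B)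
      finally show "norm (g x) * monomial (?\<alpha> A) x \<le> B (?\<alpha> A)" .
    qed
    finally have "norm (g x) \<le> C / ?P" using P by (simp add: C_def le_divide_eq)
    then show "norm (g x) \<le> C * (\<Prod>i\<in>UNIV. 1 / (1 + (x $ i)\<^sup>2))" by (simp add: prod_dividef)
  qed
qed

text \<open>This is \<open>decay 0\<close> up to a null set: \<open>0 powr 0\<close> is 0, so the
  two differ only on the coordinate hyperplanes.\<close>

lemma integrable_prod_decay: "integrable lborel (\<lambda>x::real^'n. \<Prod>i\<in>UNIV. 1 / (1 + (x $ i)\<^sup>2))"
proof -
  have "AE x in lborel. decay 0 x = (\<Prod>i\<in>UNIV. 1 / (1 + ((x::real^'n) $ i)\<^sup>2))"
    using AE_inner_Basis_nonzero
  proof eventually_elim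
    case (elim x)
    have "decay 0 x = (\<Prod>b\<in>Basis. 1 / (1 + (x \<bullet> b)\<^sup>2))"
      unfolding decay_def using elim by (intro prod.cong refl) auto
    then show ?case by (simp add: prod_Basis_vec inner_axis)
  qed
  moreover have "decay 0 \<in> borel_measurable (borel :: (real^'n) measure)" unfolding decay_def by measurable
  moreover have "(\<lambda>x::real^'n. \<Prod>i\<in>UNIV. 1 / (1 + (x $ i)\<^sup>2)) \<in> borel_measurable borel"
    by (intro borel_measurable_continuous_onI continuous_intros) (auto simp: add_nonneg_eq_0_iff)
  moreover have "integrable lborel (decay 0 :: real^'n \<Rightarrow> real)" by (rule integrable_decay) auto
  ultimately show ?thesis
    using integrable_cong_AE[of "decay 0" lborel "\<lambda>x::real^'n. \<Prod>i\<in>UNIV. 1 / (1 + (x $ i)\<^sup>2)"] by simp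
qed

lemma schwartz_integrable:
  fixes g :: "real^'n \<Rightarrow> complex"
  assumes "g \<in> schwartz"
  shows "integrable lborel g"
proof -
  obtain C where C: "0 \<le> C" "\<And>x. norm (g x) \<le> C * (\<Prod>i\<in>UNIV. 1 / (1 + (x $ i)\<^sup>2))"
    using schwartz_decay[OF assms] by blast
  show ?thesis
  proof (rule Bochner_Integration.integrable_bound)
    show "integrable lborel (\<lambda>x::real^'n. C * (\<Prod>i\<in>UNIV. 1 / (1 + (x $ i)\<^sup>2)))"
      by (intro integrable_mult_right integrable_prod_decay)
    show "AE x in lborel. norm (g x) \<le> norm (C * (\<Prod>i\<in>UNIV. 1 / (1 + (x $ i)\<^sup>2)))"
      by (intro AE_I2 order_trans[OF C(2)]) simp
  qed (simp add: schwartz_borel[OF assms])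
qed

text \<open>\<open>partial_deriv\<close> selects a vector derivative at 0; Frechet differentiability
  guarantees that it exists and gives the derivative at every point of the line.\<close>

lemma vector_derivative_along_line:
  fixes g :: "real^'n \<Rightarrow> complex"
  assumes "\<And>y. g differentiable (at y)"
  shows "((\<lambda>s. g (x + s *\<^sub>R axis i 1)) has_vector_derivative partial_deriv i g (x + t *\<^sub>R axis i 1)) (at t)"
proof -
  have line: "((\<lambda>s. g (x + s *\<^sub>R e)) has_vector_derivative frechet_derivative g (at (x + t *\<^sub>R e)) e) (at t)"
    for x e :: "real^'n" and t
  proof -
    let ?D = "frechet_derivative g (at (x + t *\<^sub>R e))"
    have "(g has_derivative ?D) (at (x + t *\<^sub>R e))"
      using assms frechet_derivative_works by blast
    moreover have "((\<lambda>s. x + s *\<^sub>R e) has_derivative (\<lambda>s. s *\<^sub>R e)) (at t)"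
      by (auto intro!: derivative_eq_intros)
    ultimately have "((\<lambda>s. g (x + s *\<^sub>R e)) has_derivative (\<lambda>s. ?D (s *\<^sub>R e))) (at t)"
      by (rule has_derivative_compose[rotated])
    moreover have "?D (s *\<^sub>R e) = s *\<^sub>R ?D e" for s
      using linear_frechet_derivative[OF assms] by (rule linear_cmul)
    ultimately show ?thesis unfolding has_vector_derivative_def by simp
  qed
  have "partial_deriv i g y = frechet_derivative g (at y) (axis i 1)" for y
    unfolding partial_deriv_def using vector_derivative_at[OF line[of y "axis i 1" 0]] by simp
  then show ?thesis using line by simp
qed

lemma vector_derivative_quotient:
  assumes "(f has_vector_derivative D) (at 0)"
  shows "((\<lambda>s. (1 / s) *\<^sub>R (f s - f 0)) \<longlongrightarrow> D) (at 0)"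
proof -
  have "((\<lambda>s. norm (f (0 + s) - f 0 - s *\<^sub>R D) / norm s) \<longlongrightarrow> 0) (at 0)"
    using assms unfolding has_vector_derivative_def has_derivative_at by blast
  moreover have "\<forall>\<^sub>F s in at 0. norm (f (0 + s) - f 0 - s *\<^sub>R D) / norm s = norm ((1 / s) *\<^sub>R (f s - f 0) - D)"
  proof (rule eventually_at_filter[THEN iffD2], intro always_eventually allI impI)
    fix s :: real assume "s \<noteq> 0"
    then have "(1 / s) *\<^sub>R (f s - f 0) - D = (1 / s) *\<^sub>R (f (0 + s) - f 0 - s *\<^sub>R D)"
      by (simp add: scaleR_diff_right)
    then show "norm (f (0 + s) - f 0 - s *\<^sub>R D) / norm s = norm ((1 / s) *\<^sub>R (f s - f 0) - D)"
      by (simp add: divide_inverse mult.commute)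
  qed
  ultimately have "((\<lambda>s. norm ((1 / s) *\<^sub>R (f s - f 0) - D)) \<longlongrightarrow> 0) (at 0)"
    by (rule Lim_transform_eventually)
  then show ?thesis by (rule Lim_null[THEN iffD2, OF tendsto_norm_zero_cancel])
qed

lemma inv_fourier_translate:
  assumes "g \<in> borel_measurable borel"
  shows "inv_fourier (\<lambda>x. g (x + a)) \<eta> = exp (- 2 * of_real pi * \<i> * of_real (\<eta> \<bullet> a)) * inv_fourier g \<eta>"
proof -
  let ?f = "\<lambda>y. exp (2 * of_real pi * \<i> * of_real (\<eta> \<bullet> (y - a))) * g y"
  have m: "?f \<in> borel_measurable borel" using assms by measurable
  have "inv_fourier (\<lambda>x. g (x + a)) \<eta> = (LINT x|lborel. ?f (a + x))"
    unfolding inv_fourier_def by (simp add: add.commute)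
  also have "\<dots> = (LINT y|lborel. ?f y)" by (rule integral_lborel_translate(1)[OF m])
  also have "\<dots> = (LINT y|lborel. exp (- 2 * of_real pi * \<i> * of_real (\<eta> \<bullet> a)) * (exp (2 * of_real pi * \<i> * of_real (\<eta> \<bullet> y)) * g y))"
  proof (intro Bochner_Integration.integral_cong refl)
    fix y
    have "exp (2 * of_real pi * \<i> * complex_of_real (\<eta> \<bullet> (y - a)))
      = exp (- 2 * of_real pi * \<i> * of_real (\<eta> \<bullet> a)) * exp (2 * of_real pi * \<i> * of_real (\<eta> \<bullet> y))"
      unfolding mult_exp_exp by (simp add: inner_diff_right algebra_simps)
    then show "?f y = exp (- 2 * of_real pi * \<i> * of_real (\<eta> \<bullet> a)) * (exp (2 * of_real pi * \<i> * of_real (\<eta> \<bullet> y)) * g y)"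
      by (simp only: mult.assoc)
  qed
  finally show ?thesis unfolding inv_fourier_def by simp
qed

text \<open>Difference quotients replace integration by parts: translating g by h multiplies the
  transform by an exponential, so the transform of the quotient is explicit, and dominated
  convergence passes to the limit on the other side.\<close>

lemma inv_fourier_partial_deriv:
  fixes g :: "real^'n \<Rightarrow> complex"
  assumes g: "g \<in> schwartz"
  shows "inv_fourier (partial_deriv i g) \<eta> = - 2 * of_real pi * \<i> * of_real (\<eta> $ i) * inv_fourier g \<eta>"
proof -
  let ?e = "axis i 1 :: real^'n"
  define h where "h n = 1 / real (Suc n)" for n
  have h: "0 < h n" "h n \<le> 1" for n by (auto simp: h_def)
  have h0: "h \<longlonglongrightarrow> 0" unfolding h_def by (rule LIMSEQ_Suc) (rule lim_1_over_n)
  have h_at: "filterlim h (at 0) sequentially"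
    unfolding filterlim_at using h0 h(1) by (simp add: less_imp_neq[symmetric])
  note dg = partial_deriv_schwartz[OF g, of i]
  have [measurable]: "g \<in> borel_measurable borel" "partial_deriv i g \<in> borel_measurable borel"
    using schwartz_borel[OF g] schwartz_borel[OF dg] by auto
  note vd = vector_derivative_along_line[OF schwartz_differentiable[OF g], of _ i]
  obtain C where C: "0 \<le> C" "\<And>x. norm (partial_deriv i g x) \<le> C * (\<Prod>i\<in>UNIV. 1 / (1 + (x $ i)\<^sup>2))"
    using schwartz_decay[OF dg] by blast
  define \<rho> where "\<rho> x = (\<Prod>i\<in>UNIV. 1 / (1 + (x $ i)\<^sup>2))" for x :: "real^'n"
  let ?q = "\<lambda>n x. (1 / h n) *\<^sub>R (g (x + h n *\<^sub>R ?e) - g x)"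
  have bound: "norm (?q n x) \<le> C * (3 ^ CARD('n) * \<rho> x)" for n x
  proof -
    have "\<exists>t\<in>{0<..<h n}. norm (g (x + h n *\<^sub>R ?e) - g (x + 0 *\<^sub>R ?e)) \<le> norm ((h n - 0) *\<^sub>R partial_deriv i g (x + t *\<^sub>R ?e))"
    proof (rule mvt_general[where f' = "\<lambda>t s. s *\<^sub>R partial_deriv i g (x + t *\<^sub>R ?e)"])
      show "((\<lambda>s. g (x + s *\<^sub>R ?e)) has_derivative (\<lambda>s. s *\<^sub>R partial_deriv i g (x + t *\<^sub>R ?e))) (at t)" for t
        using vd[of x t] unfolding has_vector_derivative_def .
      show "continuous_on {0..h n} (\<lambda>s. g (x + s *\<^sub>R ?e))"
        by (intro continuous_at_imp_continuous_on ballI has_vector_derivative_continuous[OF vd])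
    qed (rule h)
    then obtain t where t: "0 < t" "t < h n" "norm (g (x + h n *\<^sub>R ?e) - g x) \<le> h n * norm (partial_deriv i g (x + t *\<^sub>R ?e))"
      using h[of n] by auto
    have "\<rho> (x + t *\<^sub>R ?e) \<le> (\<Prod>j\<in>UNIV. 3 * (1 / (1 + (x $ j)\<^sup>2)))"
      unfolding \<rho>_def
    proof (intro prod_mono conjI)
      fix j :: 'n
      define y where "y = (x + t *\<^sub>R ?e) $ j"
      \<comment> \<open>The intermediate point of the mean value theorem is at distance at most 1,
        and such a shift changes 1 + x_j^2 by a factor of at most 3. This gives a majorant
        independent of n.\<close>
      have "\<bar>x $ j - y\<bar> \<le> 1" using t h[of n] by (auto simp: y_def axis_def)
      then have "(x $ j - y)\<^sup>2 \<le> 1" by (simp add: abs_square_le_1)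
      moreover have "(x $ j)\<^sup>2 \<le> 2 * y\<^sup>2 + 2 * (x $ j - y)\<^sup>2"
        using zero_le_power2[of "2 * y - x $ j"] by (simp add: power2_eq_square algebra_simps)
      moreover have "0 \<le> y\<^sup>2" by simp
      ultimately have "1 + (x $ j)\<^sup>2 \<le> 3 * (1 + y\<^sup>2)" unfolding distrib_left by linarith
      moreover have "0 < 1 + (x $ j)\<^sup>2" "0 < 1 + y\<^sup>2" by (simp_all add: add_pos_nonneg)
      ultimately show "1 / (1 + ((x + t *\<^sub>R ?e) $ j)\<^sup>2) \<le> 3 * (1 / (1 + (x $ j)\<^sup>2))"
        unfolding y_def[symmetric] by (simp add: field_simps)
    qed simp
    also have "\<dots> = 3 ^ CARD('n) * \<rho> x" unfolding \<rho>_def prod.distrib by simp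
    finally have \<rho>: "\<rho> (x + t *\<^sub>R ?e) \<le> 3 ^ CARD('n) * \<rho> x" .
    have "norm (?q n x) = norm (g (x + h n *\<^sub>R ?e) - g x) / h n" using h[of n] by (simp add: divide_inverse)
    also have "\<dots> \<le> norm (partial_deriv i g (x + t *\<^sub>R ?e))" using t h[of n] by (simp add: divide_le_eq mult.commute)
    also have "\<dots> \<le> C * \<rho> (x + t *\<^sub>R ?e)" unfolding \<rho>_def by (rule C(2))
    also have "\<dots> \<le> C * (3 ^ CARD('n) * \<rho> x)" by (intro mult_left_mono \<rho> C(1))
    finally show ?thesis .
  qed
  have "(\<lambda>n. inv_fourier (?q n) \<eta>) \<longlonglongrightarrow> inv_fourier (partial_deriv i g) \<eta>"
    unfolding inv_fourier_def
  proof (rule integral_dominated_convergence[where w = "\<lambda>x. C * (3 ^ CARD('n) * \<rho> x)"])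
    show "integrable lborel (\<lambda>x. C * (3 ^ CARD('n) * \<rho> x))"
      unfolding \<rho>_def by (intro integrable_mult_right integrable_prod_decay)
    show "AE x in lborel. norm (exp (2 * of_real pi * \<i> * complex_of_real (\<eta> \<bullet> x)) * ?q n x) \<le> C * (3 ^ CARD('n) * \<rho> x)" for n
      using bound by (intro AE_I2) (simp only: norm_mult norm_exp_2pi_i mult_1_left)
    show "AE x in lborel. (\<lambda>n. exp (2 * of_real pi * \<i> * complex_of_real (\<eta> \<bullet> x)) * ?q n x)
        \<longlonglongrightarrow> exp (2 * of_real pi * \<i> * of_real (\<eta> \<bullet> x)) * partial_deriv i g x"
    proof (intro AE_I2 tendsto_mult tendsto_const)
      fix x
      have "((\<lambda>s. (1 / s) *\<^sub>R (g (x + s *\<^sub>R ?e) - g x)) \<longlongrightarrow> partial_deriv i g x) (at 0)"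
        using vector_derivative_quotient[OF vd[of x 0]] by simp
      then show "(\<lambda>n. ?q n x) \<longlonglongrightarrow> partial_deriv i g x" by (rule filterlim_compose[OF _ h_at])
    qed
  qed measurable
  moreover have "inv_fourier (?q n) \<eta> = (1 / h n) *\<^sub>R (exp (- 2 * of_real pi * \<i> * of_real (h n * \<eta> $ i)) - 1) * inv_fourier g \<eta>" for n
  proof -
    have int: "integrable lborel (\<lambda>x. g (x + h n *\<^sub>R ?e))"
      using schwartz_integrable[OF g] integral_lborel_translate(2)[of g "h n *\<^sub>R ?e"] by (simp add: add.commute)
    have "inv_fourier (?q n) \<eta> = (LINT x|lborel. (1 / h n) *\<^sub>R (exp (2 * of_real pi * \<i> * of_real (\<eta> \<bullet> x)) * g (x + h n *\<^sub>R ?e) - exp (2 * of_real pi * \<i> * of_real (\<eta> \<bullet> x)) * g x))"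
      unfolding inv_fourier_def by (intro Bochner_Integration.integral_cong refl) (simp add: algebra_simps)
    also have "\<dots> = (1 / h n) *\<^sub>R (inv_fourier (\<lambda>x. g (x + h n *\<^sub>R ?e)) \<eta> - inv_fourier g \<eta>)"
      unfolding inv_fourier_def integral_scaleR_right
      by (subst Bochner_Integration.integral_diff[OF inv_fourier_integrable[OF int] inv_fourier_integrable[OF schwartz_integrable[OF g]]]) simp
    also have "\<dots> = (1 / h n) *\<^sub>R (exp (- 2 * of_real pi * \<i> * of_real (h n * \<eta> $ i)) - 1) * inv_fourier g \<eta>"
      by (subst inv_fourier_translate) (simp_all add: inner_axis algebra_simps)
    finally show ?thesis .
  qed
  moreover have "(\<lambda>n. (1 / h n) *\<^sub>R (exp (- 2 * of_real pi * \<i> * of_real (h n * \<eta> $ i)) - 1) * inv_fourier g \<eta>)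
    \<longlonglongrightarrow> - 2 * of_real pi * \<i> * of_real (\<eta> $ i) * inv_fourier g \<eta>"
  proof (intro tendsto_mult tendsto_const)
    let ?c = "- 2 * of_real pi * \<i> * of_real (\<eta> $ i)"
    have "((\<lambda>z::complex. exp (z * ?c)) has_field_derivative ?c) (at (of_real 0))"
      by (auto intro!: derivative_eq_intros)
    then have "((\<lambda>s::real. exp (of_real s * ?c)) has_vector_derivative ?c) (at 0)"
      by (rule has_vector_derivative_real_field)
    from filterlim_compose[OF vector_derivative_quotient[OF this] h_at]
    show "(\<lambda>n. (1 / h n) *\<^sub>R (exp (- 2 * of_real pi * \<i> * of_real (h n * \<eta> $ i)) - 1)) \<longlonglongrightarrow> ?c"
      by (simp add: mult_ac)
  qed
  ultimately show ?thesis by (simp only: LIMSEQ_unique)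
qed

section \<open>Fourier transforms of Schwartz functions\<close>

lemma fourier_eq_inv_fourier:
  assumes "g \<in> schwartz"
  shows "fourier g \<xi> = inv_fourier g (- \<xi>)"
proof -
  have [measurable]: "g \<in> borel_measurable borel" by (rule schwartz_borel[OF assms])
  have "fourier g \<xi> = (LINT x|lborel. exp (- 2 * of_real pi * \<i> * of_real (x \<bullet> \<xi>)) * g x)"
    unfolding fourier_def by (rule integral_completion) measurable
  then show ?thesis unfolding inv_fourier_def by (simp add: inner_commute)
qed

lemma fourier_continuous:
  fixes g :: "real^'n \<Rightarrow> complex"
  assumes "g \<in> schwartz"
  shows "continuous_on UNIV (fourier g)"
proof -
  have "continuous_on UNIV (\<lambda>\<xi>. inv_fourier g (- \<xi>))"
    by (rule continuous_on_compose2[OF continuous_inv_fourier[OF schwartz_integrable[OF assms]]])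
       (auto intro!: continuous_intros)
  then show ?thesis using fourier_eq_inv_fourier[OF assms] by (simp add: fun_eq_iff cong: continuous_on_cong)
qed

text \<open>Each power of \<eta>_i is exchanged for a partial derivative, under which the Schwartz
  class is closed; the spare factor 2 * pi is at least 1.\<close>

lemma schwartz_inv_fourier_component_bound:
  fixes g :: "real^'n \<Rightarrow> complex"
  assumes "g \<in> schwartz"
  shows "\<exists>C. \<forall>\<eta>. \<bar>\<eta> $ i\<bar> ^ m * norm (inv_fourier g \<eta>) \<le> C"
  using assms
proof (induction m arbitrary: g)
  case 0
  then show ?case using norm_inv_fourier_le[of g] by auto
next
  case (Suc m)
  obtain C where C: "\<And>\<eta>. \<bar>\<eta> $ i\<bar> ^ m * norm (inv_fourier (partial_deriv i g) \<eta>) \<le> C"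
    using Suc.IH[OF partial_deriv_schwartz[OF Suc.prems, of i]] by blast
  have "\<bar>\<eta> $ i\<bar> ^ Suc m * norm (inv_fourier g \<eta>) \<le> C" for \<eta>
  proof -
    have "\<bar>\<eta> $ i\<bar> ^ Suc m * norm (inv_fourier g \<eta>) \<le> 2 * pi * (\<bar>\<eta> $ i\<bar> ^ Suc m * norm (inv_fourier g \<eta>))"
      using pi_gt3 mult_right_mono[of 1 "2 * pi" "\<bar>\<eta> $ i\<bar> ^ Suc m * norm (inv_fourier g \<eta>)"] by simp
    also have "\<dots> = \<bar>\<eta> $ i\<bar> ^ m * norm (inv_fourier (partial_deriv i g) \<eta>)"
      unfolding inv_fourier_partial_deriv[OF Suc.prems] by (simp add: norm_mult)
    also have "\<dots> \<le> C" by (rule C)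
    finally show ?thesis .
  qed
  then show ?case by blast
qed

lemma schwartz_fourier_rapid_decay:
  fixes g :: "real^'n \<Rightarrow> complex"
  assumes "g \<in> schwartz"
  shows "\<exists>C. \<forall>\<xi>. norm \<xi> ^ m * norm (fourier g \<xi>) \<le> C"
proof -
  obtain B where B: "\<And>i \<eta>. \<bar>\<eta> $ i\<bar> ^ m * norm (inv_fourier g \<eta>) \<le> B i"
    using schwartz_inv_fourier_component_bound[OF assms, of _ m] by metis
  have B0: "0 \<le> B i" for i using B[of 0 i] by (meson norm_ge_zero mult_nonneg_nonneg zero_le_power abs_ge_zero order_trans)
  let ?r = "sqrt (real CARD('n))"
  have "norm \<xi> ^ m * norm (fourier g \<xi>) \<le> ?r ^ m * (\<Sum>i\<in>UNIV. B i)" for \<xi>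
  proof -
    \<comment> \<open>A coordinate of largest modulus controls the norm up to the square root of d.
      It varies with \<xi>, hence the sum over all coordinates in the bound.\<close>
    have "infnorm \<xi> \<in> (\<lambda>b. \<bar>\<xi> \<bullet> b\<bar>) ` Basis" unfolding infnorm_Max by (intro Max_in) auto
    then obtain b where b: "b \<in> Basis" "infnorm \<xi> = \<bar>\<xi> \<bullet> b\<bar>" by blast
    then obtain i where "b = axis i 1" by (auto simp: Basis_vec_def)
    then have i: "infnorm \<xi> = \<bar>(- \<xi>) $ i\<bar>" using b(2) by (simp add: inner_axis)
    have "norm \<xi> \<le> ?r * infnorm \<xi>" using norm_le_infnorm[of \<xi>] by simp
    then have "norm \<xi> ^ m \<le> (?r * \<bar>(- \<xi>) $ i\<bar>) ^ m" unfolding i by (intro power_mono) auto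
    then have "norm \<xi> ^ m * norm (fourier g \<xi>) \<le> (?r * \<bar>(- \<xi>) $ i\<bar>) ^ m * norm (fourier g \<xi>)"
      by (rule mult_right_mono) simp
    also have "\<dots> = ?r ^ m * (\<bar>(- \<xi>) $ i\<bar> ^ m * norm (inv_fourier g (- \<xi>)))"
      by (simp only: power_mult_distrib mult.assoc fourier_eq_inv_fourier[OF assms])
    also have "\<dots> \<le> ?r ^ m * B i" by (intro mult_left_mono B) simp
    also have "\<dots> \<le> ?r ^ m * (\<Sum>i\<in>UNIV. B i)"
      using B0 by (intro mult_left_mono member_le_sum) auto
    finally show ?thesis .
  qed
  then show ?thesis by blast
qed

section \<open>Fractional derivatives and their symbols\<close>

lemma fourier_powr_integrable:
  fixes g :: "real^'n \<Rightarrow> complex"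
  assumes "g \<in> schwartz" "- real CARD('n) < b"
  shows "integrable lborel (\<lambda>\<xi>. of_real (norm \<xi> powr b) * fourier g \<xi>)"
  using assms
  by (intro integrable_powr_rapid_decay borel_measurable_continuous_onI fourier_continuous schwartz_fourier_rapid_decay) auto

lemma frac_deriv_schwartz_eq_inv_fourier:
  fixes g :: "real^'n \<Rightarrow> complex"
  assumes "g \<in> schwartz"
  shows "frac_deriv_schwartz b g = inv_fourier (\<lambda>\<xi>. of_real (norm \<xi> powr b) * fourier g \<xi>)"
proof
  fix x
  have [measurable]: "fourier g \<in> borel_measurable borel"
    by (intro borel_measurable_continuous_onI fourier_continuous assms)
  have "frac_deriv_schwartz b g x
    = (LINT \<xi>|lborel. exp (2 * of_real pi * \<i> * of_real (x \<bullet> \<xi>)) * of_real (norm \<xi> powr b) * fourier g \<xi>)"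
    unfolding frac_deriv_schwartz_def by (rule integral_completion) measurable
  then show "frac_deriv_schwartz b g x = inv_fourier (\<lambda>\<xi>. of_real (norm \<xi> powr b) * fourier g \<xi>) x"
    unfolding inv_fourier_def by (simp add: mult.assoc)
qed

lemma AE_lebesgue_imp_AE_lborel:
  fixes f h :: "'a::euclidean_space \<Rightarrow> complex"
  assumes "f \<in> borel_measurable borel" "h \<in> borel_measurable borel" "AE x in lebesgue. f x = h x"
  shows "AE x in lborel. f x = h x"
proof -
  have m: "{x. f x \<noteq> h x} \<in> sets lborel" using assms(1,2) by measurable
  have "{x. f x \<noteq> h x} \<in> null_sets lebesgue"
    using assms(3) m by (subst AE_iff_null_sets) auto
  then have "{x. f x \<noteq> h x} \<in> null_sets lborel" using null_sets_completion_iff[OF m] by simp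
  then show ?thesis by (intro AE_I'[of "{x. f x \<noteq> h x}"]) auto
qed

text \<open>The difference of the symbols is integrable and continuous away from the origin, and its
  inverse transform vanishes almost everywhere; injectivity holds at each point of continuity, so
  the conclusion is pointwise.\<close>

lemma frac_deriv_schwartz_determines_symbol:
  fixes g g' :: "real^'n \<Rightarrow> complex"
  assumes g: "g \<in> schwartz" "- real CARD('n) < b" and g': "g' \<in> schwartz" "- real CARD('n) < b'"
    and eq: "AE x in lebesgue. frac_deriv_schwartz b g x = frac_deriv_schwartz b' g' x" and "\<xi> \<noteq> 0"
  shows "of_real (norm \<xi> powr b) * fourier g \<xi> = of_real (norm \<xi> powr b') * fourier g' \<xi>"
proof -
  let ?G = "\<lambda>\<xi>. of_real (norm \<xi> powr b) * fourier g \<xi>" and ?G' = "\<lambda>\<xi>. of_real (norm \<xi> powr b') * fourier g' \<xi>"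
  note int = fourier_powr_integrable[OF g] fourier_powr_integrable[OF g']
  have "(\<lambda>\<xi>. ?G \<xi> - ?G' \<xi>) \<xi> = 0"
  proof (rule inv_fourier_eq_0_imp_eq_0[where H = "\<lambda>\<xi>. ?G \<xi> - ?G' \<xi>" and \<eta> = \<xi>])
    show "integrable lborel (\<lambda>\<xi>. ?G \<xi> - ?G' \<xi>)" using int by simp
    have "isCont (fourier g) \<xi>" "isCont (fourier g') \<xi>"
      using fourier_continuous g g' by (auto simp: continuous_on_eq_continuous_at)
    then show "isCont (\<lambda>\<xi>. ?G \<xi> - ?G' \<xi>) \<xi>"
      using \<open>\<xi> \<noteq> 0\<close> by (intro continuous_intros) auto
    have "AE x in lborel. inv_fourier ?G x = inv_fourier ?G' x"
    proof (rule AE_lebesgue_imp_AE_lborel)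
      show "AE x in lebesgue. inv_fourier ?G x = inv_fourier ?G' x"
        using eq by (simp add: frac_deriv_schwartz_eq_inv_fourier g g')
    qed (intro borel_measurable_continuous_onI continuous_inv_fourier int)+
    then show "AE x in lborel. inv_fourier (\<lambda>\<xi>. ?G \<xi> - ?G' \<xi>) x = 0"
    proof eventually_elim
      case (elim x)
      have "inv_fourier (\<lambda>\<xi>. ?G \<xi> - ?G' \<xi>) x = inv_fourier ?G x - inv_fourier ?G' x"
        unfolding inv_fourier_def right_diff_distrib
        by (rule Bochner_Integration.integral_diff) (intro inv_fourier_integrable int)+
      then show ?case using elim by simp
    qed
  qed
  then show ?thesis by simp
qed

text \<open>Evaluates the definite description: any other representation of f has the same symbol
  off the origin, hence leads to the same integrand after multiplication by
  |\<xi>|^\<sigma>.\<close>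

lemma frac_deriv_eq:
  fixes g f :: "real^'n \<Rightarrow> complex"
  assumes g: "g \<in> schwartz" and b: "- real CARD('n) < b" "- real CARD('n) < b + \<sigma>"
    and f: "AE x in lebesgue. f x = frac_deriv_schwartz b g x"
  shows "frac_deriv \<sigma> f = frac_deriv_schwartz (b + \<sigma>) g"
proof -
  let ?h = "\<lambda>b g x. LINT \<xi>|lebesgue. exp (2 * of_real pi * \<i> * of_real (x \<bullet> \<xi>)) *
            of_real (norm \<xi> powr \<sigma>) * of_real (norm \<xi> powr b) * fourier g \<xi>"
  have h: "?h b g = frac_deriv_schwartz (b + \<sigma>) g" for b and g :: "real^'n \<Rightarrow> complex"
    unfolding frac_deriv_schwartz_def fun_eq_iff
    by (intro allI Bochner_Integration.integral_cong refl) (simp add: powr_add mult_ac)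
  have "frac_deriv \<sigma> f = ?h b g"
    unfolding frac_deriv_def
  proof (rule the_equality)
    show "\<exists>g'\<in>schwartz. \<exists>b'. - real CARD('n) < b' \<and> - real CARD('n) < b' + \<sigma> \<and>
      (AE x in lebesgue. f x = frac_deriv_schwartz b' g' x) \<and> ?h b g = ?h b' g'"
      using g b f by blast
    fix h' assume "\<exists>g'\<in>schwartz. \<exists>b'. - real CARD('n) < b' \<and> - real CARD('n) < b' + \<sigma> \<and>
      (AE x in lebesgue. f x = frac_deriv_schwartz b' g' x) \<and> h' = ?h b' g'"
    then obtain g' b' where g': "g' \<in> schwartz" "- real CARD('n) < b'"
      "AE x in lebesgue. f x = frac_deriv_schwartz b' g' x" "h' = ?h b' g'" by blast
    have "AE x in lebesgue. frac_deriv_schwartz b g x = frac_deriv_schwartz b' g' x"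
      using f g'(3) by eventually_elim simp
    note sym = frac_deriv_schwartz_determines_symbol[OF g b(1) g'(1,2) this]
    have "?h b' g' = ?h b g"
      unfolding fun_eq_iff
    proof (intro allI Bochner_Integration.integral_cong refl)
      fix x \<xi> :: "real^'n"
      have "of_real (norm \<xi> powr b') * fourier g' \<xi> = of_real (norm \<xi> powr b) * fourier g \<xi>"
        \<comment> \<open>At the origin both sides are 0, since \<open>0 powr\<close> is 0 for every
          exponent.\<close>
        using sym[of \<xi>] by (cases "\<xi> = 0") auto
      then show "exp (2 * of_real pi * \<i> * complex_of_real (x \<bullet> \<xi>)) * of_real (norm \<xi> powr \<sigma>) * of_real (norm \<xi> powr b') * fourier g' \<xi>
        = exp (2 * of_real pi * \<i> * of_real (x \<bullet> \<xi>)) * of_real (norm \<xi> powr \<sigma>) * of_real (norm \<xi> powr b) * fourier g \<xi>"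
        by (simp only: mult.assoc)
    qed
    then show "h' = ?h b g" using g'(4) by simp
  qed
  then show ?thesis using h by simp
qed

section \<open>The weighted inequality\<close>

theorem theorem2p8:
  fixes v w :: "real^'n \<Rightarrow> real" and p q s t :: real
  assumes "1 < p" and "p \<le> q"
    and "t < s" and "s < t + real CARD('n)"
    and "weight v" and "weight w"
    and "(v, w) \<in> A_pq (s - t) p q"
    and "(\<lambda>x. v x powr (- conj_exp p / p)) \<in> A_infty" and "w \<in> A_infty"
  shows "\<exists>C::real. C > 0 \<and>
    (\<forall>f \<in> D_gt_schwartz (max (- real CARD('n)) (- t)).
       \<exists>P. polynomial_of_degree_le (nat \<lfloor>s - t\<rfloor>) P \<and>
         Lp_norm q w (\<lambda>x. frac_deriv t f x - P x) \<le> ennreal C * Lp_norm p v (frac_deriv s f))"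
proof -
  let ?d = "real CARD('n)"
  define \<alpha> where "\<alpha> = s - t"
  have \<alpha>: "0 < \<alpha>" "\<alpha> < ?d" using assms(3,4) by (auto simp: \<alpha>_def)
  obtain C where C: "0 \<le> C"
    "\<And>h u B J. h \<in> borel_measurable borel \<Longrightarrow> (\<And>x. 0 \<le> h x) \<Longrightarrow> (\<And>x. h x \<le> B) \<Longrightarrow> 0 \<le> J \<Longrightarrow>
      (\<integral>\<^sup>+x. ennreal (h x powr p * v x) \<partial>lebesgue) \<le> ennreal J \<Longrightarrow> (\<And>x. 0 \<le> u x) \<Longrightarrow>
      (\<And>x. ennreal (u x) \<le> (\<integral>\<^sup>+y. ennreal (norm (x - y) powr (\<alpha> - ?d) * h y) \<partial>lborel)) \<Longrightarrow>
      (\<integral>\<^sup>+x. ennreal (u x powr q * w x) \<partial>lebesgue) \<le> ennreal (C * J powr (q / p))"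
  proof (rule riesz_potential_two_weight[OF assms(1,2) \<alpha> assms(7)[folded \<alpha>_def] assms(8,9)], goal_cases)
    case (1 C)
    show ?thesis by (rule that[OF 1(2)], rule 1(3))
  qed
  have "\<alpha> < real DIM(real^'n)" using \<alpha> by simp
  then obtain c where c: "0 \<le> c"
    "\<And>(H :: real^'n \<Rightarrow> complex) x. integrable lborel H \<Longrightarrow> integrable lborel (\<lambda>\<xi>. of_real (norm \<xi> powr - \<alpha>) * H \<xi>) \<Longrightarrow>
      ennreal (norm (inv_fourier (\<lambda>\<xi>. of_real (norm \<xi> powr - \<alpha>) * H \<xi>) x))
      \<le> (\<integral>\<^sup>+y. ennreal (norm (x - y) powr (\<alpha> - real DIM(real^'n)) * (c * norm (inv_fourier H y))) \<partial>lborel)"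
  proof (rule inv_fourier_riesz_bound[OF \<alpha>(1), where 'a = "real^'n"], goal_cases)
    case (1 c)
    show ?thesis by (rule that[OF 1(2)], rule 1(3))
  qed
  \<comment> \<open>\<open>C powr (1 / q) * c\<close> is what the q-th root of the integral bound
    leaves; the summand 1 keeps the constant positive.\<close>
  define C' where "C' = C powr (1 / q) * c + 1"
  show ?thesis
  proof (intro exI[of _ C'] conjI ballI)
    show "0 < C'" using c(1) by (simp add: C'_def add_nonneg_pos)
    fix f :: "real^'n \<Rightarrow> complex"
    assume "f \<in> D_gt_schwartz (max (- ?d) (- t))"
    then obtain g b where g: "g \<in> schwartz" and b: "max (- ?d) (- t) < b"
      and f: "AE x in lebesgue. f x = frac_deriv_schwartz b g x"
      unfolding D_gt_schwartz_def by blast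
    \<comment> \<open>The choice of \<tau> gives b > -d and b + t > 0, and b + s exceeds b + t; so
      all three symbols are integrable.\<close>
    have b': "- ?d < b" "- ?d < b + t" "- ?d < b + s" using b assms(3) by auto
    define H where "H \<xi> = of_real (norm \<xi> powr (b + s)) * fourier g \<xi>" for \<xi>
    have H: "integrable lborel H" unfolding H_def by (rule fourier_powr_integrable[OF g b'(3)])
    have Hs: "frac_deriv s f = inv_fourier H"
      using frac_deriv_eq[OF g b'(1,3) f] by (simp add: frac_deriv_schwartz_eq_inv_fourier[OF g] H_def[abs_def])
    have H\<alpha>: "(\<lambda>\<xi>. of_real (norm \<xi> powr - \<alpha>) * H \<xi>) = (\<lambda>\<xi>. of_real (norm \<xi> powr (b + t)) * fourier g \<xi>)"
    proof
      fix \<xi> :: "real^'n"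
      have "norm \<xi> powr - \<alpha> * norm \<xi> powr (b + s) = norm \<xi> powr (b + t)"
        by (simp add: \<alpha>_def add.commute flip: powr_add)
      then show "of_real (norm \<xi> powr - \<alpha>) * H \<xi> = of_real (norm \<xi> powr (b + t)) * fourier g \<xi>"
        unfolding H_def mult.assoc[symmetric] of_real_mult[symmetric] by (simp only:)
    qed
    have H\<alpha>_int: "integrable lborel (\<lambda>\<xi>. of_real (norm \<xi> powr - \<alpha>) * H \<xi>)"
      unfolding H\<alpha> by (rule fourier_powr_integrable[OF g b'(2)])
    have Ht: "frac_deriv t f = inv_fourier (\<lambda>\<xi>. of_real (norm \<xi> powr - \<alpha>) * H \<xi>)"
      using frac_deriv_eq[OF g b'(1,2) f] by (simp add: frac_deriv_schwartz_eq_inv_fourier[OF g] H\<alpha>)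
    let ?F = "frac_deriv t f" and ?h = "frac_deriv s f"
    have q: "0 < q" and p: "0 < p" using assms(1,2) by auto
    have "Lp_norm q w ?F \<le> ennreal C' * Lp_norm p v ?h"
    \<comment> \<open>If D^s f is not in L^p(v), the right-hand side is infinite because C' > 0.
      Otherwise its integral is a real number and can serve as J.\<close>
    proof (cases "(\<integral>\<^sup>+x. ennreal (norm (?h x) powr p * v x) \<partial>lebesgue) = \<infinity>")
      case True
      then have "Lp_norm p v ?h = \<infinity>" by (simp add: Lp_norm_def ennreal_powr_def)
      then show ?thesis using \<open>0 < C'\<close> by (simp add: ennreal_mult_top)
    next
      case False
      then obtain i where i: "(\<integral>\<^sup>+x. ennreal (norm (?h x) powr p * v x) \<partial>lebesgue) = ennreal i" "0 \<le> i"
        by (cases "\<integral>\<^sup>+x. ennreal (norm (?h x) powr p * v x) \<partial>lebesgue") auto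
      have hm[measurable]: "inv_fourier H \<in> borel_measurable borel"
        by (intro borel_measurable_continuous_onI continuous_inv_fourier H)
      have "(\<integral>\<^sup>+x. ennreal (norm (?F x) powr q * w x) \<partial>lebesgue) \<le> ennreal (C * (c powr p * i) powr (q / p))"
      proof (rule C(2)[where h = "\<lambda>y. c * norm (?h y)" and B = "c * (LINT \<xi>|lborel. norm (H \<xi>))"])
        \<comment> \<open>D^s f is the inverse transform of an integrable symbol and therefore
          bounded; this bound depends on f but does not enter the constant.\<close>
        show "c * norm (?h x) \<le> c * (LINT \<xi>|lborel. norm (H \<xi>))" for x
          unfolding Hs by (intro mult_left_mono norm_inv_fourier_le c(1))
        have "(\<integral>\<^sup>+x. ennreal ((c * norm (?h x)) powr p * v x) \<partial>lebesgue)
          = (\<integral>\<^sup>+x. ennreal (c powr p) * ennreal (norm (?h x) powr p * v x) \<partial>lebesgue)"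
          using c(1) by (intro nn_integral_cong) (simp add: powr_mult mult.assoc flip: ennreal_mult')
        also have "\<dots> = ennreal (c powr p) * ennreal i"
          unfolding i(1)[symmetric]
        proof (rule nn_integral_cmult)
          have "inv_fourier H \<in> borel_measurable lebesgue" using hm by (simp add: measurable_completion)
          then show "(\<lambda>x. ennreal (norm (?h x) powr p * v x)) \<in> borel_measurable lebesgue"
            unfolding Hs using weight_measurable[OF assms(5)] by measurable
        qed
        also have "\<dots> = ennreal (c powr p * i)" using i(2) by (simp add: ennreal_mult)
        finally show "(\<integral>\<^sup>+x. ennreal ((c * norm (?h x)) powr p * v x) \<partial>lebesgue) \<le> ennreal (c powr p * i)" by simp
        show "ennreal (norm (?F x)) \<le> (\<integral>\<^sup>+y. ennreal (norm (x - y) powr (\<alpha> - ?d) * (c * norm (?h y))) \<partial>lborel)" for x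
          using c(2)[OF H H\<alpha>_int, of x] unfolding Hs Ht by simp
      qed (use c(1) i(2) in \<open>auto simp: Hs\<close>)
      then obtain r where r: "(\<integral>\<^sup>+x. ennreal (norm (?F x) powr q * w x) \<partial>lebesgue) = ennreal r" "0 \<le> r"
        "r \<le> C * (c powr p * i) powr (q / p)"
        using C(1) i(2) by (cases "\<integral>\<^sup>+x. ennreal (norm (?F x) powr q * w x) \<partial>lebesgue") (auto simp: top_unique)
      have "r powr (1 / q) \<le> (C * (c powr p * i) powr (q / p)) powr (1 / q)"
        using r q by (intro powr_mono2) auto
      also have "\<dots> = C powr (1 / q) * c * i powr (1 / p)"
        using C(1) c(1) i(2) p q by (simp add: powr_mult powr_powr)
      also have "\<dots> \<le> C' * i powr (1 / p)"
        by (intro mult_right_mono) (auto simp: C'_def)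
      finally have "ennreal (r powr (1 / q)) \<le> ennreal C' * ennreal (i powr (1 / p))"
        using \<open>0 < C'\<close> by (simp add: ennreal_leI flip: ennreal_mult)
      then show ?thesis using r i by (simp add: Lp_norm_def ennreal_powr_def)
    qed
    moreover have "polynomial_of_degree_le (nat \<lfloor>s - t\<rfloor>) (\<lambda>_ :: real^'n. 0)"
      unfolding polynomial_of_degree_le_def by (intro exI[of _ "\<lambda>_. 0"]) simp
    ultimately show "\<exists>P. polynomial_of_degree_le (nat \<lfloor>s - t\<rfloor>) P \<and>
         Lp_norm q w (\<lambda>x. ?F x - P x) \<le> ennreal C' * Lp_norm p v ?h"
      by (intro exI[of _ "\<lambda>_. 0"]) simp
  qed
qed

end
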